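(* Let $1<p<\infty$, $\frac1p+\frac1{p'}=1$. Let $h=h_-r^kh_+$ with $h_\pm\in\mathcal GH_\infty^\pm$, $k\in\mathbb Z$, and $$g=h\,r_\infty^{\alpha_\infty}\left(\prod_{j=1}^m r_{c_j}^{\alpha_j}\right)\left(\prod_{j=1}^s r_{d_j}^{1/p}\right),$$ where $m,s$ are non-negative integers, $c_j$ $(j=1,\dots,m)$ and $d_j$ $(j=1,\dots,s)$ are distinct real numbers, and $$-\frac1p<\alpha_\infty\le\frac1{p'},\qquad -\frac1{p'}<\alpha_j<\frac1p\ \text{ for all } j=1,\dots,m .$$ Consider Toeplitz operators in $H_p^+$. Then: (i) if $-\frac1p<\alpha_\infty<\frac1{p'}$, then $\dim\ker T_g=\max\{0,-k-s\}=\max\{0,\dim\ker T_h-s\}$ and, if $k<-s$, $$\ker T_g=h_+^{-1}\prod_{j=1}^s\left(\frac{\xi+i}{\xi-d_j}\right)^{1/p}\prod_{j=1}^m\left(\frac{\xi+i}{\xi-c_j}\right)^{\alpha_j}(\xi+i)^{\alpha_\infty}K_0,$$ with $K_0=\{\psi_+\in K_{r^{|k|}}:\psi_+(d_j)=0,\ j=1,\dots,s\}$; (ii) if $\alpha_\infty=\frac1{p'}$, then $\dim\ker T_g=\max\{0,-k-s-1\}=\max\{0,\dim\ker T_h-s-1\}$ and, if $k<-s-1$, $$\ker T_g=h_+^{-1}\prod_{j=1}^s\left(\frac{\xi+i}{\xi-d_j}\right)^{1/p}\prod_{j=1}^m\left(\frac{\xi+i}{\xi-c_j}\right)^{\alpha_j}\frac{(\xi+i)^{1/p'}}{\xi+i}\,\widetilde{K_0},$$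 with $\widetilde{K_0}=\{\psi_+\in K_{r^{|k|-1}}:\psi_+(d_j)=0,\ j=1,\dots,s\}$.
   Context: $L_p=L^p(\mathbb R)$; $H_p^+=H^p(\mathbb C^+)$ and $H_p^-=\overline{H_p^+}=H^p(\mathbb C^-)$, identified with closed subspaces of $L_p$ via boundary values; $H_\infty^\pm$ is the algebra of bounded analytic functions in $\mathbb C^\pm$ and $\mathcal GH_\infty^\pm$ its group of invertible elements. For a (here bounded) symbol $g$, $T_g\phi_+=P^+(g\phi_+)$ on $H_p^+$, with $P^+$ the projection of $L_p$ onto $H_p^+$ parallel to $H_p^-$; thus $\ker T_g=\{\phi_+\in H_p^+: g\phi_+\in H_p^-\}$. $r(\xi)=\frac{\xi-i}{\xi+i}$; for $n\in\mathbb N$, $K_{r^n}=\operatorname{span}\left\{\frac1{\xi+i}\left(\frac{\xi-i}{\xi+i}\right)^j: j=0,\dots,n-1\right\}$. For $c\in\mathbb R\cup\{\infty\}$ and a real exponent $\alpha$, $z_c^\alpha=e^{\alpha\log z}$, where the branch cut of $\log$ connects $0$ to $\infty$ and intersects the unit circle (only) at $z_0=\frac{c-i}{c+i}$ ($z_0=1$ if $c=\infty$), with $\log 1=0$ (for $c=\infty$ the value at $1$ is understood as a one-sided limit; non-zero constant factors are immaterial for kernels); $r_c^\alpha(\xi)=\left(\frac{\xi-i}{\xi+i}\right)_c^\alpha$, $\xi\in\mathbb R$. The powers $\left(\frac{\xi+i}{\xi-c}\right)^{\alpha}$ and $(\xi+i)^\alpha$ are branches analytic in $\mathbb C^+$.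 Empty products are equal to $1$. *)

theory Defs
  imports "HOL-Analysis.Analysis"
begin

abbreviation C_plus :: "complex set" where "C_plus \<equiv> {z. Im z > 0}"
abbreviation C_minus :: "complex set" where "C_minus \<equiv> {z. Im z < 0}"

text \<open>
  Elements of \<open>L_p(\<real>)\<close> are represented by functions on \<open>\<real>\<close>; all sets of such functions below
  are closed under equality almost everywhere. Below \<open>U\<close> is one of \<open>C_plus\<close>, \<open>C_minus\<close>.
\<close>

text \<open>Boundary values are limits along vertical lines; for Hardy functions they agree a.e. with
  the non-tangential limits.\<close>

definition has_boundary_value :: "complex set \<Rightarrow> (complex \<Rightarrow> complex) \<Rightarrow> (real \<Rightarrow> complex) \<Rightarrow> bool" where
  "has_boundary_value U F f \<longleftrightarrow>
     (AE x in lebesgue. (F \<longlongrightarrow> f x) (at (complex_of_real x) within {z \<in> U. Re z = x}))"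

definition Hardy :: "complex set \<Rightarrow> real \<Rightarrow> (real \<Rightarrow> complex) set" where
  "Hardy U p = {f. \<exists>F. F holomorphic_on U \<and>
     (\<exists>C. \<forall>y. Complex 0 y \<in> U \<longrightarrow>
        (\<integral>\<^sup>+x. ennreal (cmod (F (Complex x y)) powr p) \<partial>lebesgue) \<le> ennreal C) \<and>
     has_boundary_value U F f}"

definition Hardy_inf :: "complex set \<Rightarrow> (real \<Rightarrow> complex) set" where
  "Hardy_inf U = {f. \<exists>F. F holomorphic_on U \<and> bounded (F ` U) \<and> has_boundary_value U F f}"

definition G_Hardy_inf :: "complex set \<Rightarrow> (real \<Rightarrow> complex) set" where
  "G_Hardy_inf U = {f \<in> Hardy_inf U. \<exists>g \<in> Hardy_inf U. AE x in lebesgue. f x * g x = 1}"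

text \<open>
  The projection of \<open>L_p\<close> onto \<open>H_p\<^sup>+\<close> parallel to \<open>H_p\<^sup>-\<close>, given by its graph: \<open>u\<close> is the image
  of \<open>f\<close> iff \<open>f = u + v\<close> with \<open>u \<in> H_p\<^sup>+\<close>, \<open>v \<in> H_p\<^sup>-\<close>. For \<open>1 < p < \<infinity>\<close> the space \<open>L_p\<close> is the
  direct sum of \<open>H_p\<^sup>+\<close> and \<open>H_p\<^sup>-\<close>, so up to a.e. equality this graph is that of an operator
  defined on all of \<open>L_p\<close>.
\<close>

definition proj_plus :: "real \<Rightarrow> (real \<Rightarrow> complex) \<Rightarrow> (real \<Rightarrow> complex) \<Rightarrow> bool" where
  "proj_plus p f u \<longleftrightarrow> u \<in> Hardy C_plus p \<and> (\<lambda>x. f x - u x) \<in> Hardy C_minus p"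

text \<open>\<open>toeplitz p g \<phi> \<psi>\<close> means \<open>T_g \<phi> = \<psi>\<close>.\<close>

definition toeplitz :: "real \<Rightarrow> (real \<Rightarrow> complex) \<Rightarrow> (real \<Rightarrow> complex) \<Rightarrow> (real \<Rightarrow> complex) \<Rightarrow> bool" where
  "toeplitz p g \<phi> \<psi> \<longleftrightarrow> \<phi> \<in> Hardy C_plus p \<and> proj_plus p (\<lambda>x. g x * \<phi> x) \<psi>"

definition toeplitz_ker :: "real \<Rightarrow> (real \<Rightarrow> complex) \<Rightarrow> (real \<Rightarrow> complex) set" where
  "toeplitz_ker p g = {\<phi>. toeplitz p g \<phi> (\<lambda>x. 0)}"

lemma zero_in_Hardy: "(\<lambda>x. 0) \<in> Hardy U p"
  unfolding Hardy_def has_boundary_value_def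
  by (rule CollectI, rule exI[of _ "\<lambda>z. 0"]) auto

lemma toeplitz_ker_iff:
  "\<phi> \<in> toeplitz_ker p g \<longleftrightarrow> \<phi> \<in> Hardy C_plus p \<and> (\<lambda>x. g x * \<phi> x) \<in> Hardy C_minus p"
  by (simp add: toeplitz_ker_def toeplitz_def proj_plus_def zero_in_Hardy)

text \<open>
  Dimension over \<open>\<complex>\<close> of a space of functions in which functions equal a.e. are identified: the
  largest number of linearly independent elements, \<open>\<infinity>\<close> if there is none.
\<close>

definition ae_independent :: "nat \<Rightarrow> (nat \<Rightarrow> real \<Rightarrow> complex) \<Rightarrow> bool" where
  "ae_independent n b \<longleftrightarrow>
     (\<forall>a :: nat \<Rightarrow> complex. (AE x in lebesgue. (\<Sum>i<n. a i * b i x) = 0) \<longrightarrow> (\<forall>i<n. a i = 0))"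

definition ae_dim :: "(real \<Rightarrow> complex) set \<Rightarrow> enat" where
  "ae_dim V = (SUP n \<in> {n. \<exists>b. (\<forall>i<n. b i \<in> V) \<and> ae_independent n b}. enat n)"

definition r :: "real \<Rightarrow> complex" where
  "r \<xi> = (of_real \<xi> - \<i>) / (of_real \<xi> + \<i>)"

definition K_r :: "nat \<Rightarrow> (real \<Rightarrow> complex) set" where
  "K_r n = {\<psi>. \<exists>a :: nat \<Rightarrow> complex. \<psi> = (\<lambda>\<xi>. \<Sum>j<n. a j * (1 / (of_real \<xi> + \<i>) * r \<xi> ^ j))}"

text \<open>
  The branch of the logarithm whose cut is the ray from \<open>0\<close> through \<open>z0\<close> (\<open>\<bar>z0\<bar> = 1\<close>), with value
  \<open>0\<close> at \<open>1\<close>. For \<open>z0 = 1\<close> the value \<open>0\<close> at \<open>1\<close> is the limit from below the cut, that is,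
  the limit of \<open>log_cut 1 (r \<xi>)\<close> as \<open>\<xi> \<rightarrow> +\<infinity>\<close>. The limit from above would change powers only by
  a constant factor, which leaves kernels unchanged.
\<close>

definition log_cut :: "complex \<Rightarrow> complex \<Rightarrow> complex" where
  "log_cut z0 z = Ln (- (z / z0)) - Ln (- (1 / z0))"

lemma exp_log_cut: "z0 \<noteq> 0 \<Longrightarrow> z \<noteq> 0 \<Longrightarrow> exp (log_cut z0 z) = z"
  by (simp add: log_cut_def exp_diff)

lemma log_cut_1: "log_cut z0 1 = 0"
  by (simp add: log_cut_def)

lemma holomorphic_log_cut:
  assumes "z0 \<noteq> 0"
  shows "log_cut z0 holomorphic_on (- {of_real t * z0 | t. t \<ge> 0})"
proof -
  have "- (z / z0) \<notin> \<real>\<^sub>\<le>\<^sub>0" if z: "z \<notin> {of_real t * z0 | t. t \<ge> 0}" for z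
  proof
    assume "- (z / z0) \<in> \<real>\<^sub>\<le>\<^sub>0"
    then obtain t where "- (z / z0) = of_real t" "t \<le> 0"
      by (rule nonpos_Reals_cases) blast
    then have "z = of_real (- t) * z0" "- t \<ge> 0"
      using assms by (auto simp: field_simps) (metis minus_minus)
    with z show False by blast
  qed
  then show ?thesis
    unfolding log_cut_def using assms
    by (intro holomorphic_intros) auto
qed

lemma log_cut_one_sided: "((\<lambda>\<xi>. log_cut 1 (r \<xi>)) \<longlongrightarrow> 0) at_top"
proof -
  have eq: "log_cut 1 (r \<xi>) = Ln (r \<xi>)" if "\<xi> > 0" for \<xi>
  proof -
    have nz: "\<xi>\<^sup>2 + 1 > 0" by (simp add: add_nonneg_pos)
    have "Im (r \<xi>) = - 2 * \<xi> / (\<xi>\<^sup>2 + 1)"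
      by (simp add: r_def Im_divide power2_eq_square)
    then have "Im (r \<xi>) < 0" using that nz by (simp add: divide_neg_pos)
    then have "Ln (- r \<xi>) = Ln (r \<xi>) + \<i> * of_real pi"
      by (subst Ln_minus) auto
    then show ?thesis by (simp add: log_cut_def)
  qed
  have "(r \<longlongrightarrow> 1) at_top"
  proof -
    have "cmod (r \<xi> - 1) \<le> 2 / \<xi>" if "\<xi> > 0" for \<xi>
    proof -
      have nz: "of_real \<xi> + \<i> \<noteq> 0" by (simp add: complex_eq_iff)
      have "r \<xi> - 1 = - 2 * \<i> / (of_real \<xi> + \<i>)"
        using nz by (simp add: r_def field_simps)
      then have "cmod (r \<xi> - 1) = 2 / cmod (of_real \<xi> + \<i>)"
        by (simp add: norm_divide norm_mult)
      moreover have "\<xi> \<le> cmod (of_real \<xi> + \<i>)"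
        using complex_Re_le_cmod[of "of_real \<xi> + \<i>"] by simp
      ultimately show ?thesis using that by (simp add: frac_le)
    qed
    then have "\<forall>\<^sub>F \<xi> in at_top. cmod (r \<xi> - 1) \<le> 2 / \<xi>"
      by (intro eventually_mono[OF eventually_gt_at_top[of 0]]) auto
    moreover have "((\<lambda>\<xi>::real. 2 / \<xi>) \<longlongrightarrow> 0) at_top"
      by (intro tendsto_divide_0[OF tendsto_const] filterlim_at_top_imp_at_infinity filterlim_ident)
    ultimately have "((\<lambda>\<xi>. r \<xi> - 1) \<longlongrightarrow> 0) at_top"
      by (rule Lim_null_comparison)
    then show ?thesis by (simp add: LIM_zero_iff)
  qed
  then have "((\<lambda>\<xi>. Ln (r \<xi>)) \<longlongrightarrow> Ln 1) at_top"
    by (rule tendsto_Ln) auto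
  then show ?thesis
    using eq by (auto elim!: Lim_transform_eventually intro: eventually_mono[OF eventually_gt_at_top[of 0]])
qed

text \<open>\<open>r_pow_at z0 \<alpha>\<close> is \<open>r_c\<^sup>\<alpha>\<close>, where \<open>z0 = r c\<close>, and \<open>z0 = 1\<close> for \<open>c = \<infinity>\<close>.\<close>

definition r_pow_at :: "complex \<Rightarrow> real \<Rightarrow> real \<Rightarrow> complex" where
  "r_pow_at z0 \<alpha> \<xi> = exp (of_real \<alpha> * log_cut z0 (r \<xi>))"

definition r_pow :: "real \<Rightarrow> real \<Rightarrow> real \<Rightarrow> complex" where
  "r_pow c = r_pow_at (r c)"

definition r_pow_inf :: "real \<Rightarrow> real \<Rightarrow> complex" where
  "r_pow_inf = r_pow_at 1"

text \<open>
  The powers \<open>((\<xi> + \<i>) / (\<xi> - c))\<^sup>\<alpha>\<close> and \<open>(\<xi> + \<i>)\<^sup>\<alpha>\<close> are principal powers: these are analytic in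
  the upper half-plane, continuous up to \<open>\<real>\<close> (except at \<open>c\<close>);
  any other analytic branch differs by a non-zero constant factor.
\<close>

definition w_pow :: "real \<Rightarrow> real \<Rightarrow> real \<Rightarrow> complex" where
  "w_pow c \<alpha> \<xi> = ((of_real \<xi> + \<i>) / (of_real \<xi> - of_real c)) powr of_real \<alpha>"

lemma w_not_nonpos:
  assumes "Im z \<ge> 0" "z \<noteq> of_real c"
  shows "(z + \<i>) / (z - of_real c) \<notin> \<real>\<^sub>\<le>\<^sub>0"
proof
  assume "(z + \<i>) / (z - of_real c) \<in> \<real>\<^sub>\<le>\<^sub>0"
  then obtain t where t: "(z + \<i>) / (z - of_real c) = of_real t" "t \<le> 0"
    by (auto elim: nonpos_Reals_cases)
  then have "z + \<i> = of_real t * (z - of_real c)"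
    using assms by (auto simp: field_simps)
  then have "Im z + 1 = t * Im z"
    by (auto simp: complex_eq_iff)
  moreover have "t * Im z \<le> 0"
    using assms t by (simp add: mult_nonpos_nonneg)
  ultimately show False using assms by linarith
qed

lemma w_pow_analytic:
  "(\<lambda>z. ((z + \<i>) / (z - of_real c)) powr of_real \<alpha>) holomorphic_on C_plus"
  "continuous_on ({z. Im z \<ge> 0} - {of_real c}) (\<lambda>z. ((z + \<i>) / (z - of_real c)) powr of_real \<alpha>)"
proof -
  show "(\<lambda>z. ((z + \<i>) / (z - of_real c)) powr of_real \<alpha>) holomorphic_on C_plus"
    by (intro holomorphic_intros w_not_nonpos) auto
next
  show "continuous_on ({z. Im z \<ge> 0} - {of_real c}) (\<lambda>z. ((z + \<i>) / (z - of_real c)) powr of_real \<alpha>)"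
  proof (rule continuous_on_powr_complex)
    show "{z. Im z \<ge> 0} - {of_real c} \<subseteq>
        {z. Re ((z + \<i>) / (z - of_real c)) \<ge> 0 \<or> Im ((z + \<i>) / (z - of_real c)) \<noteq> 0}"
    proof
      fix z assume "z \<in> {z. Im z \<ge> 0} - {complex_of_real c}"
      then have "(z + \<i>) / (z - of_real c) \<notin> \<real>\<^sub>\<le>\<^sub>0"
        using w_not_nonpos by auto
      then show "z \<in> {z. Re ((z + \<i>) / (z - of_real c)) \<ge> 0 \<or> Im ((z + \<i>) / (z - of_real c)) \<noteq> 0}"
        unfolding complex_nonpos_Reals_iff mem_Collect_eq by linarith
    qed
  next
    fix z assume z: "z \<in> {z. Im z \<ge> 0} - {complex_of_real c}" "(z + \<i>) / (z - of_real c) = 0"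
    with w_not_nonpos[of z c] show "0 < Re (complex_of_real \<alpha>)" by auto
  qed (auto intro!: continuous_intros)
qed

lemma shift_pow_analytic:
  "(\<lambda>z. (z + \<i>) powr of_real \<alpha>) holomorphic_on {z. Im z > - 1}"
  by (intro holomorphic_intros) (auto simp: complex_nonpos_Reals_iff)

end

(*
  On the real line each factor of the symbol splits as r_c^a = conj(w) / w with
  w = ((x + i)/(x - c))^a analytic in the upper half-plane, and r_oo^a splits in the same way
  through (x + i)^a. Let V be the product of all these functions and n = -k. Then phi lies in the
  kernel iff u_1 = h_+ phi V^{-1} (x + i)^n and the analogous quotient u_2 built from the
  complex conjugate of g phi satisfy u_1 = conj(u_2) a.e. on the real line. Both are boundary
  values of analytic functions U_1, U_2 in the upper half-plane.

  The bounds on the exponents make U_1 and U_2 locally bounded in some L^t, t > 1, on horizontal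
  lines and O(y^{-b}), b < 1, near the real line. Hence primitives of U_1(z) and of
  conj(U_2(conj z)) extend continuously to the real line and agree there, so that U_1 continues
  to an entire function. The pointwise estimate |F(x + iy)| <= C y^{-1/p} in H_p controls its
  growth, and it is a polynomial P of degree < n. Finally V P (z + i)^{-n} is in H_p iff P
  vanishes at all points with exponent 1/p and, if the exponent at infinity is 1/p', also
  deg P < n - 1: otherwise a logarithmic divergence appears.
*)
theory Submission
  imports Defs "HOL-Complex_Analysis.Complex_Analysis"
begin

subsection \<open>Entire functions with an integrable singularity of the growth bound\<close>

text \<open>The obstacle is that boundary values are given only almost everywhere, as limits along
  vertical lines; neither Poisson integrals nor norm convergence to the boundary is used. The two
  quotients are therefore compared only through integrals over segments, which forces the passage to
  primitives. Two inequalities carry the continuation. The lower bound -1/p' at the finite points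
  leaves a margin that keeps the blow-up exponent of the quotients below 1. The bound a > -1/p at
  infinity puts the threshold n - a - 1/p, above which Taylor coefficients vanish, strictly below n.
  The upper bounds decide which weighted polynomials belong to H_p. The points c_j and d_j form a
  single finite set with an exponent function; the prescribed zeros are the points where the
  exponent attains 1/p. The symbol h is the case of the empty set and exponent 0 at infinity, so
  both dimensions come from one characterization.\<close>

text \<open>On \<open>\<bar>z\<bar> = R\<close> one has \<open>\<bar>z\<^sup>2 - R\<^sup>2\<bar> = 2 R \<bar>Im z\<bar>\<close>; integrating \<open>(z\<^sup>2 - R\<^sup>2) E(z) / z\<^sup>k\<^sup>+\<^sup>1\<close> over this
  circle compensates the blow-up of the bound at the real axis.\<close>

lemma entire_taylor_coeff_eq_0:
  fixes E :: "complex \<Rightarrow> complex" and M C R0 :: real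
  assumes E: "E holomorphic_on UNIV"
    and bd: "\<And>z. cmod z \<ge> R0 \<Longrightarrow> \<bar>Im z\<bar> * cmod (E z) \<le> C * cmod z powr M"
    and k: "real k > M - 1"
  shows "(deriv ^^ k) E 0 = 0"
proof (rule ccontr)
  \<comment> \<open>\<open>A\<close> and \<open>B\<close> are the integrals over a circle of
    \<open>E z / z ^ (k + 1)\<close> and \<open>z^2 * E z / z ^ (k + 1)\<close>. Neither depends on
    the radius, so a bound of order less than \<open>R^2\<close> on \<open>B - R^2 * A\<close>
    forces \<open>A = 0\<close>.\<close>
  define A where "A = (2 * pi * \<i>) / fact k * (deriv ^^ k) E 0"
  define B where "B = (2 * pi * \<i>) / fact k * (deriv ^^ k) (\<lambda>z. z^2 * E z) 0"
  assume "(deriv ^^ k) E 0 \<noteq> 0"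
  then have "A \<noteq> 0" by (simp add: A_def)
  have C0: "C \<ge> 0"
  proof -
    have "0 \<le> C * cmod (complex_of_real (max R0 1)) powr M"
      using bd[of "complex_of_real (max R0 1)"] by simp
    then show ?thesis by (auto simp: zero_le_mult_iff max_def split: if_splits)
  qed
  have main: "cmod (B - of_real (R^2) * A) \<le> 4 * pi * C * R powr (M + 1 - real k)" if R: "R \<ge> R0" "R > 0" for R
  proof -
    have E': "E holomorphic_on S" for S using E holomorphic_on_subset by blast
    have E'': "(\<lambda>z. z^2 * E z) holomorphic_on S" for S using E' by (intro holomorphic_intros)
    have 1: "((\<lambda>u. E u / (u-0) ^ (Suc k)) has_contour_integral A) (circlepath 0 R)"
      unfolding A_def using R
      by (intro Cauchy_has_contour_integral_higher_derivative_circlepath holomorphic_on_imp_continuous_on E') auto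
    have 2: "((\<lambda>u. u^2 * E u / (u-0) ^ (Suc k)) has_contour_integral B) (circlepath 0 R)"
      unfolding B_def using R
      by (intro Cauchy_has_contour_integral_higher_derivative_circlepath holomorphic_on_imp_continuous_on E'') auto
    have 3: "((\<lambda>u. u^2 * E u / (u-0) ^ (Suc k) - of_real (R^2) * (E u / (u-0) ^ (Suc k)))
        has_contour_integral (B - of_real (R^2) * A)) (circlepath 0 R)"
      by (intro has_contour_integral_diff has_contour_integral_lmul 1 2)
    have "cmod (B - of_real (R^2) * A) \<le> 2 * C * R powr (M - real k) * (2 * pi * R)"
    proof (rule has_contour_integral_bound_circlepath[OF 3])
      fix z assume "cmod (z - 0) = R"
      then have z: "cmod z = R" by simp
      have "z^2 - of_real (R^2) = z * (z - cnj z)"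
        using complex_norm_square[of z] z by (simp add: power2_eq_square algebra_simps)
      then have "cmod (z^2 - of_real (R^2)) = 2 * R * \<bar>Im z\<bar>"
        by (simp add: norm_mult z complex_diff_cnj)
      moreover have "z^2 * E z / (z-0) ^ (Suc k) - of_real (R^2) * (E z / (z-0) ^ (Suc k))
          = (z^2 - of_real (R^2)) * E z / z ^ Suc k" by (simp add: algebra_simps diff_divide_distrib)
      ultimately have "cmod (z^2 * E z / (z-0) ^ (Suc k) - of_real (R^2) * (E z / (z-0) ^ (Suc k)))
          = 2 * R * (\<bar>Im z\<bar> * cmod (E z)) / R ^ Suc k"
        by (simp add: norm_mult norm_divide norm_power z)
      also have "\<dots> \<le> 2 * R * (C * R powr M) / R ^ Suc k"
        using bd[of z] z R by (intro divide_right_mono mult_left_mono) auto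
      also have "\<dots> = 2 * C * R powr (M - real k)"
        using R by (simp add: powr_diff powr_realpow)
      finally show "cmod (z^2 * E z / (z-0) ^ (Suc k) - of_real (R^2) * (E z / (z-0) ^ (Suc k))) \<le> 2 * C * R powr (M - real k)" .
    qed (use R C0 in auto)
    also have "\<dots> = 4 * pi * C * (R powr (M - real k) * R powr 1)" using R by simp
    also have "R powr (M - real k) * R powr 1 = R powr (M + 1 - real k)"
      unfolding powr_add[symmetric] by (simp add: algebra_simps)
    finally show ?thesis .
  qed
  have "cmod A \<le> 4 * pi * C * R powr (M - 1 - real k) + cmod B * R powr (-2)" if R: "R \<ge> R0" "R > 0" for R
  proof -
    have "R^2 * cmod A = cmod (of_real (R^2) * A)" by (simp add: norm_mult norm_power)
    also have "\<dots> \<le> cmod B + cmod (B - of_real (R^2) * A)"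
      using norm_triangle_ineq4[of B "B - of_real (R^2) * A"] by simp
    also have "\<dots> \<le> cmod B + 4 * pi * C * R powr (M + 1 - real k)" using main[OF R] by simp
    finally have "cmod A \<le> (cmod B + 4 * pi * C * R powr (M + 1 - real k)) / R^2"
      using R by (simp add: pos_le_divide_eq mult.commute)
    also have "\<dots> = 4 * pi * C * (R powr (M + 1 - real k) * R powr (-2)) + cmod B * R powr (-2)"
      using R by (simp add: powr_minus powr_numeral field_simps)
    also have "R powr (M + 1 - real k) * R powr (-2) = R powr (M - 1 - real k)"
      unfolding powr_add[symmetric] by (simp add: algebra_simps)
    finally show ?thesis .
  qed
  then have "\<forall>\<^sub>F R in at_top. cmod A \<le> 4 * pi * C * R powr (M - 1 - real k) + cmod B * R powr (-2)"
    by (intro eventually_mono[OF eventually_ge_at_top[of "max R0 1"]]) auto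
  moreover have "((\<lambda>R. 4 * pi * C * R powr (M - 1 - real k) + cmod B * R powr (-2)) \<longlongrightarrow> 4 * pi * C * 0 + cmod B * 0) at_top"
    using k by (intro tendsto_intros tendsto_neg_powr filterlim_ident) auto
  ultimately have "cmod A \<le> 4 * pi * C * 0 + cmod B * 0"
    by (intro tendsto_le[OF _ _ tendsto_const]) auto
  with \<open>A \<noteq> 0\<close> show False by simp
qed

lemma entire_vanishing_coeffs_poly:
  assumes E: "E holomorphic_on UNIV" and d: "\<And>k. k \<ge> N \<Longrightarrow> (deriv ^^ k) E 0 = 0"
  obtains P :: "complex poly" where "\<And>j. j \<ge> N \<Longrightarrow> coeff P j = 0" "\<And>z. E z = poly P z"
proof
  define P where "P = (\<Sum>j<N. monom ((deriv ^^ j) E 0 / fact j) j)"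
  show "coeff P j = 0" if "j \<ge> N" for j using that by (auto simp: P_def coeff_sum)
  fix z
  have "(\<lambda>n. (deriv ^^ n) E 0 / (fact n) * (z-0)^n) sums E z"
    by (rule holomorphic_power_series[of E 0 "cmod z + 1"]) (use E holomorphic_on_subset in auto)
  moreover have "(\<lambda>n. (deriv ^^ n) E 0 / (fact n) * (z-0)^n) sums (\<Sum>n<N. (deriv ^^ n) E 0 / (fact n) * (z-0)^n)"
    by (rule sums_finite) (auto simp: d not_less)
  ultimately show "E z = poly P z" by (simp add: P_def poly_sum poly_monom sums_unique2)
qed

subsection \<open>Pointwise bounds in Hardy spaces\<close>

text \<open>Squares instead of discs: averaging over their size needs only Fubini, no polar coordinates.\<close>

lemma square_Cauchy_estimate:
  assumes F: "F holomorphic_on {z. Im z > 0}" and h: "0 < h" "h < Im z0"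
  shows "2 * pi * h * cmod (F z0) \<le> integral {-h..h} (\<lambda>t. cmod (F (z0 + Complex t h)))
    + integral {-h..h} (\<lambda>t. cmod (F (z0 + Complex t (-h))))
    + integral {-h..h} (\<lambda>t. cmod (F (z0 + Complex h t)))
    + integral {-h..h} (\<lambda>t. cmod (F (z0 + Complex (-h) t)))"
proof -
  define H where "H = {z::complex. Im z > 0}"
  define f where "f = (\<lambda>w. F w / (w - z0))"
  have contF: "continuous_on H F" using F holomorphic_on_imp_continuous_on by (auto simp: H_def)
  define a1 a2 a3 a4 where "a1 = z0 + Complex (-h) (-h)" and "a2 = z0 + Complex h (-h)"
    and "a3 = z0 + Complex h h" and "a4 = z0 + Complex (-h) h"
  have cvx: "convex H" "open H" by (simp_all add: H_def convex_halfspace_Im_gt open_halfspace_Im_gt)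
  have sub: "path_image (rectpath a1 a3) \<subseteq> H - {z0}"
    using h by (subst path_image_rectpath) (auto simp: a1_def a3_def H_def)
  have 1: "(f has_contour_integral (2*pi * \<i> * winding_number (rectpath a1 a3) z0 * F z0)) (rectpath a1 a3)"
    unfolding f_def
  proof (rule Cauchy_integral_formula_convex_simple[OF cvx(1)])
    show "z0 \<in> interior H" using cvx h by (simp add: interior_open H_def)
  qed (use F sub in \<open>auto simp: H_def\<close>)
  have "winding_number (rectpath a1 a3) z0 = 1"
    by (rule winding_number_rectpath) (use h in \<open>auto simp: in_box_complex_iff a1_def a3_def\<close>)
  with 1 have 2: "contour_integral (rectpath a1 a3) f = 2*pi * \<i> * F z0"
    by (auto dest: contour_integral_unique)
  have fi: "f contour_integrable_on (rectpath a1 a3)" using 1 by (auto simp: contour_integrable_on_def)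
  have split: "rectpath a1 a3 = linepath a1 a2 +++ linepath a2 a3 +++ linepath a3 a4 +++ linepath a4 a1"
  proof -
    have "a2 = Complex (Re a3) (Im a1)" "a4 = Complex (Re a1) (Im a3)"
      by (simp_all add: a1_def a2_def a3_def a4_def complex_eq_iff)
    then show ?thesis by (simp add: rectpath_def Let_def)
  qed
  have 3: "contour_integral (rectpath a1 a3) f = contour_integral (linepath a1 a2) f + contour_integral (linepath a2 a3) f
      + contour_integral (linepath a3 a4) f + contour_integral (linepath a4 a1) f"
    using fi unfolding split by (simp add: contour_integrable_join)
  have fi': "f contour_integrable_on linepath a1 a2" "f contour_integrable_on linepath a2 a3"
     "f contour_integrable_on linepath a3 a4" "f contour_integrable_on linepath a4 a1"
    using fi unfolding split by simp_all
  \<comment> \<open>Relative to the centre, \<open>u\<close> is the midpoint of a side and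
    \<open>v\<close> its unit direction. The parametrization contributes \<open>2 * h\<close>, while
    the Cauchy kernel is at most \<open>1 / h\<close> on the side; hence the bound below without any
    further constant.\<close>
  define side_int where "side_int = (\<lambda>u v. integral {-h..h} (\<lambda>t. cmod (F (z0 + u + of_real t * v))))"
  have side: "h * cmod (contour_integral (linepath a b) f) \<le> side_int u v"
    if ab: "a = z0 + u - of_real h * v" "b = z0 + u + of_real h * v" and v: "cmod v = 1"
     and fi: "f contour_integrable_on linepath a b"
     and uv: "\<And>t. t \<in> {-h..h} \<Longrightarrow> cmod (u + of_real t * v) \<ge> h"
     and sub: "\<And>t. t \<in> {-h..h} \<Longrightarrow> z0 + u + of_real t * v \<in> H" for a b u v
  proof -
    have c1: "continuous_on {-h..h} (\<lambda>t. F (z0 + u + of_real t * v))"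
      by (rule continuous_on_compose2[OF contF]) (auto intro!: continuous_intros sub)
    have nz: "u + of_real t * v \<noteq> 0" if "t \<in> {-h..h}" for t using uv[OF that] h by auto
    have c2: "continuous_on {-h..h} (\<lambda>t. f (z0 + u + of_real t * v))"
      unfolding f_def using nz by (intro continuous_intros c1) (auto simp: algebra_simps)
    have "((\<lambda>t. f (linepath a b t) * (b - a)) has_integral contour_integral (linepath a b) f) {0..1}"
      using fi has_contour_integral_integral has_contour_integral_linepath by blast
    then have "((\<lambda>t. f (linepath a b t) * (b - a)) has_integral contour_integral (linepath a b) f) (cbox 0 1)" by simp
    then have "((\<lambda>x. f (linepath a b ((1/(2*h)) *\<^sub>R x + 1/2)) * (b - a)) has_integral
       (1 / \<bar>1/(2*h)\<bar> ^ DIM(real)) *\<^sub>R contour_integral (linepath a b) f)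
          ((\<lambda>x. (1/(1/(2*h))) *\<^sub>R x + -((1/(1/(2*h))) *\<^sub>R (1/2))) ` cbox 0 1)"
      by (rule has_integral_affinity) (use h in auto)
    moreover have "((\<lambda>x. (1/(1/(2*h))) *\<^sub>R x + -((1/(1/(2*h))) *\<^sub>R (1/2))) ` cbox (0::real) 1) = {-h..h}"
      using h by (subst image_affinity_cbox) auto
    moreover have "linepath a b ((1/(2*h)) *\<^sub>R x + 1/2) = z0 + u + of_real x * v" for x
      using h by (simp add: linepath_def ab scaleR_conv_of_real field_simps)
    ultimately have i: "((\<lambda>x. f (z0 + u + of_real x * v) * (b - a)) has_integral
       (2 * h) *\<^sub>R contour_integral (linepath a b) f) {-h..h}" using h by simp
    have "cmod ((2 * h) *\<^sub>R contour_integral (linepath a b) f) \<le> integral {-h..h} (\<lambda>t. 2 * cmod (F (z0 + u + of_real t * v)))"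
      unfolding integral_unique[OF i, symmetric]
    proof (rule integral_norm_bound_integral)
      show "(\<lambda>x. f (z0 + u + of_real x * v) * (b - a)) integrable_on {-h..h}" using i by blast
      show "(\<lambda>t. 2 * cmod (F (z0 + u + of_real t * v))) integrable_on {- h..h}"
        by (intro integrable_continuous_interval continuous_intros c1)
      fix x assume x: "x \<in> {-h..h}"
      have "b - a = of_real (2 * h) * v" by (simp add: ab)
      then have "cmod (f (z0 + u + of_real x * v) * (b - a)) = cmod (F (z0 + u + of_real x * v)) * (2 * h / cmod (u + of_real x * v))"
        using h v by (simp add: f_def norm_mult norm_divide algebra_simps)
      also have "\<dots> \<le> cmod (F (z0 + u + of_real x * v)) * 2"
        using uv[OF x] h nz[OF x] by (intro mult_left_mono) (auto simp: divide_le_eq)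
      finally show "cmod (f (z0 + u + of_real x * v) * (b - a)) \<le> 2 * cmod (F (z0 + u + of_real x * v))" by simp
    qed
    then show ?thesis using h by (simp add: norm_mult side_int_def)
  qed
  have "2 * pi * h * cmod (F z0) = h * cmod (contour_integral (rectpath a1 a3) f)"
    by (simp add: 2 norm_mult)
  also have "\<dots> \<le> h * cmod (contour_integral (linepath a1 a2) f) + h * cmod (contour_integral (linepath a2 a3) f)
      + h * cmod (contour_integral (linepath a3 a4) f) + h * cmod (contour_integral (linepath a4 a1) f)"
    unfolding 3 distrib_left[symmetric] using h
    by (intro mult_left_mono norm_triangle_le add_right_mono norm_triangle_ineq) auto
  also have "h * cmod (contour_integral (linepath a1 a2) f) \<le> side_int (Complex 0 (-h)) 1"
    by (rule side) (use h fi' in \<open>auto simp: a1_def a2_def complex_eq_iff H_def intro: order_trans[OF _ abs_Im_le_cmod]\<close>)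
  also have "h * cmod (contour_integral (linepath a2 a3) f) \<le> side_int (Complex h 0) \<i>"
    by (rule side) (use h fi' in \<open>auto simp: a3_def a2_def complex_eq_iff H_def intro: order_trans[OF _ abs_Re_le_cmod]\<close>)
  also have "h * cmod (contour_integral (linepath a3 a4) f) \<le> side_int (Complex 0 h) (-1)"
    by (rule side) (use h fi' in \<open>auto simp: a3_def a4_def complex_eq_iff H_def intro: order_trans[OF _ abs_Im_le_cmod]\<close>)
  also have "h * cmod (contour_integral (linepath a4 a1) f) \<le> side_int (Complex (-h) 0) (-\<i>)"
    by (rule side) (use h fi' in \<open>auto simp: a1_def a4_def complex_eq_iff H_def intro: order_trans[OF _ abs_Re_le_cmod]\<close>)
  \<comment> \<open>The top and left sides are traversed backwards, so their parameter is
    reflected.\<close>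
  also have "side_int (Complex 0 h) (-1) = integral {-h..h} (\<lambda>t. cmod (F (z0 + Complex t h)))"
    unfolding side_int_def by (subst Henstock_Kurzweil_Integration.integral_reflect_real[symmetric])
       (auto intro!: integral_cong arg_cong[of _ _ "\<lambda>z. cmod (F z)"] simp: complex_eq_iff)
  also have "side_int (Complex (-h) 0) (-\<i>) = integral {-h..h} (\<lambda>t. cmod (F (z0 + Complex (-h) t)))"
    unfolding side_int_def by (subst Henstock_Kurzweil_Integration.integral_reflect_real[symmetric])
       (auto intro!: integral_cong arg_cong[of _ _ "\<lambda>z. cmod (F z)"] simp: complex_eq_iff)
  also have "side_int (Complex 0 (-h)) 1 = integral {-h..h} (\<lambda>t. cmod (F (z0 + Complex t (-h))))"
    unfolding side_int_def by (auto intro!: integral_cong arg_cong[of _ _ "\<lambda>z. cmod (F z)"] simp: complex_eq_iff)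
  also have "side_int (Complex h 0) \<i> = integral {-h..h} (\<lambda>t. cmod (F (z0 + Complex h t)))"
    unfolding side_int_def by (auto intro!: integral_cong arg_cong[of _ _ "\<lambda>z. cmod (F z)"] simp: complex_eq_iff)
  finally show ?thesis by simp
qed

text \<open>Integrating the previous estimate over the half-side \<open>h\<close> turns its left
  factor \<open>2 * h\<close> into \<open>R^2\<close>. The horizontal sides sweep out the square
  once and the vertical sides once more, which accounts for the factor 2; each side is first
  lengthened to \<open>{-R..R}\<close>, which only increases the integral.\<close>

lemma square_area_Cauchy_estimate:
  assumes F: "F holomorphic_on {z. Im z > 0}" and R: "0 < R" "R < Im z0"
  shows "pi * R^2 * cmod (F z0) \<le> 2 * integral {-R..R} (\<lambda>s. integral {-R..R} (\<lambda>t. cmod (F (z0 + Complex t s))))"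
proof -
  define u where "u = (\<lambda>s t. cmod (F (z0 + Complex t s)))"
  have contF: "continuous_on {z. Im z > 0} F" using F holomorphic_on_imp_continuous_on by auto
  have cu: "continuous_on (cbox (-R,-R) (R,R)) (\<lambda>(s,t). u s t)"
  proof -
    have "continuous_on (cbox (-R,-R) (R,R)) (\<lambda>q. cmod (F (z0 + Complex (snd q) (fst q))))"
      by (intro continuous_intros continuous_on_compose2[OF contF])
         (use R in \<open>auto simp: mem_box Basis_prod_def continuous_on_Complex intro!: continuous_intros\<close>)
    then show ?thesis by (simp add: u_def case_prod_unfold)
  qed
  have cu': "continuous_on (cbox (-R,-R) (R,R)) (\<lambda>(s,t). u t s)"
    using continuous_on_compose2[OF cu, of _ prod.swap]
    by (auto simp: case_prod_unfold mem_box Basis_prod_def continuous_on_swap)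
  have c1: "continuous_on {-R..R} (u s)" if "s \<in> {-R..R}" for s
    unfolding u_def
    by (intro continuous_intros continuous_on_compose2[OF contF])
       (use R that in \<open>auto simp: continuous_on_Complex intro!: continuous_intros\<close>)
  have c2: "continuous_on {-R..R} (\<lambda>s. u s t)" if "t \<in> {-R..R}" for t
    unfolding u_def
    by (intro continuous_intros continuous_on_compose2[OF contF])
       (use R that in \<open>auto simp: continuous_on_Complex intro!: continuous_intros\<close>)
  define I where "I = (\<lambda>s. integral {-R..R} (u s))"
  define J where "J = (\<lambda>t. integral {-R..R} (\<lambda>s. u s t))"
  have cI: "continuous_on {-R..R} I"
    using integral_continuous_on_param[of "{-R..R}" "-R" R u] cu by (simp add: I_def cbox_Pair_eq)
  have cJ: "continuous_on {-R..R} J"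
    using integral_continuous_on_param[of "{-R..R}" "-R" R "\<lambda>t s. u s t"] cu' by (simp add: J_def cbox_Pair_eq)
  have int: "f integrable_on {a..b}" if "continuous_on {-R..R} f" "{a..b} \<subseteq> {-R..R}" for f :: "real \<Rightarrow> real" and a b
    using integrable_continuous_interval continuous_on_subset that by blast
  have point: "2 * pi * h * cmod (F z0) \<le> I h + I (-h) + J h + J (-h)" if "h \<in> {0..R}" for h
  proof (cases "h = 0")
    case True
    have "I 0 \<ge> 0" "J 0 \<ge> 0" unfolding I_def J_def using R
      by (auto intro!: Henstock_Kurzweil_Integration.integral_nonneg int c1 c2) (auto simp: u_def)
    then show ?thesis using True by simp
  next
    case False
    with that have h: "0 < h" "h \<le> R" by auto
    have sub: "integral {-h..h} f \<le> integral {-R..R} f" if "continuous_on {-R..R} f" "\<And>t. f t \<ge> 0" for f :: "real \<Rightarrow> real"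
      by (rule integral_subset_le) (use h that in \<open>auto intro!: int[of f]\<close>)
    have "2 * pi * h * cmod (F z0) \<le> integral {-h..h} (u h) + integral {-h..h} (u (-h))
      + integral {-h..h} (\<lambda>t. u t h) + integral {-h..h} (\<lambda>t. u t (-h))"
      unfolding u_def using square_Cauchy_estimate[OF F] h R by simp
    also have "\<dots> \<le> I h + I (-h) + J h + J (-h)"
      unfolding I_def J_def using h
      by (intro add_mono sub c1 c2) (auto simp: u_def)
    finally show ?thesis .
  qed
  have half: "integral {0..R} (\<lambda>h. f h + f (-h)) = integral {-R..R} f" if c: "continuous_on {-R..R} f" for f :: "real \<Rightarrow> real"
  proof -
    have cm: "continuous_on {0..R} (\<lambda>h. f (-h))"
      by (rule continuous_on_compose2[OF c]) (auto intro!: continuous_intros)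
    have "integral {0..R} (\<lambda>h. f h + f (-h)) = integral {0..R} f + integral {0..R} (\<lambda>h. f (-h))"
      by (rule Henstock_Kurzweil_Integration.integral_add) (use R cm continuous_on_subset[OF c, of "{0..R}"] in \<open>auto intro!: integrable_continuous_interval\<close>)
    also have "integral {0..R} (\<lambda>h. f (-h)) = integral {-R..0} f"
      using Henstock_Kurzweil_Integration.integral_reflect_real[of 0 "-R" f] by simp
    also have "integral {0..R} f + integral {-R..0} f = integral {-R..R} f"
      using Henstock_Kurzweil_Integration.integral_combine[of "-R" 0 R f] R int[OF c] by simp
    finally show ?thesis .
  qed
  have cr: "continuous_on {0..R} f" "continuous_on {0..R} (\<lambda>t. f (-t))" if "continuous_on {-R..R} f" for f :: "real \<Rightarrow> real"
  proof -
    show "continuous_on {0..R} f" using that by (rule continuous_on_subset) (use R in auto)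
    show "continuous_on {0..R} (\<lambda>t. f (-t))"
      by (rule continuous_on_compose2[OF that continuous_on_minus[OF continuous_on_id]]) (use R in auto)
  qed
  have "pi * R^2 * cmod (F z0) = integral {0..R} (\<lambda>h. 2 * pi * h * cmod (F z0))"
  proof -
    have "((\<lambda>h. 2 * pi * h * cmod (F z0)) has_integral (pi * R^2 * cmod (F z0) - pi * 0^2 * cmod (F z0))) {0..R}"
      by (rule fundamental_theorem_of_calculus)
         (use R in \<open>auto intro!: derivative_eq_intros simp: has_real_derivative_iff_has_vector_derivative[symmetric]\<close>)
    then show ?thesis by (subst integral_unique) auto
  qed
  also have "\<dots> \<le> integral {0..R} (\<lambda>h. (I h + I (-h)) + (J h + J (-h)))"
    by (rule integral_le)
       (use point cr[OF cI] cr[OF cJ] in \<open>auto intro!: integrable_continuous_interval continuous_on_add continuous_on_mult continuous_on_const continuous_on_id simp: add.assoc\<close>)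
  also have "\<dots> = integral {0..R} (\<lambda>h. I h + I (-h)) + integral {0..R} (\<lambda>h. J h + J (-h))"
    by (rule Henstock_Kurzweil_Integration.integral_add)
       (use cr[OF cI] cr[OF cJ] in \<open>auto intro!: integrable_continuous_interval continuous_on_add\<close>)
  also have "\<dots> = integral {-R..R} I + integral {-R..R} J"
    using half cI cJ by simp
  also have "integral {-R..R} J = integral {-R..R} I"
    unfolding I_def J_def using integral_swap_continuous[OF cu] by simp
  finally show ?thesis by (simp add: I_def u_def)
qed

abbreviation Lp_mass :: "real \<Rightarrow> (complex \<Rightarrow> complex) \<Rightarrow> real \<Rightarrow> ennreal" where
  "Lp_mass p F y \<equiv> \<integral>\<^sup>+x. ennreal (cmod (F (Complex x y)) powr p) \<partial>lebesgue"

text \<open>Separates the growth condition from the boundary values and keeps the constant explicit,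
  since the estimates below must be uniform in the height.\<close>

definition Hardy_bound :: "real \<Rightarrow> real \<Rightarrow> (complex \<Rightarrow> complex) \<Rightarrow> bool" where
  "Hardy_bound p C F \<longleftrightarrow> F holomorphic_on C_plus \<and>
     (\<forall>y>0. Lp_mass p F y \<le> ennreal C)"

lemma continuous_on_horizontal:
  assumes F: "F holomorphic_on {z. Im z > 0}" and y: "y > 0"
  shows "continuous_on S (\<lambda>x. F (Complex x y))"
proof -
  have contF: "continuous_on {z. Im z > 0} F" using F holomorphic_on_imp_continuous_on by auto
  show ?thesis
    by (rule continuous_on_compose2[OF contF]) (use y in \<open>auto simp: continuous_on_Complex intro!: continuous_intros\<close>)
qed

lemma horizontal_borel [measurable]:
  assumes F: "F holomorphic_on {z. Im z > 0}" and y: "y > 0"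
  shows "(\<lambda>x. F (Complex x y)) \<in> borel_measurable borel"
  using continuous_on_horizontal[OF assms, of UNIV] by (rule borel_measurable_continuous_onI)

text \<open>Takes the place of the Hoelder inequality on an interval: values above the threshold
  \<open>\<mu>\<close> are absorbed by the p-th power, and \<open>\<mu>\<close> is chosen later to
  balance the two terms.\<close>

lemma le_powr_split:
  fixes u \<mu> p :: real
  assumes "u \<ge> 0" "\<mu> > 0" "p > 1"
  shows "u \<le> \<mu> + \<mu> powr (1 - p) * u powr p"
proof (cases "u \<le> \<mu>")
  case True then show ?thesis by (simp add: add_increasing2)
next
  case False
  then have "u = u powr (1 - p) * u powr p" using assms by (simp flip: powr_add)
  also have "\<dots> \<le> \<mu> powr (1 - p) * u powr p"
    using False assms by (intro mult_right_mono powr_mono2') auto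
  finally show ?thesis using assms by simp
qed

text \<open>A square of half-side \<open>Im z / 2\<close> stays in the half-plane, and each of its
  rows lies on a horizontal line where the p-th power has mass at most \<open>C\<close>. Bounding
  the rows in L^1 and averaging over the square gives the estimate; the 8 is 4 times a crude bound 2
  for \<open>2 powr (1 / p)\<close>.\<close>

lemma Hardy_pointwise:
  assumes F: "Hardy_bound p C F" and p: "p > 1" and C: "C \<ge> 0" and z: "Im z > 0"
  shows "cmod (F z) \<le> 8 * (2 + C) / pi * Im z powr (- 1 / p)"
proof -
  have hF: "F holomorphic_on {z. Im z > 0}" using F by (simp add: Hardy_bound_def)
  define R where "R = Im z / 2"
  have R: "0 < R" "R < Im z" using z by (auto simp: R_def)
  define B where "B = (2 + C) * R powr (1 - 1/p)"
  have row: "integral {-R..R} (\<lambda>t. cmod (F (z + Complex t s))) \<le> B" if s: "s \<in> {-R..R}" for s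
  proof -
    define y where "y = Im z + s"
    have y: "y > 0" using s R by (auto simp: y_def)
    define v where "v = (\<lambda>t. cmod (F (z + Complex t s)))"
    have cv: "continuous_on {-R..R} v" unfolding v_def
    proof (intro continuous_intros continuous_on_compose2[OF holomorphic_on_imp_continuous_on[OF hF]])
    qed (use y in \<open>auto simp: y_def continuous_on_Complex intro!: continuous_intros\<close>)
    have cv': "continuous_on {-R..R} (\<lambda>t. v t powr p)"
      by (rule continuous_on_powr'[OF cv continuous_on_const]) (use p in \<open>auto simp: v_def\<close>)
    have cvU: "continuous_on UNIV v" unfolding v_def
    proof (intro continuous_intros continuous_on_compose2[OF holomorphic_on_imp_continuous_on[OF hF]])
    qed (use y in \<open>auto simp: y_def continuous_on_Complex intro!: continuous_intros\<close>)
    have [measurable]: "v \<in> borel_measurable borel" using cvU by (rule borel_measurable_continuous_onI)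
    have "integral {-R..R} (\<lambda>t. v t powr p) \<le> C"
    proof -
      have "ennreal (integral {-R..R} (\<lambda>t. v t powr p)) = (\<integral>\<^sup>+t. ennreal (v t powr p * indicator {-R..R} t) \<partial>lborel)"
      proof (rule nn_integral_has_integral_lborel[symmetric])
        show "((\<lambda>t. v t powr p * indicator {-R..R} t) has_integral integral {-R..R} (\<lambda>t. v t powr p)) UNIV"
        proof -
          have "(\<lambda>t. v t powr p * indicator {-R..R} t) = (\<lambda>t. if t \<in> {-R..R} then v t powr p else 0)"
            by (auto simp: fun_eq_iff)
          then show ?thesis
            using integrable_integral[OF integrable_continuous_interval[OF cv']]
            by (simp only: has_integral_restrict_UNIV)
        qed
      qed (auto intro!: mult_nonneg_nonneg)
      also have "\<dots> \<le> (\<integral>\<^sup>+t. ennreal (v t powr p) \<partial>lborel)"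
        by (intro nn_integral_mono) (auto simp: indicator_def)
      also have "\<dots> = (\<integral>\<^sup>+t. ennreal (cmod (F (Complex (Re z + 1 * t) y)) powr p) \<partial>lborel)"
        by (intro nn_integral_cong) (auto simp: v_def y_def intro!: arg_cong[of _ _ "\<lambda>z. cmod (F z) powr p"] complex_eqI)
      also have "\<dots> = (\<integral>\<^sup>+t. ennreal (cmod (F (Complex t y)) powr p) \<partial>lborel)"
      proof -
        have [measurable]: "(\<lambda>t. F (Complex t y)) \<in> borel_measurable borel"
          by (rule horizontal_borel[OF hF y])
        show ?thesis
          using nn_integral_real_affine[of "\<lambda>t. ennreal (cmod (F (Complex t y)) powr p)" 1 "Re z"] by simp
      qed
      also have "\<dots> = (\<integral>\<^sup>+t. ennreal (cmod (F (Complex t y)) powr p) \<partial>lebesgue)"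
        by (simp add: nn_integral_completion)
      also have "\<dots> \<le> ennreal C" using F y by (simp add: Hardy_bound_def)
      finally show ?thesis using C by simp
    qed
    \<comment> \<open>This threshold makes both \<open>R * \<mu>\<close> and
      \<open>\<mu> powr (1 - p)\<close> equal to \<open>R powr (1 - 1 / p)\<close>.\<close>
    define \<mu> where "\<mu> = R powr (- 1 / p)"
    have \<mu>: "\<mu> > 0" using R by (simp add: \<mu>_def)
    have "integral {-R..R} v \<le> integral {-R..R} (\<lambda>t. \<mu> + \<mu> powr (1 - p) * v t powr p)"
      by (intro integral_le integrable_continuous_interval continuous_intros cv cv' le_powr_split)
         (use \<mu> p in \<open>auto simp: v_def\<close>)
    also have "\<dots> = integral {-R..R} (\<lambda>t. \<mu>) + integral {-R..R} (\<lambda>t. \<mu> powr (1 - p) * v t powr p)"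
      by (intro Henstock_Kurzweil_Integration.integral_add integrable_continuous_interval continuous_intros cv')
    also have "\<dots> = 2 * R * \<mu> + \<mu> powr (1 - p) * integral {-R..R} (\<lambda>t. v t powr p)"
      using R by simp
    also have "\<dots> \<le> 2 * R * \<mu> + \<mu> powr (1 - p) * C"
      using \<open>integral {-R..R} (\<lambda>t. v t powr p) \<le> C\<close> R by (intro add_mono mult_left_mono) auto
    also have "\<dots> = B"
    proof -
      have "R * \<mu> = R powr 1 * R powr (- 1 / p)" using R by (simp add: \<mu>_def)
      also have "\<dots> = R powr (1 - 1 / p)" unfolding powr_add[symmetric] by simp
      finally have 1: "R * \<mu> = R powr (1 - 1 / p)" .
      have "\<mu> powr (1 - p) = R powr (1 - 1 / p)"
        unfolding \<mu>_def powr_powr using p by (intro arg_cong[of _ _ "\<lambda>e. R powr e"]) (simp add: field_simps)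
      with 1 show ?thesis by (simp add: B_def algebra_simps)
    qed
    finally show ?thesis by (simp add: v_def)
  qed
  have "pi * R^2 * cmod (F z) \<le> 2 * integral {-R..R} (\<lambda>s. integral {-R..R} (\<lambda>t. cmod (F (z + Complex t s))))"
    using square_area_Cauchy_estimate[OF hF R] .
  also have "\<dots> \<le> 2 * (2 * R * B)"
  proof (intro mult_left_mono)
    have "integral {-R..R} (\<lambda>s. integral {-R..R} (\<lambda>t. cmod (F (z + Complex t s)))) \<le> integral {-R..R} (\<lambda>s. B)"
    proof (rule integral_le)
      have "continuous_on (cbox (-R,-R) (R,R)) (\<lambda>q. cmod (F (z + Complex (snd q) (fst q))))"
        by (intro continuous_intros continuous_on_compose2[OF holomorphic_on_imp_continuous_on[OF hF]])
           (use R in \<open>auto simp: mem_box Basis_prod_def continuous_on_Complex intro!: continuous_intros\<close>)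
      then have "continuous_on {-R..R} (\<lambda>s. integral {-R..R} (\<lambda>t. cmod (F (z + Complex t s))))"
        using integral_continuous_on_param[of "{-R..R}" "-R" R "\<lambda>s t. cmod (F (z + Complex t s))"]
        by (simp add: cbox_Pair_eq case_prod_unfold)
      then show "(\<lambda>s. integral {-R..R} (\<lambda>t. cmod (F (z + Complex t s)))) integrable_on {-R..R}"
        by (rule integrable_continuous_interval)
    qed (use row in auto)
    then show "integral {-R..R} (\<lambda>s. integral {-R..R} (\<lambda>t. cmod (F (z + Complex t s)))) \<le> 2 * R * B"
      using R by simp
  qed auto
  finally have "cmod (F z) \<le> 4 * R * B / (pi * R^2)"
    using R by (simp add: pos_le_divide_eq mult_ac)
  also have "\<dots> = 4 * (2 + C) / pi * (R powr (1 - 1/p) / R powr 1)"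
    using R by (simp add: B_def power2_eq_square)
  also have "R powr (1 - 1/p) / R powr 1 = R powr (- 1 / p)"
    unfolding powr_diff[symmetric] by simp
  also have "R powr (- 1 / p) = Im z powr (- 1 / p) * 2 powr (1 / p)"
    using z by (simp add: R_def powr_divide powr_minus field_simps)
  also have "4 * (2 + C) / pi * (Im z powr (- 1 / p) * 2 powr (1 / p)) \<le> 4 * (2 + C) / pi * (Im z powr (- 1 / p) * 2 powr 1)"
    using p C by (intro mult_left_mono powr_mono) auto
  finally show ?thesis by (simp add: algebra_simps)
qed

subsection \<open>Gluing across the real line\<close>

definition trunc :: "real \<Rightarrow> complex \<Rightarrow> complex" where
  "trunc k z = z / of_real (max 1 (cmod z / k))"

lemma continuous_trunc: "k > 0 \<Longrightarrow> continuous_on UNIV (trunc k)"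
  unfolding trunc_def by (intro continuous_intros) (auto simp: max_def)

lemma norm_trunc_le:
  assumes "k > 0" shows "cmod (trunc k z) \<le> k"
proof (cases "cmod z \<le> k")
  case True
  then show ?thesis using assms by (simp add: trunc_def max_def)
next
  case False
  then have "max 1 (cmod z / k) = cmod z / k" using assms by (simp add: max_def field_simps)
  then show ?thesis using assms False by (simp add: trunc_def norm_divide norm_mult)
qed

text \<open>Truncation alters only values of modulus above \<open>k\<close>, and there
  \<open>cmod z powr (1 - t)\<close> is below \<open>k powr (1 - t)\<close>. As
  \<open>t > 1\<close>, a bound on the t-th power makes the error small for large
  \<open>k\<close>.\<close>

lemma norm_diff_trunc_le:
  assumes k: "k > 0" and t: "t > 1"
  shows "cmod (z - trunc k z) \<le> cmod z powr t * k powr (1 - t)"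
proof (cases "cmod z \<le> k")
  case True
  then show ?thesis using k by (simp add: trunc_def max_def field_simps)
next
  case False
  then have m: "max 1 (cmod z / k) = cmod z / k" using assms by (simp add: max_def field_simps)
  have z: "z \<noteq> 0" using False k by auto
  have "z - trunc k z = z * of_real (1 - k / cmod z)"
    using z by (simp add: trunc_def m algebra_simps)
  then have "cmod (z - trunc k z) = cmod z * (1 - k / cmod z)"
    using False k z by (simp only: norm_mult norm_of_real) (simp add: field_simps)
  also have "\<dots> \<le> cmod z * 1" using k by (intro mult_left_mono) auto
  also have "\<dots> = cmod z powr t * cmod z powr (1 - t)" using z by (simp flip: powr_add)
  also have "\<dots> \<le> cmod z powr t * k powr (1 - t)"
    using False k t by (intro mult_left_mono powr_mono2') auto
  finally show ?thesis .
qed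

text \<open>Boundedness in \<open>L\<^sup>t\<close> with \<open>t > 1\<close> gives uniform integrability; comparing two sequences with the
  same limit avoids any measurability or integrability requirement on the limit \<open>l\<close>.\<close>

lemma (in finite_measure) integrals_merge:
  fixes f g :: "nat \<Rightarrow> 'a \<Rightarrow> complex"
  assumes [measurable]: "\<And>n. f n \<in> borel_measurable M" "\<And>n. g n \<in> borel_measurable M"
    and lim: "AE x in M. (\<lambda>n. f n x) \<longlonglongrightarrow> l x" "AE x in M. (\<lambda>n. g n x) \<longlonglongrightarrow> l x"
    and t: "t > 1" and K: "K \<ge> 0"
    and bd: "\<And>n. (\<integral>\<^sup>+x. ennreal (cmod (f n x) powr t) \<partial>M) \<le> ennreal K"
            "\<And>n. (\<integral>\<^sup>+x. ennreal (cmod (g n x) powr t) \<partial>M) \<le> ennreal K"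
  shows "\<And>n. integrable M (f n)" "\<And>n. integrable M (g n)"
    and "(\<lambda>n. integral\<^sup>L M (f n) - integral\<^sup>L M (g n)) \<longlonglongrightarrow> 0"
proof -
  have tm: "(\<lambda>x. trunc k (h x)) \<in> borel_measurable M" if "k > 0" "h \<in> borel_measurable M" for k h
    using borel_measurable_continuous_onI[OF continuous_trunc[OF that(1)]] that(2) by simp
  have ti: "integrable M (\<lambda>x. trunc k (h x))" if "k > 0" "h \<in> borel_measurable M" for k h
    by (rule integrable_const_bound[of _ k]) (use norm_trunc_le that tm in auto)
  \<comment> \<open>The error of truncation depends on \<open>K\<close> and \<open>k\<close> alone,
    hence is uniform along both sequences.\<close>
  have *: "integrable M h \<and> cmod (integral\<^sup>L M h - (\<integral>x. trunc k (h x) \<partial>M)) \<le> K * k powr (1 - t)"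
    if k: "k > 0" and [measurable]: "h \<in> borel_measurable M"
      and b: "(\<integral>\<^sup>+x. ennreal (cmod (h x) powr t) \<partial>M) \<le> ennreal K" for h k
  proof -
    have pi: "integrable M (\<lambda>x. cmod (h x) powr t)"
      using b by (intro integrableI_nonneg) (auto intro: le_less_trans)
    have pK: "(\<integral>x. cmod (h x) powr t \<partial>M) \<le> K"
      using b K nn_integral_eq_integral[OF pi] by simp
    have di: "integrable M (\<lambda>x. h x - trunc k (h x))"
      by (rule Bochner_Integration.integrable_bound[OF integrable_mult_left[OF pi, of "k powr (1 - t)"]])
         (use k tm[OF k] norm_diff_trunc_le[OF k t] in auto)
    have hi: "integrable M h"
      using Bochner_Integration.integrable_add[OF di ti[OF k, of h]] by simp
    have "cmod (integral\<^sup>L M h - (\<integral>x. trunc k (h x) \<partial>M)) = cmod (\<integral>x. h x - trunc k (h x) \<partial>M)"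
      using hi ti[OF k] by simp
    also have "\<dots> \<le> (\<integral>x. cmod (h x - trunc k (h x)) \<partial>M)" by simp
    also have "\<dots> \<le> (\<integral>x. cmod (h x) powr t * k powr (1 - t) \<partial>M)"
      by (intro integral_mono integrable_norm di integrable_mult_left pi norm_diff_trunc_le k t)
    also have "\<dots> \<le> K * k powr (1 - t)" using pK by (simp add: mult_right_mono)
    finally show ?thesis using hi by simp
  qed
  show "integrable M (f n)" "integrable M (g n)" for n using *[of 1] bd by auto
  show "(\<lambda>n. integral\<^sup>L M (f n) - integral\<^sup>L M (g n)) \<longlonglongrightarrow> 0"
  proof (rule LIMSEQ_I)
    fix e :: real assume e: "e > 0"
    have "((\<lambda>k. 2 * (K * k powr (1 - t))) \<longlongrightarrow> 2 * (K * 0)) at_top"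
      using t by (intro tendsto_intros tendsto_neg_powr filterlim_ident) auto
    then have "\<forall>\<^sub>F k in at_top. 2 * (K * k powr (1 - t)) < e / 2"
      using e by (auto dest!: order_tendstoD(2)[of _ _ _ "e/2"])
    then have "\<forall>\<^sub>F k in at_top. 2 * (K * k powr (1 - t)) < e / 2 \<and> k > 0"
      using eventually_gt_at_top[of "0::real"] by eventually_elim auto
    then obtain k where k: "k > 0" "2 * (K * k powr (1 - t)) < e / 2"
      using eventually_happens'[OF trivial_limit_at_top_linorder] by blast
    \<comment> \<open>At a fixed level the constant \<open>2 * k\<close> dominates on a finite
      measure space. Both truncations converge to \<open>trunc k (l x)\<close>, so \<open>l\<close>
      cancels from the difference before anything is integrated.\<close>
    have "(\<lambda>n. \<integral>x. trunc k (f n x) - trunc k (g n x) \<partial>M) \<longlonglongrightarrow> (\<integral>x. 0 \<partial>M)"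
    proof (rule integral_dominated_convergence)
      show "AE x in M. (\<lambda>n. trunc k (f n x) - trunc k (g n x)) \<longlonglongrightarrow> 0"
        using lim
      proof eventually_elim
        case (elim x)
        have "isCont (trunc k) (l x)" using continuous_trunc[OF k(1)] by (simp add: continuous_on_eq_continuous_at)
        then have "(\<lambda>n. trunc k (f n x) - trunc k (g n x)) \<longlonglongrightarrow> trunc k (l x) - trunc k (l x)"
          using elim by (intro tendsto_diff isCont_tendsto_compose[of "l x" "trunc k"])
        then show ?case by simp
      qed
      show "AE x in M. cmod (trunc k (f n x) - trunc k (g n x)) \<le> 2 * k" for n
      proof (rule AE_I2)
        fix x show "cmod (trunc k (f n x) - trunc k (g n x)) \<le> 2 * k"
          using norm_triangle_ineq4[of "trunc k (f n x)" "trunc k (g n x)"]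
            norm_trunc_le[OF k(1), of "f n x"] norm_trunc_le[OF k(1), of "g n x"] by linarith
      qed
    qed (use k(1) in \<open>auto intro!: borel_measurable_diff tm\<close>)
    then have "(\<lambda>n. \<integral>x. trunc k (f n x) - trunc k (g n x) \<partial>M) \<longlonglongrightarrow> 0" by simp
    from LIMSEQ_D[OF this, of "e/2"] e obtain N where
      N: "\<And>n. n \<ge> N \<Longrightarrow> cmod (\<integral>x. trunc k (f n x) - trunc k (g n x) \<partial>M) < e / 2" by auto
    show "\<exists>no. \<forall>n\<ge>no. cmod (integral\<^sup>L M (f n) - integral\<^sup>L M (g n) - 0) < e"
    proof (intro exI allI impI)
      fix n assume "n \<ge> N"
      from N[OF this] have "cmod ((\<integral>x. trunc k (f n x) \<partial>M) - (\<integral>x. trunc k (g n x) \<partial>M)) < e / 2"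
        using ti k by simp
      moreover have "cmod (integral\<^sup>L M (f n) - (\<integral>x. trunc k (f n x) \<partial>M)) \<le> K * k powr (1 - t)"
        "cmod (integral\<^sup>L M (g n) - (\<integral>x. trunc k (g n x) \<partial>M)) \<le> K * k powr (1 - t)"
        using *[OF k(1)] bd by auto
      ultimately show "cmod (integral\<^sup>L M (f n) - integral\<^sup>L M (g n) - 0) < e"
        using k(2) norm_triangle_ineq4[of "integral\<^sup>L M (f n) - (\<integral>x. trunc k (f n x) \<partial>M)" "integral\<^sup>L M (g n) - (\<integral>x. trunc k (g n x) \<partial>M)"]
          norm_triangle_ineq[of "integral\<^sup>L M (f n) - (\<integral>x. trunc k (f n x) \<partial>M) - (integral\<^sup>L M (g n) - (\<integral>x. trunc k (g n x) \<partial>M))"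
            "(\<integral>x. trunc k (f n x) \<partial>M) - (\<integral>x. trunc k (g n x) \<partial>M)"]
        by (simp add: algebra_simps)
    qed
  qed
qed

text \<open>For \<open>\<beta> < 1\<close> the bound is integrable along verticals, which is why primitives extend
  continuously to the real line.\<close>

abbreviation vert_dominated :: "real \<Rightarrow> (complex \<Rightarrow> complex) \<Rightarrow> bool" where
  "vert_dominated \<beta> U \<equiv> \<forall>R. \<exists>M. \<forall>z. 0 < Im z \<and> Im z \<le> R \<and> \<bar>Re z\<bar> \<le> R \<longrightarrow>
     cmod (U z) \<le> M * Im z powr (-\<beta>)"

text \<open>A mean value inequality against the antiderivative of
  \<open>M * y powr (-\<beta>)\<close>. The bound is kept as a difference of powers because
  \<open>y powr (1 - \<beta>)\<close> is uniformly continuous down to \<open>y = 0\<close>, which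
  gives a Cauchy criterion independent of \<open>x\<close>.\<close>

lemma vertical_increment:
  assumes A: "\<And>z. Im z > 0 \<Longrightarrow> (A has_field_derivative U z) (at z)"
    and b: "\<beta> < 1" and s: "0 < s" "s \<le> t"
    and bd: "\<And>y. s \<le> y \<Longrightarrow> y \<le> t \<Longrightarrow> cmod (U (Complex x y)) \<le> M * y powr (-\<beta>)"
  shows "cmod (A (Complex x t) - A (Complex x s)) \<le> M / (1 - \<beta>) * (t powr (1 - \<beta>) - s powr (1 - \<beta>))"
proof (cases "s = t")
  case False
  with s have st: "s < t" by simp
  have vd: "((\<lambda>y. A (Complex x y)) has_vector_derivative \<i> * U (Complex x y)) (at y)" if "y > 0" for y
  proof -
    have "((\<lambda>y. Complex x y) has_vector_derivative \<i>) (at y)"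
    proof -
      have "((\<lambda>y. of_real x + of_real y * \<i>) has_vector_derivative 0 + (of_real y * 0 + of_real 1 * \<i>)) (at y)"
        by (intro derivative_intros)
      then show ?thesis by (simp add: Complex_eq[abs_def] mult.commute)
    qed
    then show ?thesis
      using field_vector_diff_chain_at[of "\<lambda>y. Complex x y" \<i> y A "U (Complex x y)"] A[of "Complex x y"] that
      by (simp add: o_def)
  qed
  have "cmod (A (Complex x t) - A (Complex x s)) \<le> M / (1 - \<beta>) * t powr (1 - \<beta>) - M / (1 - \<beta>) * s powr (1 - \<beta>)"
  proof (rule differentiable_bound_general[OF st, where \<phi>' = "\<lambda>y. M * y powr (-\<beta>)" and f = "\<lambda>y. A (Complex x y)" and \<phi> = "\<lambda>y. M / (1 - \<beta>) * y powr (1 - \<beta>)"])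
    show "continuous_on {s..t} (\<lambda>y. A (Complex x y))"
    proof (intro continuous_at_imp_continuous_on ballI)
      fix y assume "y \<in> {s..t}"
      then show "isCont (\<lambda>y. A (Complex x y)) y"
        using has_vector_derivative_continuous[OF vd[of y]] s by auto
    qed
    show "continuous_on {s..t} (\<lambda>y. M / (1 - \<beta>) * y powr (1 - \<beta>))"
      using s b by (intro continuous_intros) auto
    show "((\<lambda>y. A (Complex x y)) has_vector_derivative \<i> * U (Complex x y)) (at y)" if "s < y" "y < t" for y
      using vd that s by auto
    show "((\<lambda>y. M / (1 - \<beta>) * y powr (1 - \<beta>)) has_vector_derivative M * y powr (-\<beta>)) (at y)" if "s < y" "y < t" for y
    proof -
      have "((\<lambda>y. M / (1 - \<beta>) * y powr (1 - \<beta>)) has_real_derivative M / (1 - \<beta>) * ((1 - \<beta>) * y powr (1 - \<beta> - 1))) (at y)"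
        using that s by (intro DERIV_cmult has_real_derivative_powr) auto
      then show ?thesis
        using b by (simp add: has_real_derivative_iff_has_vector_derivative)
    qed
    show "cmod (\<i> * U (Complex x y)) \<le> M * y powr (-\<beta>)" if "s < y" "y < t" for y
      using bd[of y] that by (simp add: norm_mult)
  qed
  then show ?thesis by (simp add: algebra_simps)
qed simp

text \<open>The upward shifts of \<open>A\<close> by \<open>1 / Suc n\<close> are continuous on the
  closed half-plane. By \<open>vertical_increment\<close> they are uniformly Cauchy on every box
  touching the real line, so their limit is continuous there.\<close>

lemma primitive_extends_to_closure:
  assumes A: "\<And>z. Im z > 0 \<Longrightarrow> (A has_field_derivative U z) (at z)"
    and b: "0 \<le> \<beta>" "\<beta> < 1"
    and bd: "vert_dominated \<beta> U"
  obtains B where "continuous_on {z. Im z \<ge> 0} B" "\<And>z. Im z > 0 \<Longrightarrow> B z = A z"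
    "\<And>x. (\<lambda>n. A (Complex x (1 / real (Suc n)))) \<longlonglongrightarrow> B (Complex x 0)"
proof -
  define s where "s = (\<lambda>n z. A (z + \<i> * of_real (1 / real (Suc n))))"
  have contA: "continuous_on {z. Im z > 0} A"
    using A by (intro continuous_at_imp_continuous_on ballI DERIV_isCont) auto
  have cs: "continuous_on {z. Im z \<ge> 0} (s n)" for n
    unfolding s_def
    by (intro continuous_on_compose2[OF contA] continuous_intros) (auto intro!: add_nonneg_pos)
  define X where "X = (\<lambda>R. {z. 0 \<le> Im z \<and> Im z \<le> R \<and> \<bar>Re z\<bar> \<le> R})"
  have uc: "uniformly_convergent_on (X R) s" for R
  proof (rule Cauchy_uniformly_convergent, unfold uniformly_Cauchy_on_def, intro allI impI)
    fix e :: real assume e: "e > 0"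
    obtain M0 where M0: "\<And>z. 0 < Im z \<and> Im z \<le> \<bar>R\<bar> + 1 \<and> \<bar>Re z\<bar> \<le> \<bar>R\<bar> + 1 \<Longrightarrow> cmod (U z) \<le> M0 * Im z powr (-\<beta>)"
      using bd by blast
    define M where "M = max M0 0"
    have M: "cmod (U z) \<le> M * Im z powr (-\<beta>)" if "0 < Im z \<and> Im z \<le> \<bar>R\<bar> + 1 \<and> \<bar>Re z\<bar> \<le> \<bar>R\<bar> + 1" for z
      using M0[OF that] by (rule order_trans) (auto simp: M_def intro: mult_right_mono)
    have M': "M \<ge> 0" by (simp add: M_def)
    define Q where "Q = M / (1 - \<beta>)"
    have Q: "Q \<ge> 0" using M' b by (simp add: Q_def)
    have ucp: "uniformly_continuous_on {0..\<bar>R\<bar>+1} (\<lambda>y::real. y powr (1 - \<beta>))"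
      using b by (intro compact_uniformly_continuous continuous_intros continuous_on_powr') auto
    \<comment> \<open>\<open>Q\<close> may be 0, hence the tolerance with
      \<open>Q + 1\<close>.\<close>
    from uniformly_continuous_onE[OF ucp, of "e / (Q + 1)"] e Q obtain d where d: "d > 0"
      "\<And>y y'. y \<in> {0..\<bar>R\<bar>+1} \<Longrightarrow> y' \<in> {0..\<bar>R\<bar>+1} \<Longrightarrow> dist y' y < d \<Longrightarrow> dist (y' powr (1 - \<beta>)) (y powr (1 - \<beta>)) < e / (Q + 1)"
      using divide_pos_pos[of e "Q + 1"] by auto
    obtain N where N: "1 / real (Suc N) < d" using d(1) nat_approx_posE by blast
    have key: "dist (s m z) (s n z) < e" if mn: "N \<le> m" "m \<le> n" and z: "z \<in> X R" for m n z
    proof -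
      define t1 t2 where "t1 = Im z + 1 / real (Suc n)" and "t2 = Im z + 1 / real (Suc m)"
      have fr: "1 / real (Suc n) \<le> 1 / real (Suc m)" "1 / real (Suc m) \<le> 1 / real (Suc N)" "1 / real (Suc m) \<le> 1" "0 < 1 / real (Suc n)"
        using mn by (auto intro!: divide_left_mono)
      have t: "0 < t1" "t1 \<le> t2" "t2 \<le> \<bar>R\<bar> + 1" "t2 - t1 < d"
      proof -
        have "0 \<le> Im z" "Im z \<le> R" using z by (auto simp: X_def)
        then show "0 < t1" "t1 \<le> t2" "t2 \<le> \<bar>R\<bar> + 1" "t2 - t1 < d"
          unfolding t1_def t2_def using fr N by linarith+
      qed
      have eq: "s m z = A (Complex (Re z) t2)" "s n z = A (Complex (Re z) t1)"
        by (auto simp: s_def t1_def t2_def intro!: arg_cong[of _ _ A] complex_eqI)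
      have "dist (s m z) (s n z) \<le> Q * (t2 powr (1 - \<beta>) - t1 powr (1 - \<beta>))"
        unfolding eq dist_norm Q_def
      proof (rule vertical_increment[OF A b(2) t(1,2)])
        show "cmod (U (Complex (Re z) y)) \<le> M * y powr (-\<beta>)" if "t1 \<le> y" "y \<le> t2" for y
          using M[of "Complex (Re z) y"] that t z by (auto simp: X_def)
      qed
      also have "\<dots> \<le> Q * (e / (Q + 1))"
        using d(2)[of t1 t2] t Q by (intro mult_left_mono) (auto simp: dist_real_def)
      also have "\<dots> < e" using Q e by (simp add: field_simps)
      finally show ?thesis .
    qed
    show "\<exists>M. \<forall>x\<in>X R. \<forall>m\<ge>M. \<forall>n\<ge>M. dist (s m x) (s n x) < e"
    proof (intro exI[of _ N] ballI allI impI)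
      fix z m n assume "z \<in> X R" "N \<le> m" "N \<le> n"
      then show "dist (s m z) (s n z) < e"
        using key[of m n z] key[of n m z] by (cases "m \<le> n") (auto simp: dist_commute)
    qed
  qed
  define B where "B = (\<lambda>z. lim (\<lambda>n. s n z))"
  have lims: "(\<lambda>n. s n z) \<longlonglongrightarrow> B z" if "Im z \<ge> 0" for z
  proof -
    have "z \<in> X (\<bar>Re z\<bar> + Im z)" using that by (auto simp: X_def)
    from uniformly_convergent_imp_convergent[OF uc this] show ?thesis
      by (simp add: B_def convergent_LIMSEQ_iff)
  qed
  have ul: "uniform_limit (X R) s B sequentially" for R
    using uc[of R] unfolding uniformly_convergent_uniform_limit_iff B_def .
  have cB: "continuous_on (X R) B" for R
  proof (rule uniform_limit_theorem[OF _ ul])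
    show "\<forall>\<^sub>F n in sequentially. continuous_on (X R) (s n)"
      using cs by (auto intro!: always_eventually continuous_on_subset[OF cs] simp: X_def)
  qed auto
  have cB': "continuous_on {z. Im z \<ge> 0} B"
  proof (subst continuous_on_eq_continuous_within, rule ballI)
    fix z assume z: "z \<in> {z::complex. Im z \<ge> 0}"
    define R where "R = cmod z + 1"
    have zX: "z \<in> X R" using z abs_Im_le_cmod[of z] abs_Re_le_cmod[of z] by (auto simp: X_def R_def)
    have cX: "continuous (at z within X R) B" using cB zX by (simp add: continuous_on_eq_continuous_within)
    \<comment> \<open>Continuity is a local matter: inside the unit ball about \<open>z\<close> the
      box with \<open>R = cmod z + 1\<close> cannot be told from the half-plane.\<close>
    have "X R \<inter> ball z 1 = {z. Im z \<ge> 0} \<inter> ball z 1"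
    proof -
      have "Im w \<le> R" "\<bar>Re w\<bar> \<le> R" if "w \<in> ball z 1" for w
      proof -
        have "cmod (z - w) < 1" using that by (simp add: dist_norm)
        then have "cmod w \<le> R" using norm_triangle_ineq2[of w z] by (simp add: R_def norm_minus_commute)
        then show "Im w \<le> R" "\<bar>Re w\<bar> \<le> R" using abs_Im_le_cmod[of w] abs_Re_le_cmod[of w] by auto
      qed
      then show ?thesis by (auto simp: X_def)
    qed
    then have "at z within X R = at z within {z. Im z \<ge> 0}"
      by (intro at_within_nhd[of z "ball z 1"]) auto
    with cX show "continuous (at z within {z. Im z \<ge> 0}) B" by (simp add: continuous_within)
  qed
  show thesis
  proof
    show "continuous_on {z. Im z \<ge> 0} B" by (rule cB')
    show "B z = A z" if z: "Im z > 0" for z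
    proof (rule LIMSEQ_unique[OF lims])
      have "(\<lambda>n. z + \<i> * of_real (1 / real (Suc n))) \<longlonglongrightarrow> z + \<i> * of_real 0"
        by (intro tendsto_intros LIMSEQ_Suc[OF lim_1_over_n, unfolded inverse_eq_divide] )
      then have "(\<lambda>n. z + \<i> * of_real (1 / real (Suc n))) \<longlonglongrightarrow> z" by simp
      moreover have "isCont A z" using A[OF z] by (rule DERIV_isCont)
      ultimately show "(\<lambda>n. s n z) \<longlonglongrightarrow> A z"
        unfolding s_def by (rule isCont_tendsto_compose[rotated])
    qed (use z in auto)
    show "(\<lambda>n. A (Complex x (1 / real (Suc n)))) \<longlonglongrightarrow> B (Complex x 0)" for x
    proof -
      have "s n (Complex x 0) = A (Complex x (1 / real (Suc n)))" for n
        by (auto simp: s_def intro!: arg_cong[of _ _ A] complex_eqI)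
      with lims[of "Complex x 0"] show ?thesis by simp
    qed
  qed
qed

lemma integral_horizontal_primitive:
  assumes A: "\<And>z. Im z > 0 \<Longrightarrow> (A has_field_derivative U z) (at z)" and y: "y > 0" and ab: "a \<le> b"
  shows "integral {a..b} (\<lambda>x. U (Complex x y)) = A (Complex b y) - A (Complex a y)"
proof (rule integral_unique, rule fundamental_theorem_of_calculus[OF ab])
  fix x assume "x \<in> {a..b}"
  have "((\<lambda>x. Complex x y) has_vector_derivative 1) (at x within {a..b})"
  proof -
    have "((\<lambda>x. of_real x + \<i> * of_real y) has_vector_derivative (of_real 1 + 0)) (at x within {a..b})"
      by (intro derivative_intros)
    then show ?thesis by (simp add: Complex_eq[abs_def])
  qed
  moreover have "(A has_field_derivative U (Complex x y)) (at (Complex x y) within (\<lambda>x. Complex x y) ` {a..b})"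
    using A[of "Complex x y"] y by (auto intro: has_field_derivative_at_within)
  ultimately show "((\<lambda>x. A (Complex x y)) has_vector_derivative U (Complex x y)) (at x within {a..b})"
    using field_vector_diff_chain_within[of "\<lambda>x. Complex x y" 1 x "{a..b}" A] by (simp add: o_def)
qed

text \<open>By \<open>conv\<close> the boundary increments of a primitive of \<open>U1\<close> and
  of the conjugated primitive of \<open>U2\<close> coincide on every segment, so the two boundary
  functions differ by a constant. Adjusting it makes the primitives a continuous function on the
  plane, holomorphic off the real line and therefore entire; \<open>E\<close> is its derivative,
  which does not see the constant.\<close>

lemma glue_across_reals:
  assumes U1: "U1 holomorphic_on C_plus" and U2: "U2 holomorphic_on C_plus"
    and b: "0 \<le> \<beta>" "\<beta> < 1"
    and bd1: "vert_dominated \<beta> U1"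
    and bd2: "vert_dominated \<beta> U2"
    and conv: "\<And>a b. a \<le> b \<Longrightarrow> (\<lambda>n. integral {a..b} (\<lambda>x. U1 (Complex x (1 / real (Suc n))))
          - cnj (integral {a..b} (\<lambda>x. U2 (Complex x (1 / real (Suc n)))))) \<longlonglongrightarrow> 0"
  obtains E where "E holomorphic_on UNIV" "\<And>z. Im z > 0 \<Longrightarrow> E z = U1 z"
    "\<And>z. Im z > 0 \<Longrightarrow> E (cnj z) = cnj (U2 z)"
proof -
  have op: "open C_plus" "convex C_plus" by (simp_all add: convex_halfspace_Im_gt open_halfspace_Im_gt)
  obtain A1 where A1: "\<And>z. Im z > 0 \<Longrightarrow> (A1 has_field_derivative U1 z) (at z)"
    using holomorphic_convex_primitive'[OF op(2,1) U1] by (metis at_within_open mem_Collect_eq op(1))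
  obtain A2 where A2: "\<And>z. Im z > 0 \<Longrightarrow> (A2 has_field_derivative U2 z) (at z)"
    using holomorphic_convex_primitive'[OF op(2,1) U2] by (metis at_within_open mem_Collect_eq op(1))
  obtain B1 where B1: "continuous_on {z. Im z \<ge> 0} B1" "\<And>z. Im z > 0 \<Longrightarrow> B1 z = A1 z"
    "\<And>x. (\<lambda>n. A1 (Complex x (1 / real (Suc n)))) \<longlonglongrightarrow> B1 (Complex x 0)"
    using primitive_extends_to_closure[OF A1 b bd1] by blast
  obtain B2 where B2: "continuous_on {z. Im z \<ge> 0} B2" "\<And>z. Im z > 0 \<Longrightarrow> B2 z = A2 z"
    "\<And>x. (\<lambda>n. A2 (Complex x (1 / real (Suc n)))) \<longlonglongrightarrow> B2 (Complex x 0)"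
    using primitive_extends_to_closure[OF A2 b bd2] by blast
  define D where "D = (\<lambda>x. B1 (Complex x 0) - cnj (B2 (Complex x 0)))"
  have Dle: "D y = D x" if "x \<le> y" for x y
  proof -
    have "(\<lambda>n. (A1 (Complex y (1 / real (Suc n))) - A1 (Complex x (1 / real (Suc n))))
      - cnj (A2 (Complex y (1 / real (Suc n))) - A2 (Complex x (1 / real (Suc n)))))
      \<longlonglongrightarrow> (B1 (Complex y 0) - B1 (Complex x 0)) - cnj (B2 (Complex y 0) - B2 (Complex x 0))"
      by (intro tendsto_intros B1 B2)
    moreover have "(\<lambda>n. (A1 (Complex y (1 / real (Suc n))) - A1 (Complex x (1 / real (Suc n))))
      - cnj (A2 (Complex y (1 / real (Suc n))) - A2 (Complex x (1 / real (Suc n))))) \<longlonglongrightarrow> 0"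
      using conv[OF that] integral_horizontal_primitive[of A1 U1, OF A1 _ that]
        integral_horizontal_primitive[of A2 U2, OF A2 _ that] by simp
    ultimately have "(B1 (Complex y 0) - B1 (Complex x 0)) - cnj (B2 (Complex y 0) - B2 (Complex x 0)) = 0"
      using LIMSEQ_unique by blast
    then show ?thesis by (simp add: D_def algebra_simps)
  qed
  have D: "D x = D 0" for x by (metis Dle nle_le)
  \<comment> \<open>\<open>D 0\<close> is the constant by which the two boundary functions
    differ.\<close>
  define f where "f = (\<lambda>z. if Im z \<ge> 0 then B1 z else cnj (B2 (cnj z)) + D 0)"
  have fd1: "(f has_field_derivative U1 z) (at z)" if "Im z > 0" for z
  proof -
    have "eventually (\<lambda>w. w \<in> C_plus) (nhds z)" using that op(1) by (intro eventually_nhds_in_open) auto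
    then have "eventually (\<lambda>w. f w = A1 w) (nhds z)" by eventually_elim (auto simp: f_def B1)
    then show ?thesis using A1[OF that] by (subst DERIV_cong_ev[OF refl _ refl]) auto
  qed
  have opm: "open {z. Im z < 0}" by (rule open_halfspace_Im_lt)
  have fd2: "(f has_field_derivative cnj (U2 (cnj z))) (at z)" if "Im z < 0" for z
  proof -
    have "eventually (\<lambda>w. w \<in> {z. Im z < 0}) (nhds z)" using that opm by (intro eventually_nhds_in_open) auto
    then have "eventually (\<lambda>w. f w = (cnj \<circ> A2 \<circ> cnj) w + D 0) (nhds z)" by eventually_elim (auto simp: f_def B2)
    moreover have "((\<lambda>w. (cnj \<circ> A2 \<circ> cnj) w + D 0) has_field_derivative cnj (U2 (cnj z))) (at z)"
      using DERIV_add[OF has_field_derivative_cnj_cnj[OF A2[of "cnj z"]] DERIV_const[of "D 0"]] that by simp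
    ultimately show ?thesis by (subst DERIV_cong_ev[OF refl _ refl]) auto
  qed
  have cf: "continuous_on UNIV f"
  proof -
    have "continuous_on ({z. Im z \<ge> 0} \<union> {z. Im z \<le> 0}) f"
      unfolding f_def
    proof (rule continuous_on_cases)
      show "closed {z. Im z \<ge> 0}" "closed {z. Im z \<le> 0}" by (simp_all add: closed_halfspace_Im_ge closed_halfspace_Im_le)
      show "continuous_on {z. Im z \<le> 0} (\<lambda>z. cnj (B2 (cnj z)) + D 0)"
        by (intro continuous_intros continuous_on_compose2[OF B2(1)]) auto
      have "B1 z = cnj (B2 (cnj z)) + D 0" if "Im z = 0" for z
      proof -
        have "z = Complex (Re z) 0" "cnj z = Complex (Re z) 0" using that by (auto simp: complex_eq_iff)
        then show ?thesis using D[of "Re z"] unfolding D_def by (metis add.commute diff_add_cancel)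
      qed
      then show "\<forall>z. z \<in> {z. 0 \<le> Im z} \<and> \<not> 0 \<le> Im z \<or> z \<in> {z. Im z \<le> 0} \<and> 0 \<le> Im z \<longrightarrow>
          B1 z = cnj (B2 (cnj z)) + D 0" by auto
    qed (use B1 in auto)
    moreover have "{z. Im z \<ge> 0} \<union> {z. Im z \<le> 0} = (UNIV :: complex set)" by auto
    ultimately show ?thesis by simp
  qed
  have hf: "f holomorphic_on UNIV"
  \<comment> \<open>The real line is given by its normal \<open>\<i>\<close>: the inner product of
    \<open>\<i>\<close> with \<open>z\<close> is \<open>Im z\<close>.\<close>
  proof (rule holomorphic_on_paste_across_line[of UNIV \<i> f 0])
    show "f holomorphic_on UNIV \<inter> {z. \<i> \<bullet> z < 0}"
    proof -
      have "UNIV \<inter> {z. \<i> \<bullet> z < 0} = {z. Im z < 0}" by (auto simp: inner_complex_def)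
      moreover have "f holomorphic_on {z. Im z < 0}"
        using fd2 by (auto simp: holomorphic_on_open[OF opm])
      ultimately show ?thesis by simp
    qed
    show "f holomorphic_on UNIV \<inter> {z. 0 < \<i> \<bullet> z}"
    proof -
      have "UNIV \<inter> {z. 0 < \<i> \<bullet> z} = C_plus" by (auto simp: inner_complex_def)
      moreover have "f holomorphic_on C_plus"
        using fd1 by (auto simp: holomorphic_on_open[OF op(1)])
      ultimately show ?thesis by simp
    qed
  qed (use cf in auto)
  show thesis
  proof
    show "deriv f holomorphic_on UNIV" using hf by (intro holomorphic_deriv) auto
    show "deriv f z = U1 z" if "Im z > 0" for z using fd1[OF that] by (rule DERIV_imp_deriv)
    show "deriv f (cnj z) = cnj (U2 z)" if "Im z > 0" for z
      using fd2[of "cnj z"] that by (auto intro: DERIV_imp_deriv)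
  qed
qed

subsection \<open>The weights\<close>

text \<open>The modulus of the base of one factor of the weight. On the upper half-plane it is
  bounded below, and it is bounded above away from \<open>c\<close>; so the powers of
  \<open>rho\<close> record only the singularity at \<open>c\<close>, and growth at infinity is left
  to \<open>z + \<i>\<close>.\<close>

definition rho :: "real \<Rightarrow> complex \<Rightarrow> real" where
  "rho c z = cmod (z + \<i>) / cmod (z - of_real c)"

lemma norm_plus_i_ge:
  assumes "Im z \<ge> 0" shows "cmod (z + \<i>) \<ge> 1" "cmod (z + \<i>) \<ge> \<bar>Re z\<bar>" "cmod (z + \<i>) \<ge> (1 + \<bar>Re z\<bar>) / 2"
  using abs_Im_le_cmod[of "z + \<i>"] abs_Re_le_cmod[of "z + \<i>"] assms by auto

lemma rho_nonneg [simp]: "rho c z \<ge> 0" by (simp add: rho_def)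

lemma rho_ge:
  assumes "Im z \<ge> 0" "z \<noteq> of_real c"
  shows "rho c z \<ge> 1 / (1 + cmod (of_real c + \<i>))"
proof -
  have "cmod (z - of_real c) \<le> cmod (z + \<i>) + cmod (of_real c + \<i>)"
    using norm_triangle_ineq4[of "z + \<i>" "of_real c + \<i>"] by simp
  also have "\<dots> \<le> cmod (z + \<i>) + cmod (of_real c + \<i>) * cmod (z + \<i>)"
    using norm_plus_i_ge[OF assms(1)] by (simp add: mult_le_cancel_left1)
  finally have "cmod (z - of_real c) \<le> (1 + cmod (of_real c + \<i>)) * cmod (z + \<i>)" by (simp add: algebra_simps)
  moreover have "1 + cmod (of_real c + \<i>) > 0" by (simp add: add_pos_nonneg)
  ultimately show ?thesis using assms by (simp add: rho_def field_simps)
qed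

lemma rho_pos: "Im z \<ge> 0 \<Longrightarrow> z \<noteq> of_real c \<Longrightarrow> rho c z > 0"
  using norm_plus_i_ge(1)[of z] by (auto simp: rho_def intro!: divide_pos_pos)

lemma rho_le:
  assumes "d > 0" "cmod (z - of_real c) \<ge> d"
  shows "rho c z \<le> 1 + cmod (of_real c + \<i>) / d"
proof -
  have "cmod (z + \<i>) \<le> cmod (z - of_real c) + cmod (of_real c + \<i>)"
    using norm_triangle_ineq[of "z - of_real c" "of_real c + \<i>"] by simp
  then have "rho c z \<le> (cmod (z - of_real c) + cmod (of_real c + \<i>)) / cmod (z - of_real c)"
    unfolding rho_def by (rule divide_right_mono) simp
  also have "\<dots> = 1 + cmod (of_real c + \<i>) / cmod (z - of_real c)"
  proof -
    have "cmod (z - of_real c) \<noteq> 0" using assms by linarith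
    then show ?thesis by (simp only: add_divide_distrib divide_self_if if_False)
  qed
  also have "\<dots> \<le> 1 + cmod (of_real c + \<i>) / d"
  proof -
    have "cmod (z - of_real c) > 0" using assms by linarith
    then show ?thesis using assms by (intro add_left_mono divide_left_mono mult_pos_pos) auto
  qed
  finally show ?thesis .
qed

text \<open>The points are distinct, so at most one factor can be large at a given \<open>z\<close>,
  and the product of the singularities is no worse than their sum. Exponents below \<open>a\<close>,
  even negative ones, may be raised to \<open>a\<close> because \<open>rho\<close> is bounded
  below.\<close>

lemma prod_rho_le:
  assumes "finite S" and a: "a \<ge> 0" and "\<And>c. c \<in> S \<Longrightarrow> f c \<le> a"
  shows "\<exists>C\<ge>0. \<forall>z. Im z > 0 \<longrightarrow> (\<Prod>c\<in>S. rho c z powr f c) \<le> C * (1 + (\<Sum>c\<in>S. rho c z powr a))"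
  using assms(1,3)
proof (induction S rule: finite_induct)
  case empty
  show ?case by (intro exI[of _ 1]) auto
next
  case (insert c0 S)
  then obtain C where C: "C \<ge> 0" "\<And>z. Im z > 0 \<Longrightarrow> (\<Prod>c\<in>S. rho c z powr f c) \<le> C * (1 + (\<Sum>c\<in>S. rho c z powr a))"
    by auto
  \<comment> \<open>The lower bound of \<open>rho c0\<close>, raised to the nonpositive power
    \<open>f c0 - a\<close>.\<close>
  define K where "K = (1 + cmod (of_real c0 + \<i>)) powr (a - f c0)"
  \<comment> \<open>Every \<open>z\<close> is at least half of \<open>\<bar>c - c0\<bar>\<close>
    away from one of the two points, and there \<open>rho_le\<close> bounds the corresponding
    factor. The sum of both bounds covers either case.\<close>
  define Lc where "Lc = (\<lambda>c. (1 + cmod (of_real c + \<i>) / (\<bar>c - c0\<bar> / 2)) powr a + (1 + cmod (of_real c0 + \<i>) / (\<bar>c - c0\<bar> / 2)) powr a)"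
  define L where "L = (\<Sum>c\<in>S. Lc c)"
  have L: "L \<ge> 0" by (auto simp: L_def Lc_def intro!: sum_nonneg)
  have single: "rho c0 z powr f c0 \<le> K * rho c0 z powr a" if z: "Im z > 0" for z
  proof -
    have zc: "z \<noteq> of_real c0" using z by auto
    have pos: "rho c0 z > 0" using z zc by (intro rho_pos) auto
    have "1 / (1 + cmod (of_real c0 + \<i>)) \<le> rho c0 z" using z zc by (intro rho_ge) auto
    then have "rho c0 z powr (f c0 - a) \<le> (1 / (1 + cmod (of_real c0 + \<i>))) powr (f c0 - a)"
      using insert.prems[of c0] by (intro powr_mono2') (auto simp: add_pos_nonneg)
    also have "\<dots> = K"
      unfolding K_def powr_divide using powr_minus_divide[of "1 + cmod (of_real c0 + \<i>)" "f c0 - a"] by simp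
    finally have "rho c0 z powr (f c0 - a) * rho c0 z powr a \<le> K * rho c0 z powr a" by (intro mult_right_mono) auto
    then show ?thesis using pos by (simp flip: powr_add)
  qed
  have pair: "rho c z powr a * rho c0 z powr a \<le> Lc c * (rho c z powr a + rho c0 z powr a)"
    if c: "c \<in> S" for c z
  proof -
    have cc: "c \<noteq> c0" using c insert.hyps by auto
    define d where "d = \<bar>c - c0\<bar> / 2"
    have d: "d > 0" using cc by (simp add: d_def)
    have "cmod (of_real c - of_real c0) \<le> cmod (z - of_real c) + cmod (z - of_real c0)"
      using norm_triangle_ineq4[of "z - of_real c0" "z - of_real c"] by simp
    then have "2 * d \<le> cmod (z - of_real c) + cmod (z - of_real c0)"
      by (simp add: d_def flip: of_real_diff)
    then consider "d \<le> cmod (z - of_real c)" | "d \<le> cmod (z - of_real c0)" by linarith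
    then show ?thesis
    proof cases
      case 1
      have "rho c z powr a \<le> (1 + cmod (of_real c + \<i>) / d) powr a"
        using rho_le[OF d 1] a by (intro powr_mono2) auto
      then have "rho c z powr a \<le> Lc c" unfolding Lc_def d_def by (rule order_trans) simp
      then have "rho c z powr a * rho c0 z powr a \<le> Lc c * rho c0 z powr a" by (rule mult_right_mono) simp
      also have "\<dots> \<le> Lc c * (rho c z powr a + rho c0 z powr a)" by (rule mult_left_mono) (auto simp: Lc_def)
      finally show ?thesis .
    next
      case 2
      have "rho c0 z powr a \<le> (1 + cmod (of_real c0 + \<i>) / d) powr a"
        using rho_le[OF d 2] a by (intro powr_mono2) auto
      then have "rho c0 z powr a \<le> Lc c" unfolding Lc_def d_def by (rule order_trans) simp
      then have "rho c z powr a * rho c0 z powr a \<le> rho c z powr a * Lc c" by (rule mult_left_mono) simp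
      also have "\<dots> \<le> Lc c * (rho c z powr a + rho c0 z powr a)" by (simp add: Lc_def algebra_simps)
      finally show ?thesis .
    qed
  qed
  show ?case
  proof (intro exI[of _ "C * K * (1 + L)"] conjI allI impI)
    show "0 \<le> C * K * (1 + L)" using C L by (simp add: K_def)
    fix z :: complex assume z: "Im z > 0"
    define s where "s = (\<Sum>c\<in>S. rho c z powr a)"
    define q where "q = rho c0 z powr a"
    have s: "s \<ge> 0" and q: "q \<ge> 0" by (auto simp: s_def q_def intro!: sum_nonneg)
    have sq: "s * q \<le> L * (s + q)"
    proof -
      have "s * q = (\<Sum>c\<in>S. rho c z powr a * q)" by (simp add: s_def sum_distrib_right)
      also have "\<dots> \<le> (\<Sum>c\<in>S. Lc c * (rho c z powr a + q))"
        unfolding q_def by (intro sum_mono pair)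
      also have "\<dots> \<le> (\<Sum>c\<in>S. Lc c * (s + q))"
      proof (intro sum_mono mult_left_mono add_right_mono)
        fix c assume "c \<in> S"
        then show "rho c z powr a \<le> s" unfolding s_def using insert.hyps by (intro member_le_sum) auto
      qed (auto simp: Lc_def)
      finally show ?thesis by (simp add: L_def sum_distrib_right)
    qed
    have "(\<Prod>c\<in>insert c0 S. rho c z powr f c) = rho c0 z powr f c0 * (\<Prod>c\<in>S. rho c z powr f c)"
      using insert.hyps by simp
    also have "\<dots> \<le> (K * q) * (C * (1 + s))"
      unfolding q_def s_def using single[OF z] C(2)[OF z]
      by (intro mult_mono) (auto simp: K_def intro!: prod_nonneg)
    also have "\<dots> = C * K * (q + s * q)" by (simp add: algebra_simps)
    also have "\<dots> \<le> C * K * (q + L * (s + q))"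
      using sq C by (intro mult_left_mono add_left_mono) (auto simp: K_def)
    also have "\<dots> \<le> C * K * ((1 + L) * (1 + (q + s)))"
      using C L s q by (intro mult_left_mono) (auto simp: K_def algebra_simps)
    finally show "(\<Prod>c\<in>insert c0 S. rho c z powr f c) \<le> C * K * (1 + L) * (1 + (\<Sum>c\<in>insert c0 S. rho c z powr a))"
      using insert.hyps by (simp add: q_def s_def algebra_simps)
  qed
qed

section \<open>Integrable majorants common to all horizontal lines\<close>

lemma nn_integral_abs_shift_finite:
  fixes g :: "real \<Rightarrow> real"
  assumes [measurable]: "g \<in> borel_measurable borel"
    and fin: "(\<integral>\<^sup>+x. ennreal (g x) * indicator {0..} x \<partial>lborel) < \<infinity>"
  shows "(\<integral>\<^sup>+x. ennreal (g \<bar>x - c\<bar>) \<partial>lborel) < \<infinity>"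
proof -
  let ?I = "\<integral>\<^sup>+x. ennreal (g x) * indicator {0..} x \<partial>lborel"
  have 1: "(\<integral>\<^sup>+x. ennreal (g (x - c)) * indicator {0..} (x - c) \<partial>lborel) = ?I"
    using nn_integral_real_affine[of "\<lambda>x. ennreal (g x) * indicator {0..} x" 1 "-c"] by simp
  have 2: "(\<integral>\<^sup>+x. ennreal (g (c - x)) * indicator {0..} (c - x) \<partial>lborel) = ?I"
    using nn_integral_real_affine[of "\<lambda>x. ennreal (g x) * indicator {0..} x" "-1" c] by simp
  have "(\<integral>\<^sup>+x. ennreal (g \<bar>x - c\<bar>) \<partial>lborel) \<le>
      (\<integral>\<^sup>+x. ennreal (g (x - c)) * indicator {0..} (x - c) + ennreal (g (c - x)) * indicator {0..} (c - x) \<partial>lborel)"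
    by (intro nn_integral_mono) (auto simp: indicator_def abs_if)
  also have "\<dots> = ?I + ?I" by (subst nn_integral_add) (auto simp: 1 2)
  also have "\<dots> < \<infinity>" using fin by simp
  finally show ?thesis .
qed

lemma nn_integral_local_powr_finite:
  assumes "a < 1"
  shows "(\<integral>\<^sup>+x. ennreal (if \<bar>x - c\<bar> \<le> 1 then \<bar>x - c\<bar> powr (-a) else 0) \<partial>lborel) < \<infinity>"
proof (rule nn_integral_abs_shift_finite[of "\<lambda>u. if u \<le> 1 then u powr (-a) else 0"])
  have "((\<lambda>x. x powr (-a)) has_integral (1 powr (-a + 1) / (-a + 1))) {0..1}"
    using assms by (intro has_integral_powr_from_0) auto
  moreover have "(\<lambda>x. if x \<in> {0..1} then x powr (-a) else 0) = (\<lambda>x. (if x \<le> 1 then x powr (-a) else 0) * indicator {0..} x)"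
    by (auto simp: fun_eq_iff indicator_def)
  ultimately have "((\<lambda>x. (if x \<le> 1 then x powr (-a) else 0) * indicator {0..} x) has_integral (1 powr (-a + 1) / (-a + 1))) UNIV"
    by (subst (asm) has_integral_restrict_UNIV[symmetric]) simp
  then have "(\<integral>\<^sup>+x. ennreal ((if x \<le> 1 then x powr (-a) else 0) * indicator {0..} x) \<partial>lborel) = ennreal (1 powr (-a + 1) / (-a + 1))"
    by (intro nn_integral_has_integral_lborel) auto
  moreover have "(\<integral>\<^sup>+x. ennreal (if x \<le> 1 then x powr (-a) else 0) * indicator {0..} x \<partial>lborel)
     = (\<integral>\<^sup>+x. ennreal ((if x \<le> 1 then x powr (-a) else 0) * indicator {0..} x) \<partial>lborel)"
    by (intro nn_integral_cong) (auto simp: indicator_def)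
  ultimately show "(\<integral>\<^sup>+x. ennreal (if x \<le> 1 then x powr (-a) else 0) * indicator {0..} x \<partial>lborel) < \<infinity>" by simp
qed auto

lemma nn_integral_global_powr_finite:
  assumes "b > 1"
  shows "(\<integral>\<^sup>+x. ennreal ((1 + \<bar>x\<bar>) powr (-b)) \<partial>lborel) < \<infinity>"
proof -
  have "(\<integral>\<^sup>+x. ennreal ((1 + \<bar>x - 0\<bar>) powr (-b)) \<partial>lborel) < \<infinity>"
  proof (rule nn_integral_abs_shift_finite[of "\<lambda>u. (1 + u) powr (-b)"])
    have "((\<lambda>x. x powr (-b)) has_integral (- (1 powr (-b + 1)) / (-b + 1))) {1..}"
      using assms by (intro has_integral_powr_to_inf) auto
    moreover have "(\<lambda>x. if x \<in> {1..} then x powr (-b) else 0) = (\<lambda>x. x powr (-b) * indicator {1..} x)"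
      by (auto simp: fun_eq_iff indicator_def)
    ultimately have "((\<lambda>x. x powr (-b) * indicator {1..} x) has_integral (- (1 powr (-b + 1)) / (-b + 1))) UNIV"
      by (subst (asm) has_integral_restrict_UNIV[symmetric]) simp
    then have fin: "(\<integral>\<^sup>+x. ennreal (x powr (-b) * indicator {1..} x) \<partial>lborel) = ennreal (- (1 powr (-b + 1)) / (-b + 1))"
      by (intro nn_integral_has_integral_lborel) auto
    have "(\<integral>\<^sup>+x. ennreal ((1 + x) powr (-b)) * indicator {0..} x \<partial>lborel)
       = (\<integral>\<^sup>+x. ennreal ((1 + 1 * x) powr (-b) * indicator {1..} (1 + 1 * x)) \<partial>lborel)"
      by (intro nn_integral_cong) (auto simp: indicator_def)
    also have "\<dots> = (\<integral>\<^sup>+x. ennreal (x powr (-b) * indicator {1..} x) \<partial>lborel)"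
      using nn_integral_real_affine[of "\<lambda>x. ennreal (x powr (-b) * indicator {1..} x)" 1 1] by simp
    finally show "(\<integral>\<^sup>+x. ennreal ((1 + x) powr (-b)) * indicator {0..} x \<partial>lborel) < \<infinity>"
      unfolding fin by simp
  qed auto
  then show ?thesis by simp
qed

text \<open>\<open>w\<close> does not involve \<open>y\<close>, which yields bounds uniform in the
  height. Moving towards the line can only bring \<open>z\<close> closer to \<open>c\<close>, up to
  distance \<open>\<bar>x - c\<bar>\<close>, so near \<open>c\<close> the power of that distance
  dominates; elsewhere \<open>rho\<close> is bounded and the decay of \<open>z + \<i>\<close>
  suffices. The points of \<open>S\<close> themselves are excluded because the bound by
  \<open>\<bar>x - c\<bar>\<close> degenerates there.\<close>

lemma rho_weight_majorant:
  assumes S: "finite S" and a: "0 \<le> a" "a < 1" and b: "b > 1"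
  obtains w where "w \<in> borel_measurable borel" "\<And>x. w x \<ge> 0" "(\<integral>\<^sup>+x. ennreal (w x) \<partial>lborel) < \<infinity>"
    "\<And>x y. y > 0 \<Longrightarrow> x \<notin> S \<Longrightarrow>
      (1 + (\<Sum>c\<in>S. rho c (Complex x y) powr a)) * cmod (Complex x y + \<i>) powr (-b) \<le> w x"
proof
  define L where "L = (\<lambda>c x::real. if \<bar>x - c\<bar> \<le> 1 then \<bar>x - c\<bar> powr (-a) else 0)"
  define G where "G = (\<lambda>x::real. (1 + \<bar>x\<bar>) powr (-b))"
  define k where "k = (\<lambda>c. (1 + cmod (of_real c + \<i>)) powr a)"
  \<comment> \<open>\<open>2 powr b\<close> comes from
    \<open>cmod (z + \<i>) \<ge> (1 + \<bar>x\<bar>) / 2\<close>.\<close>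
  define w where "w = (\<lambda>x. 2 powr b * (G x + (\<Sum>c\<in>S. k c * (L c x + G x))))"
  have k: "k c \<ge> 0" for c by (simp add: k_def)
  have L: "L c x \<ge> 0" for c x by (simp add: L_def)
  have G: "G x \<ge> 0" for x by (simp add: G_def)
  have [measurable]: "L c \<in> borel_measurable borel" "G \<in> borel_measurable borel" for c
    by (auto simp: L_def G_def)
  show "w \<in> borel_measurable borel" by (auto simp: w_def)
  show "w x \<ge> 0" for x using k L G by (auto simp: w_def intro!: sum_nonneg mult_nonneg_nonneg add_nonneg_nonneg)
  have iL: "integrable lborel (L c)" for c
    using nn_integral_local_powr_finite[OF a(2), of c] L by (intro integrableI_nonneg) (auto simp: L_def)
  have iG: "integrable lborel G"
    using nn_integral_global_powr_finite[OF b] G by (intro integrableI_nonneg) (auto simp: G_def)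
  have "integrable lborel w" unfolding w_def
    by (intro integrable_mult_right Bochner_Integration.integrable_add Bochner_Integration.integrable_sum iL iG)
  then show "(\<integral>\<^sup>+x. ennreal (w x) \<partial>lborel) < \<infinity>"
    using \<open>\<And>x. w x \<ge> 0\<close> by (subst nn_integral_eq_integral) auto
  fix x y :: real assume y: "y > 0" and x: "x \<notin> S"
  define t where "t = cmod (Complex x y + \<i>) powr (-b)"
  have t0: "t \<ge> 0" by (simp add: t_def)
  have t1: "t \<le> 1" unfolding t_def
    using norm_plus_i_ge(1)[of "Complex x y"] y b powr_mono2'[of "-b" 1 "cmod (Complex x y + \<i>)"] by simp
  have tG: "t \<le> 2 powr b * G x"
  proof -
    have "t \<le> ((1 + \<bar>x\<bar>) / 2) powr (-b)" unfolding t_def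
      using norm_plus_i_ge(3)[of "Complex x y"] y b by (intro powr_mono2') auto
    also have "\<dots> = 2 powr b * G x"
      by (simp add: G_def powr_divide powr_minus field_simps)
    finally show ?thesis .
  qed
  have r: "rho c (Complex x y) powr a * t \<le> k c * (2 powr b * (L c x + G x))" if c: "c \<in> S" for c
  proof -
    have xc: "\<bar>x - c\<bar> > 0" using x c by auto
    have dist: "cmod (Complex x y - of_real c) \<ge> \<bar>x - c\<bar>" using abs_Re_le_cmod[of "Complex x y - of_real c"] by simp
    show ?thesis
    proof (cases "\<bar>x - c\<bar> \<le> 1")
      case True
      have "rho c (Complex x y) \<le> 1 + cmod (of_real c + \<i>) / \<bar>x - c\<bar>" by (rule rho_le[OF xc dist])
      also have "\<dots> \<le> (1 + cmod (of_real c + \<i>)) / \<bar>x - c\<bar>"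
        using True xc by (simp add: add_divide_distrib)
      finally have "rho c (Complex x y) powr a \<le> ((1 + cmod (of_real c + \<i>)) / \<bar>x - c\<bar>) powr a"
        using a by (intro powr_mono2) auto
      also have "\<dots> = k c * L c x" using True by (simp add: k_def L_def powr_divide powr_minus field_simps)
      finally have "rho c (Complex x y) powr a * t \<le> k c * L c x * 1"
        using t0 t1 k L by (intro mult_mono) auto
      also have "\<dots> \<le> k c * (2 powr b * (L c x + G x))"
      proof -
        have "1 * L c x \<le> 2 powr b * (L c x + G x)"
          using L G b ge_one_powr_ge_zero[of 2 b] by (intro mult_mono) auto
        then show ?thesis using k by (simp add: mult_left_mono)
      qed
      finally show ?thesis .
    next
      case False
      then have "rho c (Complex x y) \<le> 1 + cmod (of_real c + \<i>) / 1" using dist by (intro rho_le) auto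
      then have "rho c (Complex x y) powr a \<le> k c" using a unfolding k_def by (intro powr_mono2) auto
      then have "rho c (Complex x y) powr a * t \<le> k c * (2 powr b * G x)"
        using tG t0 k by (intro mult_mono) auto
      also have "\<dots> \<le> k c * (2 powr b * (L c x + G x))"
        using k L by (intro mult_left_mono) auto
      finally show ?thesis .
    qed
  qed
  have "(1 + (\<Sum>c\<in>S. rho c (Complex x y) powr a)) * t = t + (\<Sum>c\<in>S. rho c (Complex x y) powr a * t)"
    by (simp add: distrib_right sum_distrib_right)
  also have "\<dots> \<le> 2 powr b * G x + (\<Sum>c\<in>S. k c * (2 powr b * (L c x + G x)))"
    by (intro add_mono tG sum_mono r)
  also have "\<dots> = w x" by (simp add: w_def distrib_left sum_distrib_left mult_ac)
  finally show "(1 + (\<Sum>c\<in>S. rho c (Complex x y) powr a)) * cmod (Complex x y + \<i>) powr (-b) \<le> w x"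
    unfolding t_def .
qed

text \<open>The analytic factor \<open>V\<close> of the symbol, with exponent \<open>e c\<close> at the points \<open>c \<in> S\<close> and \<open>a\<close> at infinity.\<close>

definition wt :: "real set \<Rightarrow> (real \<Rightarrow> real) \<Rightarrow> real \<Rightarrow> complex \<Rightarrow> complex" where
  "wt S e a z = (\<Prod>c\<in>S. ((z + \<i>) / (z - of_real c)) powr of_real (e c)) * (z + \<i>) powr of_real a"

lemma plus_i_not_nonpos: "Im z \<ge> 0 \<Longrightarrow> z + \<i> \<notin> \<real>\<^sub>\<le>\<^sub>0"
  by (auto simp: complex_nonpos_Reals_iff)

lemma plus_i_nonzero: "Im z \<ge> 0 \<Longrightarrow> z + \<i> \<noteq> 0"
  using plus_i_not_nonpos by fastforce

lemma upper_neq_of_real: "Im z > 0 \<Longrightarrow> z \<noteq> of_real c" by auto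

lemma wt_holomorphic: "wt S e a holomorphic_on C_plus"
proof -
  have 1: "(z + \<i>) / (z - of_real c) \<notin> \<real>\<^sub>\<le>\<^sub>0" "z - of_real c \<noteq> 0" "z + \<i> \<notin> \<real>\<^sub>\<le>\<^sub>0" if "Im z > 0" for z c
    using w_not_nonpos[of z c] plus_i_not_nonpos[of z] upper_neq_of_real[OF that] that by auto
  show ?thesis
    unfolding wt_def by (intro holomorphic_intros) (use 1 in auto)
qed

abbreviation vlim :: "(complex \<Rightarrow> complex) \<Rightarrow> real \<Rightarrow> complex \<Rightarrow> bool" where
  "vlim F x l \<equiv> ((\<lambda>y. F (Complex x y)) \<longlongrightarrow> l) (at_right 0)"

lemma wt_vertical_limit:
  assumes "x \<notin> S"
  shows "vlim (wt S e a) x (wt S e a x)"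
proof -
  have l: "((\<lambda>y. Complex x y) \<longlongrightarrow> of_real x) (at_right 0)"
    unfolding complex_of_real_def by (intro tendsto_Complex tendsto_intros)
  have "((\<lambda>y. ((Complex x y + \<i>) / (Complex x y - of_real c)) powr of_real (e c)) \<longlongrightarrow>
       ((of_real x + \<i>) / (of_real x - of_real c)) powr of_real (e c)) (at_right 0)" if "c \<in> S" for c
    using assms that by (intro tendsto_powr_complex tendsto_intros l w_not_nonpos) auto
  moreover have "((\<lambda>y. (Complex x y + \<i>) powr of_real a) \<longlongrightarrow> (of_real x + \<i>) powr of_real a) (at_right 0)"
    by (intro tendsto_powr_complex tendsto_intros l plus_i_not_nonpos) auto
  ultimately show ?thesis
    unfolding wt_def by (intro tendsto_mult tendsto_prod)
qed

lemma wt_nonzero: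
  assumes "finite S" "Im z \<ge> 0" "\<And>c. c \<in> S \<Longrightarrow> z \<noteq> of_real c"
  shows "wt S e a z \<noteq> 0"
  using assms plus_i_nonzero by (auto simp: wt_def prod_zero_iff)

lemma norm_wt:
  "cmod (wt S e a z) = (\<Prod>c\<in>S. rho c z powr e c) * cmod (z + \<i>) powr a"
  by (simp add: wt_def norm_mult prod_norm[symmetric] norm_powr_real_powr' norm_divide rho_def)

lemma norm_powi_plus_i: "Im z \<ge> 0 \<Longrightarrow> cmod ((z + \<i>) powi n) = cmod (z + \<i>) powr of_int n"
  using plus_i_nonzero[of z] by (simp add: norm_power_int powr_real_of_int')

section \<open>Quotients of Hardy functions by the weight\<close>

definition wt_quot :: "real set \<Rightarrow> (real \<Rightarrow> real) \<Rightarrow> real \<Rightarrow> int \<Rightarrow> (complex \<Rightarrow> complex) \<Rightarrow> complex \<Rightarrow> complex" where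
  "wt_quot S e a n F z = F z / wt S e a z * (z + \<i>) powi n"

lemma wt_quot_holomorphic:
  assumes "finite S" "F holomorphic_on C_plus"
  shows "wt_quot S e a n F holomorphic_on C_plus"
proof -
  have "wt S e a z \<noteq> 0" "z + \<i> \<noteq> 0" if "z \<in> C_plus" for z
    using that wt_nonzero[OF assms(1), of z e a] plus_i_nonzero[of z] upper_neq_of_real[of z] by auto
  then show ?thesis
    unfolding wt_quot_def using assms by (intro holomorphic_intros wt_holomorphic) auto
qed

text \<open>Brings the quotient into the shape handled by \<open>prod_rho_le\<close>, with exponents
  \<open>- e c\<close>. This is where lower bounds on \<open>e\<close> turn into bounds on the
  singularities.\<close>

lemma norm_wt_quot:
  assumes "Im z > 0"
  shows "cmod (wt_quot S e a n F z) = cmod (F z) * (\<Prod>c\<in>S. rho c z powr (- e c)) * cmod (z + \<i>) powr (of_int n - a)"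
proof -
  have pos: "cmod (z + \<i>) > 0" using plus_i_nonzero[of z] assms by auto
  have "cmod (wt_quot S e a n F z) = cmod (F z) * inverse (\<Prod>c\<in>S. rho c z powr e c) * (cmod (z + \<i>) powr of_int n / cmod (z + \<i>) powr a)"
    unfolding wt_quot_def norm_mult norm_divide norm_wt norm_powi_plus_i[OF less_imp_le[OF assms]] by (simp add: field_simps)
  also have "inverse (\<Prod>c\<in>S. rho c z powr e c) = (\<Prod>c\<in>S. rho c z powr (- e c))"
    by (simp add: prod_inversef[symmetric] powr_minus)
  finally show ?thesis by (simp add: powr_diff)
qed

lemma norm_plus_i_le:
  assumes "0 \<le> Im z" "cmod z \<ge> 1"
  shows "cmod (z + \<i>) powr e \<le> 2 powr \<bar>e\<bar> * cmod z powr e"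
proof -
  have 1: "cmod (z + \<i>) \<le> 2 * cmod z" using norm_triangle_ineq[of z \<i>] assms by simp
  have "cmod z ^ 2 \<le> cmod (z + \<i>) ^ 2"
    unfolding cmod_power2 using assms by (simp add: power2_eq_square algebra_simps)
  then have 2: "cmod z \<le> cmod (z + \<i>)" by (rule power2_le_imp_le) simp
  show ?thesis
  proof (cases "e \<ge> 0")
    case True
    then have "cmod (z + \<i>) powr e \<le> (2 * cmod z) powr e" using 1 by (intro powr_mono2) auto
    then show ?thesis using True by (simp add: powr_mult)
  next
    case False
    then have "cmod (z + \<i>) powr e \<le> 1 * cmod z powr e"
      using False 2 assms(2) by (simp, intro powr_mono2') auto
    also have "\<dots> \<le> 2 powr \<bar>e\<bar> * cmod z powr e" by (intro mult_right_mono ge_one_powr_ge_zero) auto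
    finally show ?thesis .
  qed
qed

lemma norm_plus_i_le_box:
  assumes "0 < Im z" "Im z \<le> R" "\<bar>Re z\<bar> \<le> R"
  shows "cmod (z + \<i>) powr e \<le> (2 * R + 1) powr \<bar>e\<bar>"
proof -
  have 1: "cmod (z + \<i>) \<le> 2 * R + 1"
    using norm_triangle_ineq[of z \<i>] cmod_le[of z] assms by simp
  have 2: "1 \<le> cmod (z + \<i>)" using norm_plus_i_ge assms by auto
  have "cmod (z + \<i>) powr e \<le> cmod (z + \<i>) powr \<bar>e\<bar>" using 2 by (intro powr_mono) auto
  also have "\<dots> \<le> (2 * R + 1) powr \<bar>e\<bar>" using 1 by (intro powr_mono2) auto
  finally show ?thesis .
qed

text \<open>In a box each \<open>rho\<close> is at most a constant times \<open>1 / Im z\<close>, so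
  the weight costs \<open>Im z powr (-\<delta>)\<close> on top of the bound on \<open>F\<close>.
  With \<open>\<gamma> = 1 / p\<close> and \<open>\<delta> < 1 - 1 / p\<close> the total exponent
  stays below 1, as gluing requires.\<close>

lemma wt_quot_local_bound:
  assumes S: "finite S" and \<delta>: "0 \<le> \<delta>" "\<And>c. c \<in> S \<Longrightarrow> - e c \<le> \<delta>"
    and K: "K \<ge> 0" "\<And>z. Im z > 0 \<Longrightarrow> cmod (F z) \<le> K * Im z powr (-\<gamma>)"
  shows "vert_dominated (\<delta> + \<gamma>) (wt_quot S e a n F)"
proof (intro allI, goal_cases)
  case (1 R)
  obtain C where C: "C \<ge> 0" "\<And>z. Im z > 0 \<Longrightarrow> (\<Prod>c\<in>S. rho c z powr (- e c)) \<le> C * (1 + (\<Sum>c\<in>S. rho c z powr \<delta>))"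
    using prod_rho_le[OF S \<delta>(1), of "\<lambda>c. - e c"] \<delta>(2) by blast
  define D where "D = (R powr \<delta> + (\<Sum>c\<in>S. (R + cmod (of_real c + \<i>)) powr \<delta>))"
  have "cmod (wt_quot S e a n F z) \<le> (K * (C * D) * (2 * R + 1) powr \<bar>of_int n - a\<bar>) * Im z powr (-(\<delta> + \<gamma>))"
    if z: "0 < Im z" "Im z \<le> R" "\<bar>Re z\<bar> \<le> R" for z
  proof -
    define y where "y = Im z"
    have y: "0 < y" "y \<le> R" using z by (auto simp: y_def)
    have "1 + (\<Sum>c\<in>S. rho c z powr \<delta>) \<le> D * y powr (-\<delta>)"
    proof -
      have "1 = y powr \<delta> * y powr (-\<delta>)" using y by (simp flip: powr_add)
      also have "\<dots> \<le> R powr \<delta> * y powr (-\<delta>)" using y \<delta> by (intro mult_right_mono powr_mono2) auto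
      finally have 1: "1 \<le> R powr \<delta> * y powr (-\<delta>)" .
      have 2: "rho c z powr \<delta> \<le> (R + cmod (of_real c + \<i>)) powr \<delta> * y powr (-\<delta>)" for c
      proof -
        have "rho c z \<le> 1 + cmod (of_real c + \<i>) / y"
          using y abs_Im_le_cmod[of "z - of_real c"] by (intro rho_le) (auto simp: y_def)
        also have "\<dots> = (y + cmod (of_real c + \<i>)) / y" using y by (simp add: add_divide_distrib)
        also have "\<dots> \<le> (R + cmod (of_real c + \<i>)) / y" using y by (intro divide_right_mono) auto
        finally have "rho c z powr \<delta> \<le> ((R + cmod (of_real c + \<i>)) / y) powr \<delta>" using \<delta> by (intro powr_mono2) auto
        also have "\<dots> = (R + cmod (of_real c + \<i>)) powr \<delta> * y powr (-\<delta>)"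
          by (simp add: powr_divide powr_minus_divide)
        finally show ?thesis .
      qed
      show ?thesis unfolding D_def distrib_right sum_distrib_right
        by (intro add_mono 1 sum_mono 2)
    qed
    then have P: "(\<Prod>c\<in>S. rho c z powr (- e c)) \<le> C * (D * y powr (-\<delta>))"
      using C z by (meson mult_left_mono order_trans)
    have "cmod (wt_quot S e a n F z) = cmod (F z) * (\<Prod>c\<in>S. rho c z powr (- e c)) * cmod (z + \<i>) powr (of_int n - a)"
      by (rule norm_wt_quot[OF z(1)])
    also have "\<dots> \<le> (K * y powr (-\<gamma>)) * (C * (D * y powr (-\<delta>))) * (2 * R + 1) powr \<bar>of_int n - a\<bar>"
      using K C(1) z P norm_plus_i_le_box[OF z] unfolding y_def
      by (intro mult_mono mult_nonneg_nonneg) (auto intro!: prod_nonneg simp: D_def sum_nonneg)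
    also have "\<dots> = (K * (C * D) * (2 * R + 1) powr \<bar>of_int n - a\<bar>) * (y powr (-\<delta>) * y powr (-\<gamma>))"
      by (simp add: mult_ac)
    also have "y powr (-\<delta>) * y powr (-\<gamma>) = y powr (-(\<delta> + \<gamma>))" unfolding powr_add[symmetric] by simp
    finally show ?thesis by (simp add: y_def)
  qed
  then show ?case by blast
qed

text \<open>Far out, all points of \<open>S\<close> are at distance at least 1 and the weights are
  bounded. The blow-up of \<open>F\<close> at the real line is absorbed by the factor
  \<open>Im z\<close>, because
  \<open>Im z powr (1 - \<gamma>) \<le> cmod z powr (1 - \<gamma>)\<close>; this is the form of
  bound that \<open>entire_taylor_coeff_eq_0\<close> accepts.\<close>

lemma wt_quot_growth:
  assumes S: "finite S" and \<delta>: "0 \<le> \<delta>" "\<And>c. c \<in> S \<Longrightarrow> - e c \<le> \<delta>" and \<gamma>: "\<gamma> \<le> 1"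
    and K: "K \<ge> 0" "\<And>z. Im z > 0 \<Longrightarrow> cmod (F z) \<le> K * Im z powr (-\<gamma>)"
  obtains R0 C' where "\<And>z. Im z > 0 \<Longrightarrow> cmod z \<ge> R0 \<Longrightarrow> Im z * cmod (wt_quot S e a n F z) \<le> C' * cmod z powr (of_int n - a + 1 - \<gamma>)" "C' \<ge> 0"
proof -
  obtain C where C: "C \<ge> 0" "\<And>z. Im z > 0 \<Longrightarrow> (\<Prod>c\<in>S. rho c z powr (- e c)) \<le> C * (1 + (\<Sum>c\<in>S. rho c z powr \<delta>))"
    using prod_rho_le[OF S \<delta>(1), of "\<lambda>c. - e c"] \<delta>(2) by blast
  define D where "D = (1 + (\<Sum>c\<in>S. (1 + cmod (of_real c + \<i>)) powr \<delta>))"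
  have D: "D \<ge> 0" by (auto simp: D_def intro!: sum_nonneg add_nonneg_nonneg)
  have nn: "K * (C * D) * 2 powr \<bar>of_int n - a\<bar> \<ge> 0" using K C D by simp
  have main: "Im z * cmod (wt_quot S e a n F z) \<le> K * (C * D) * 2 powr \<bar>of_int n - a\<bar> * cmod z powr (of_int n - a + 1 - \<gamma>)"
    if z: "Im z > 0" and big: "cmod z \<ge> 1 + (\<Sum>c\<in>S. \<bar>c\<bar>)" for z
  proof -
  have z1: "cmod z \<ge> 1"
  proof -
    have "0 \<le> (\<Sum>c\<in>S. \<bar>c\<bar>)" by (intro sum_nonneg) auto
    then show ?thesis using big by linarith
  qed
  have "rho c z powr \<delta> \<le> (1 + cmod (of_real c + \<i>)) powr \<delta>" if c: "c \<in> S" for c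
  proof -
    have "\<bar>c\<bar> \<le> (\<Sum>c\<in>S. \<bar>c\<bar>)" using S c by (intro member_le_sum) auto
    then have "cmod (z - of_real c) \<ge> 1" using big norm_triangle_ineq2[of z "of_real c"] by simp
    then have "rho c z \<le> 1 + cmod (of_real c + \<i>)" using rho_le[of 1 z c] by simp
    then show ?thesis using \<delta> by (intro powr_mono2) auto
  qed
  then have "1 + (\<Sum>c\<in>S. rho c z powr \<delta>) \<le> D" unfolding D_def by (intro add_left_mono sum_mono)
  then have P: "(\<Prod>c\<in>S. rho c z powr (- e c)) \<le> C * D" using C z by (meson mult_left_mono order_trans)
  have y: "Im z * Im z powr (-\<gamma>) \<le> cmod z powr (1 - \<gamma>)"
  proof -
    have "Im z * Im z powr (-\<gamma>) = Im z powr 1 * Im z powr (-\<gamma>)" using z by simp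
    also have "\<dots> = Im z powr (1 - \<gamma>)" unfolding powr_add[symmetric] by simp
    also have "\<dots> \<le> cmod z powr (1 - \<gamma>)" using z \<gamma> abs_Im_le_cmod[of z] by (intro powr_mono2) auto
    finally show ?thesis .
  qed
  have "Im z * cmod (wt_quot S e a n F z) = (Im z * cmod (F z)) * (\<Prod>c\<in>S. rho c z powr (- e c)) * cmod (z + \<i>) powr (of_int n - a)"
    by (simp add: norm_wt_quot[OF z])
  also have "\<dots> \<le> (K * cmod z powr (1 - \<gamma>)) * (C * D) * (2 powr \<bar>of_int n - a\<bar> * cmod z powr (of_int n - a))"
  proof -
    have "Im z * cmod (F z) \<le> K * (Im z * Im z powr (-\<gamma>))"
      using K(2)[OF z] z by (simp add: mult.left_commute)
    also have "\<dots> \<le> K * cmod z powr (1 - \<gamma>)" using y K by (intro mult_left_mono)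
    finally have 1: "Im z * cmod (F z) \<le> K * cmod z powr (1 - \<gamma>)" .
    have 2: "cmod (z + \<i>) powr (of_int n - a) \<le> 2 powr \<bar>of_int n - a\<bar> * cmod z powr (of_int n - a)"
      using z z1 by (intro norm_plus_i_le) auto
    show ?thesis
      by (rule mult_mono[OF mult_mono[OF 1 P] 2]) (use z K C D in \<open>auto intro!: prod_nonneg mult_nonneg_nonneg\<close>)
  qed
  also have "\<dots> = K * (C * D) * 2 powr \<bar>of_int n - a\<bar> * (cmod z powr (1 - \<gamma>) * cmod z powr (of_int n - a))"
    by (simp add: mult_ac)
  also have "cmod z powr (1 - \<gamma>) * cmod z powr (of_int n - a) = cmod z powr (of_int n - a + 1 - \<gamma>)"
    unfolding powr_add[symmetric] by (simp add: algebra_simps)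
  finally show ?thesis .
  qed
  show thesis by (rule that[OF main nn])
qed

text \<open>A Young inequality with constants 1. If \<open>y powr q \<le> x powr p\<close>, then
  \<open>y \<le> x powr (p / q)\<close> and the product is at most \<open>x powr p\<close>; the
  other case is symmetric.\<close>

lemma powr_mult_le_add:
  fixes x y p q t :: real
  assumes "x \<ge> 0" "y \<ge> 0" "p > 0" "q > 0" "t > 0" and t: "t / p + t / q = 1"
  shows "(x * y) powr t \<le> x powr p + y powr q"
proof -
  have *: "(x * y) powr t \<le> x powr p" if "y powr q \<le> x powr p" "x \<ge> 0" "y \<ge> 0" "p > 0" "q > 0" "t / p + t / q = 1" for x y p q
  proof -
    have "y = (y powr q) powr (1 / q)" using that by (simp add: powr_powr)
    also have "\<dots> \<le> (x powr p) powr (1 / q)" using that by (intro powr_mono2) auto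
    finally have "y \<le> x powr (p / q)" by (simp add: powr_powr)
    then have "(x * y) powr t \<le> (x * x powr (p / q)) powr t" using that assms(5) by (intro powr_mono2 mult_left_mono) auto
    also have "\<dots> = x powr (t + p / q * t)" using that by (simp add: powr_mult powr_powr powr_add)
    also have "t + p / q * t = p * (t / p + t / q)" using that by (simp add: field_simps)
    finally show ?thesis using that by simp
  qed
  show ?thesis
  proof (cases "y powr q \<le> x powr p")
    case True
    then show ?thesis using *[of y q x p] assms by (simp add: add_increasing2)
  next
    case False
    then show ?thesis using *[of x p y q] assms by (simp add: add_increasing mult.commute add.commute)
  qed
qed

text \<open>The exponent \<open>t\<close> satisfies \<open>1/t = 1/p + 1/q\<close>, where \<open>1/q\<close> is the midpoint of \<open>\<delta>\<close> and \<open>1 - 1/p\<close>: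
  then \<open>\<delta> q < 1\<close>, so the weight is locally in \<open>L\<^sup>q\<close>, and still \<open>t > 1\<close>.\<close>

lemma wt_quot_local_Lt_bound:
  assumes S: "finite S" and p: "p > 1" and \<delta>: "0 \<le> \<delta>" "\<delta> < 1 - 1 / p" "\<And>c. c \<in> S \<Longrightarrow> - e c \<le> \<delta>"
    and F: "Hardy_bound p C F" and C: "C \<ge> 0" and t_def: "t = 1 / (1 / p + (\<delta> + (1 - 1 / p)) / 2)"
  shows "t > 1" and "\<exists>K\<ge>0. \<forall>y. 0 < y \<and> y \<le> 1 \<longrightarrow>
    (\<integral>\<^sup>+x. ennreal (cmod (wt_quot S e a n F (Complex x y)) powr t) * indicator {-R..R} x \<partial>lborel) \<le> ennreal K"
proof -
  define q where "q = 2 / (\<delta> + (1 - 1 / p))"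
  have pp: "0 < 1 / p" "1 / p < 1" using p by auto
  have q: "q > 0" "\<delta> * q < 1" using \<delta> pp by (auto simp: q_def divide_simps)
  have s01: "0 < 1 / p + (\<delta> + (1 - 1 / p)) / 2" "1 / p + (\<delta> + (1 - 1 / p)) / 2 < 1"
  proof -
    define u where "u = 1 / p"
    have "0 < u + (\<delta> + (1 - u)) / 2" "u + (\<delta> + (1 - u)) / 2 < 1"
      using \<delta>(1,2) pp unfolding u_def[symmetric] by (simp_all add: field_simps)
    then show "0 < 1 / p + (\<delta> + (1 - 1 / p)) / 2" "1 / p + (\<delta> + (1 - 1 / p)) / 2 < 1" unfolding u_def .
  qed
  then have t: "t > 1" unfolding t_def by (subst less_divide_eq_1_pos)
  have iq: "1 / q = (\<delta> + (1 - 1 / p)) / 2" by (simp add: q_def)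
  have tpq: "t / p + t / q = 1"
  proof -
    have "t / p + t / q = t * (1 / p + 1 / q)" by (simp add: distrib_left)
    also have "\<dots> = 1" unfolding iq t_def using s01(1) by (metis nonzero_eq_divide_eq less_irrefl)
    finally show ?thesis .
  qed
  have ef: "- e c * q \<le> \<delta> * q" if "c \<in> S" for c using \<delta>(3)[OF that] q by (intro mult_right_mono) auto
  obtain C1 where C1: "C1 \<ge> 0" "\<And>z. Im z > 0 \<Longrightarrow> (\<Prod>c\<in>S. rho c z powr (- e c * q)) \<le> C1 * (1 + (\<Sum>c\<in>S. rho c z powr (\<delta> * q)))"
    using prod_rho_le[OF S mult_nonneg_nonneg[OF \<delta>(1) less_imp_le[OF q(1)]], of "\<lambda>c. - e c * q"] ef by blast
  \<comment> \<open>The decay exponent 2 is an arbitrary choice above 1 that makes the majorant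
    integrable; over a bounded interval it is undone by the factor
    \<open>(2 * R' + 1) powr 2\<close> in \<open>D2\<close>.\<close>
  obtain w where w [measurable]: "w \<in> borel_measurable borel" and w': "\<And>x. w x \<ge> 0" "(\<integral>\<^sup>+x. ennreal (w x) \<partial>lborel) < \<infinity>"
    "\<And>x y. y > 0 \<Longrightarrow> x \<notin> S \<Longrightarrow>
      (1 + (\<Sum>c\<in>S. rho c (Complex x y) powr (\<delta> * q))) * cmod (Complex x y + \<i>) powr (-2) \<le> w x"
    using rho_weight_majorant[OF S, of "\<delta> * q" 2] \<delta> q by auto
  \<comment> \<open>At least 1, so that the box contains all heights up to 1.\<close>
  define R' where "R' = max \<bar>R\<bar> 1"
  define D where "D = (2 * R' + 1) powr \<bar>of_int n - a\<bar>"
  define D2 where "D2 = C1 * (2 * R' + 1) powr 2"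
  have D: "D \<ge> 0" "D2 \<ge> 0" using C1 by (auto simp: D_def D2_def)
  obtain I where I: "(\<integral>\<^sup>+x. ennreal (w x) \<partial>lborel) = ennreal I" "I \<ge> 0" using w'(2) by (auto simp: less_top_ennreal)
  have pt: "cmod (wt_quot S e a n F (Complex x y)) powr t \<le> D powr t * (cmod (F (Complex x y)) powr p + D2 * w x)"
    if y: "0 < y" "y \<le> 1" and x: "x \<notin> S" "x \<in> {-R..R}" for x y
  proof -
    define z where "z = Complex x y"
    have z: "0 < Im z" "Im z \<le> R'" "\<bar>Re z\<bar> \<le> R'" using y x by (auto simp: z_def R'_def)
    define W where "W = (\<Prod>c\<in>S. rho c z powr (- e c))"
    have W: "W \<ge> 0" by (auto simp: W_def intro!: prod_nonneg)
    have Wq: "W powr q \<le> D2 * w x"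
    proof -
      have "W powr q = (\<Prod>c\<in>S. rho c z powr (- e c * q))"
        unfolding W_def by (subst prod_powr_distrib) (auto simp: powr_powr)
      also have "\<dots> \<le> C1 * (1 + (\<Sum>c\<in>S. rho c z powr (\<delta> * q)))" by (rule C1(2)[OF z(1)])
      also have "\<dots> = C1 * (((1 + (\<Sum>c\<in>S. rho c z powr (\<delta> * q))) * cmod (z + \<i>) powr (-2)) * cmod (z + \<i>) powr 2)"

      proof -
        have "cmod (z + \<i>) powr (-2) * cmod (z + \<i>) powr 2 = 1"
          unfolding powr_add[symmetric] using plus_i_nonzero[of z] z(1) by simp
        then show ?thesis by (simp only: mult.assoc mult_1_right)
      qed
      also have "\<dots> \<le> C1 * (w x * (2 * R' + 1) powr \<bar>2\<bar>)"
        using w'(3)[OF y(1) x(1)] norm_plus_i_le_box[OF z, of 2] C1 w'(1)[of x]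
        by (intro mult_left_mono mult_mono) (auto simp: z_def)
      finally show ?thesis by (simp add: D2_def mult_ac)
    qed
    have "cmod (wt_quot S e a n F z) \<le> (cmod (F z) * W) * D"
      unfolding norm_wt_quot[OF z(1)] W_def[symmetric] D_def using W
      by (intro mult_left_mono norm_plus_i_le_box z) auto
    then have "cmod (wt_quot S e a n F z) powr t \<le> ((cmod (F z) * W) * D) powr t" using t by (intro powr_mono2) auto
    also have "\<dots> = D powr t * (cmod (F z) * W) powr t" using D W by (simp add: powr_mult)
    also have "\<dots> \<le> D powr t * (cmod (F z) powr p + W powr q)"
      using W p q t tpq by (intro mult_left_mono powr_mult_le_add) auto
    also have "\<dots> \<le> D powr t * (cmod (F z) powr p + D2 * w x)" using Wq by (intro mult_left_mono add_left_mono) auto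
    finally show ?thesis by (simp add: z_def)
  qed
  have hF: "F holomorphic_on {z. Im z > 0}" using F by (simp add: Hardy_bound_def)
  show "t > 1" by (rule t)
  show "\<exists>K\<ge>0. \<forall>y. 0 < y \<and> y \<le> 1 \<longrightarrow>
    (\<integral>\<^sup>+x. ennreal (cmod (wt_quot S e a n F (Complex x y)) powr t) * indicator {-R..R} x \<partial>lborel) \<le> ennreal K"
  proof (intro exI[of _ "D powr t * (C + D2 * I)"] conjI allI impI, goal_cases)
    case 1
    show ?case using C D I by simp
  next
    case (2 y)
    then have y: "0 < y" "y \<le> 1" by auto
    have [measurable]: "(\<lambda>x. F (Complex x y)) \<in> borel_measurable borel" by (rule horizontal_borel[OF hF y(1)])
    have "AE x in lborel. x \<notin> S" using S by (intro AE_not_in finite_imp_null_set_lborel)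
    then have "(\<integral>\<^sup>+x. ennreal (cmod (wt_quot S e a n F (Complex x y)) powr t) * indicator {-R..R} x \<partial>lborel)
      \<le> (\<integral>\<^sup>+x. ennreal (D powr t) * (ennreal (cmod (F (Complex x y)) powr p) + ennreal D2 * ennreal (w x)) \<partial>lborel)"
    proof (intro nn_integral_mono_AE, eventually_elim)
      case (elim x)
      show ?case
      proof (cases "x \<in> {-R..R}")
        case True
        then have "ennreal (cmod (wt_quot S e a n F (Complex x y)) powr t) \<le> ennreal (D powr t * (cmod (F (Complex x y)) powr p + D2 * w x))"
          using pt[OF y elim(2)] by (intro ennreal_leI) auto
        also have "\<dots> = ennreal (D powr t) * (ennreal (cmod (F (Complex x y)) powr p) + ennreal D2 * ennreal (w x))"
          using D w' by (simp add: ennreal_mult ennreal_plus)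
        finally show ?thesis using True by simp
      qed simp
    qed
    also have "\<dots> = ennreal (D powr t) * ((\<integral>\<^sup>+x. ennreal (cmod (F (Complex x y)) powr p) \<partial>lborel) + ennreal D2 * (\<integral>\<^sup>+x. ennreal (w x) \<partial>lborel))"
      by (simp add: nn_integral_cmult nn_integral_add)
    also have "\<dots> \<le> ennreal (D powr t) * (ennreal C + ennreal D2 * ennreal I)"
      using F y unfolding I by (intro mult_left_mono add_right_mono) (auto simp: Hardy_bound_def nn_integral_completion)
    also have "\<dots> = ennreal (D powr t * (C + D2 * I))"
      using D C I by (simp add: ennreal_mult ennreal_plus)
    finally show ?case .
  qed
qed

text \<open>Finitely many strict inequalities leave a uniform margin; inserting 0 secures the sign
  and covers the empty set.\<close>

lemma exponent_margin:
  fixes f :: "'a \<Rightarrow> real"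
  assumes "finite S" "0 < b" "\<And>c. c \<in> S \<Longrightarrow> f c < b"
  obtains \<delta> where "0 \<le> \<delta>" "\<delta> < b" "\<And>c. c \<in> S \<Longrightarrow> f c \<le> \<delta>"
proof
  show "0 \<le> Max (insert 0 (f ` S))" using assms by (intro Max_ge) auto
  show "Max (insert 0 (f ` S)) < b" using assms by (subst Max_less_iff) auto
  show "f c \<le> Max (insert 0 (f ` S))" if "c \<in> S" for c using assms that by (intro Max_ge) auto
qed

section \<open>From conjugate boundary values to a polynomial\<close>

lemma lebesgue_integral_interval_eq_integral:
  fixes h :: "real \<Rightarrow> complex"
  assumes "continuous_on {a..b} h"
  shows "integral\<^sup>L (restrict_space lborel {a..b}) h = integral {a..b} h"
proof -
  have "set_integrable lborel {a..b} h" using assms by (rule borel_integrable_atLeastAtMost')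
  then show ?thesis
    using set_borel_integral_eq_integral(2)[of "{a..b}" h]
    by (simp add: integral_restrict_space set_lebesgue_integral_def)
qed

text \<open>Turns agreement of the limits almost everywhere into the convergence that gluing asks
  for: \<open>integrals_merge\<close> on an interval, along the heights \<open>1 / Suc m\<close>,
  with the L^t bounds supplied by \<open>wt_quot_local_Lt_bound\<close>.\<close>

lemma wt_quot_integrals_merge:
  assumes S: "finite S" and p: "p > 1" and \<delta>: "0 \<le> \<delta>" "\<delta> < 1 - 1 / p" "\<And>c. c \<in> S \<Longrightarrow> - e c \<le> \<delta>"
    and F1: "Hardy_bound p C F1" and F2: "Hardy_bound p C F2" and C: "C \<ge> 0"
    and lim: "AE x in lborel. \<exists>l. vlim (wt_quot S e a n F1) x l
      \<and> vlim (wt_quot S e a n F2) x (cnj l)"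
    and ab: "a0 \<le> b0"
  shows "(\<lambda>m. integral {a0..b0} (\<lambda>x. wt_quot S e a n F1 (Complex x (1 / real (Suc m))))
          - cnj (integral {a0..b0} (\<lambda>x. wt_quot S e a n F2 (Complex x (1 / real (Suc m)))))) \<longlonglongrightarrow> 0"
proof -
  define U1 where "U1 = wt_quot S e a n F1"
  define U2 where "U2 = wt_quot S e a n F2"
  have hU: "U1 holomorphic_on C_plus" "U2 holomorphic_on C_plus"
    using F1 F2 S by (auto simp: U1_def U2_def Hardy_bound_def intro!: wt_quot_holomorphic)
  define y where "y = (\<lambda>m. 1 / real (Suc m))"
  have y: "0 < y m" "y m \<le> 1" for m by (auto simp: y_def)
  define M where "M = restrict_space lborel {a0..b0}"
  define R where "R = \<bar>a0\<bar> + \<bar>b0\<bar>"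
  have sub: "{a0..b0} \<subseteq> {-R..R}" by (auto simp: R_def)
  interpret finite_measure M
    by (rule finite_measureI) (use ab in \<open>simp add: M_def space_restrict_space emeasure_restrict_space\<close>)
  \<comment> \<open>A pointwise choice, possibly not measurable; \<open>integrals_merge\<close> is
    designed to accept it.\<close>
  define l where "l = (\<lambda>x. SOME l. vlim U1 x l \<and> vlim U2 x (cnj l))"
  have l: "AE x in lborel. vlim U1 x (l x) \<and> vlim U2 x (cnj (l x))"
    using lim unfolding U1_def U2_def l_def by eventually_elim (rule someI_ex)
  have ylim: "filterlim y (at_right 0) sequentially"
    unfolding y_def filterlim_at using LIMSEQ_Suc[OF lim_1_over_n] by (auto simp: inverse_eq_divide)
  define f g where "f = (\<lambda>m x. U1 (Complex x (y m)))" and "g = (\<lambda>m x. cnj (U2 (Complex x (y m))))"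
  have cf: "continuous_on T (\<lambda>x. U1 (Complex x (y m)))" "continuous_on T (\<lambda>x. U2 (Complex x (y m)))" for T m
    using continuous_on_horizontal hU y by auto
  have meas: "f m \<in> borel_measurable borel" "g m \<in> borel_measurable borel" for m
    unfolding f_def g_def by (intro borel_measurable_continuous_onI continuous_intros cf)+
  define t where "t = 1 / (1 / p + (\<delta> + (1 - 1 / p)) / 2)"
  have t: "t > 1" by (rule wt_quot_local_Lt_bound(1)[OF S p \<delta> F1 C t_def])
  obtain K where K: "K \<ge> 0"
    "\<And>y. 0 < y \<Longrightarrow> y \<le> 1 \<Longrightarrow> (\<integral>\<^sup>+x. ennreal (cmod (U1 (Complex x y)) powr t) * indicator {-R..R} x \<partial>lborel) \<le> ennreal K"
    using wt_quot_local_Lt_bound(2)[where e = e and n = n and a = a and R = R, OF S p \<delta> F1 C t_def] unfolding U1_def by blast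
  obtain K' where K': "K' \<ge> 0"
    "\<And>y. 0 < y \<Longrightarrow> y \<le> 1 \<Longrightarrow> (\<integral>\<^sup>+x. ennreal (cmod (U2 (Complex x y)) powr t) * indicator {-R..R} x \<partial>lborel) \<le> ennreal K'"
    using wt_quot_local_Lt_bound(2)[where e = e and n = n and a = a and R = R, OF S p \<delta> F2 C t_def] unfolding U2_def by blast
  have restr: "(\<integral>\<^sup>+x. ennreal (cmod (h x) powr t) \<partial>M) \<le> (\<integral>\<^sup>+x. ennreal (cmod (h x) powr t) * indicator {-R..R} x \<partial>lborel)" for h :: "real \<Rightarrow> complex"
    unfolding M_def using sub
    by (subst nn_integral_restrict_space) (auto intro!: nn_integral_mono simp: indicator_def)
  have "(\<lambda>m. integral\<^sup>L M (f m) - integral\<^sup>L M (g m)) \<longlonglongrightarrow> 0"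
  proof (rule integrals_merge(3)[where l = l and t = t and K = "max K K'"])
    show "f m \<in> borel_measurable M" "g m \<in> borel_measurable M" for m
      unfolding M_def by (rule measurable_restrict_space1; use meas in simp)+
    show "AE x in M. (\<lambda>m. f m x) \<longlonglongrightarrow> l x"
      unfolding M_def using l
      by (subst AE_restrict_space_iff) (auto simp: f_def elim!: eventually_mono intro!: filterlim_compose[OF _ ylim])
    show "AE x in M. (\<lambda>m. g m x) \<longlonglongrightarrow> l x"
    proof -
      have "AE x in lborel. (\<lambda>m. g m x) \<longlonglongrightarrow> l x"
        using l
      proof eventually_elim
        case (elim x)
        then have "(\<lambda>m. cnj (U2 (Complex x (y m)))) \<longlonglongrightarrow> cnj (cnj (l x))"
          by (intro tendsto_cnj filterlim_compose[OF _ ylim]) auto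
        then show ?case by (simp add: g_def)
      qed
      then show ?thesis unfolding M_def by (subst AE_restrict_space_iff) (auto elim!: eventually_mono)
    qed
    show "(\<integral>\<^sup>+x. ennreal (cmod (f m x) powr t) \<partial>M) \<le> ennreal (max K K')" for m
    proof -
      have "(\<integral>\<^sup>+x. ennreal (cmod (f m x) powr t) \<partial>M) \<le> ennreal K"
        using restr[of "f m"] K(2)[OF y] unfolding f_def by (rule order_trans)
      also have "\<dots> \<le> ennreal (max K K')" by (rule ennreal_leI) simp
      finally show ?thesis .
    qed
    show "(\<integral>\<^sup>+x. ennreal (cmod (g m x) powr t) \<partial>M) \<le> ennreal (max K K')" for m
    proof -
      have "(\<integral>\<^sup>+x. ennreal (cmod (g m x) powr t) \<partial>M) \<le> ennreal K'"
        using restr[of "g m"] K'(2)[OF y] unfolding g_def complex_mod_cnj by (rule order_trans)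
      also have "\<dots> \<le> ennreal (max K K')" by (rule ennreal_leI) simp
      finally show ?thesis .
    qed
  qed (use t K in auto)
  moreover have "integral\<^sup>L M (f m) = integral {a0..b0} (\<lambda>x. U1 (Complex x (y m)))" for m
    unfolding M_def f_def by (rule lebesgue_integral_interval_eq_integral[OF cf(1)])
  moreover have "integral\<^sup>L M (g m) = cnj (integral {a0..b0} (\<lambda>x. U2 (Complex x (y m))))" for m
    unfolding M_def g_def using lebesgue_integral_interval_eq_integral[OF cf(2)] by simp
  ultimately show ?thesis by (simp add: U1_def U2_def y_def)
qed

text \<open>The limits only have to be conjugate to each other. Strictness of the bounds on
  \<open>e\<close> gives a margin \<open>\<delta> < 1 - 1 / p\<close>, and
  \<open>\<delta> + 1 / p < 1\<close> is the blow-up exponent of both quotients.\<close>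

lemma wt_quot_pair_polynomial:
  assumes S: "finite S" and p: "p > 1" and e: "\<And>c. c \<in> S \<Longrightarrow> - (1 - 1 / p) < e c" and a: "- 1 / p < a"
    and F1: "Hardy_bound p C F1" and F2: "Hardy_bound p C F2" and C: "C \<ge> 0"
    and lim: "AE x in lborel. \<exists>l. vlim (wt_quot S e a n F1) x l
      \<and> vlim (wt_quot S e a n F2) x (cnj l)"
  obtains P where "\<And>j. int j \<ge> n \<Longrightarrow> coeff P j = 0" "\<And>z. Im z > 0 \<Longrightarrow> wt_quot S e a n F1 z = poly P z"
proof -
  have pp: "0 < 1 - 1 / p" "1 / p > 0" using p by auto
  then have pp': "1 / p < 1" by simp
  obtain \<delta> where \<delta>: "0 \<le> \<delta>" "\<delta> < 1 - 1 / p" "\<And>c. c \<in> S \<Longrightarrow> - e c \<le> \<delta>"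
  proof (rule exponent_margin[OF S pp(1), of "\<lambda>c. - e c"])
    show "- e c < 1 - 1 / p" if "c \<in> S" for c using e[OF that] by linarith
  qed blast
  define K where "K = 8 * (2 + C) / pi"
  have K: "K \<ge> 0" using C by (simp add: K_def)
  have K1: "cmod (F1 z) \<le> K * Im z powr (- (1 / p))" if "Im z > 0" for z
    using Hardy_pointwise[OF F1 p C that] by (simp add: K_def)
  have K2: "cmod (F2 z) \<le> K * Im z powr (- (1 / p))" if "Im z > 0" for z
    using Hardy_pointwise[OF F2 p C that] by (simp add: K_def)
  define U1 where "U1 = wt_quot S e a n F1"
  define U2 where "U2 = wt_quot S e a n F2"
  have hU: "U1 holomorphic_on C_plus" "U2 holomorphic_on C_plus"
    using F1 F2 S by (auto simp: U1_def U2_def Hardy_bound_def intro!: wt_quot_holomorphic)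
  have \<beta>: "0 \<le> \<delta> + 1 / p" "\<delta> + 1 / p < 1" using \<delta> pp by auto
  obtain E where E: "E holomorphic_on UNIV" "\<And>z. Im z > 0 \<Longrightarrow> E z = U1 z"
    "\<And>z. Im z > 0 \<Longrightarrow> E (cnj z) = cnj (U2 z)"
  proof (rule glue_across_reals[OF hU \<beta>])
    show "vert_dominated (\<delta> + 1 / p) U1"
      unfolding U1_def by (rule wt_quot_local_bound[OF S \<delta>(1,3) K K1])
    show "vert_dominated (\<delta> + 1 / p) U2"
      unfolding U2_def by (rule wt_quot_local_bound[OF S \<delta>(1,3) K K2])
    show "(\<lambda>n. integral {a..b} (\<lambda>x. U1 (Complex x (1 / real (Suc n))))
          - cnj (integral {a..b} (\<lambda>x. U2 (Complex x (1 / real (Suc n)))))) \<longlonglongrightarrow> 0" if "a \<le> b" for a b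
      unfolding U1_def U2_def by (rule wt_quot_integrals_merge[OF S p \<delta> F1 F2 C lim that])
  qed blast
  \<comment> \<open>\<open>n - a\<close> comes from the powers of \<open>z + \<i>\<close>, and
    \<open>1 - 1 / p\<close> from the pointwise Hardy bound multiplied by \<open>Im z\<close>.
    Coefficients vanish above \<open>M - 1 = n - a - 1 / p\<close>, which is less than
    \<open>n\<close> since \<open>- 1 / p < a\<close>. For \<open>n \<le> 0\<close> this removes all
    of them.\<close>
  define M where "M = of_int n - a + 1 - 1 / p"
  obtain R1 C1 where C1: "\<And>z. Im z > 0 \<Longrightarrow> cmod z \<ge> R1 \<Longrightarrow> Im z * cmod (U1 z) \<le> C1 * cmod z powr M" "C1 \<ge> 0"
    using wt_quot_growth[where e = e and a = a and n = n, OF S \<delta>(1,3) less_imp_le[OF pp'] K K1] unfolding U1_def M_def by blast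
  obtain R2 C2 where C2: "\<And>z. Im z > 0 \<Longrightarrow> cmod z \<ge> R2 \<Longrightarrow> Im z * cmod (U2 z) \<le> C2 * cmod z powr M" "C2 \<ge> 0"
    using wt_quot_growth[where e = e and a = a and n = n, OF S \<delta>(1,3) less_imp_le[OF pp'] K K2] unfolding U2_def M_def by blast
  have growth: "\<bar>Im z\<bar> * cmod (E z) \<le> max C1 C2 * cmod z powr M" if z: "cmod z \<ge> max R1 R2" for z
  proof -
    have up: "C1 * cmod z powr M \<le> max C1 C2 * cmod z powr M" "C2 * cmod z powr M \<le> max C1 C2 * cmod z powr M"
      by (auto intro!: mult_right_mono)
    consider "Im z > 0" | "Im z = 0" | "Im z < 0" by linarith
    then show ?thesis
    proof cases
      case 1
      then show ?thesis using C1(1)[of z] E(2)[of z] z up(1) by simp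
    next
      case 2
      then show ?thesis using C1(2) by (simp add: le_max_iff_disj)
    next
      case 3
      then have "\<bar>Im z\<bar> * cmod (E z) = Im (cnj z) * cmod (U2 (cnj z))"
        using E(3)[of "cnj z"] by simp
      also have "\<dots> \<le> C2 * cmod z powr M" using C2(1)[of "cnj z"] 3 z by simp
      finally show ?thesis using up(2) by linarith
    qed
  qed
  have "(deriv ^^ k) E 0 = 0" if k: "k \<ge> nat n" for k
  proof (rule entire_taylor_coeff_eq_0[OF E(1) growth])
    show "real k > M - 1" using k a by (simp add: M_def)
  qed
  then obtain P where P: "\<And>j. j \<ge> nat n \<Longrightarrow> coeff P j = 0" "\<And>z. E z = poly P z"
    using entire_vanishing_coeffs_poly[OF E(1)] by metis
  show thesis
    by (rule that[of P]) (use P E(2) in \<open>auto simp: U1_def\<close>)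
qed

lemma wt_quot_eq_iff:
  assumes "finite S" "Im z > 0"
  shows "wt_quot S e a n F z = w \<longleftrightarrow> F z = wt S e a z * (w * (z + \<i>) powi (- n))"
proof -
  have "wt S e a z \<noteq> 0" "z + \<i> \<noteq> 0"
    using wt_nonzero[OF assms(1), of z e a] plus_i_nonzero[of z] upper_neq_of_real[of z] assms(2) by auto
  then show ?thesis by (auto simp: wt_quot_def power_int_minus field_simps)
qed

section \<open>Which weighted polynomials are Hardy functions\<close>

lemma norm_poly_le:
  fixes P :: "complex poly"
  shows "\<exists>K\<ge>0. \<forall>z. Im z > 0 \<longrightarrow> cmod (poly P z) \<le> K * cmod (z + \<i>) powr real (degree P)"
proof (intro exI[of _ "\<Sum>j\<le>degree P. cmod (coeff P j)"] conjI allI impI)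
  fix z assume z: "Im z > 0"
  have 1: "1 \<le> cmod (z + \<i>)" using norm_plus_i_ge z by auto
  have "cmod z ^ 2 \<le> cmod (z + \<i>) ^ 2"
    unfolding cmod_power2 using z by (simp add: power2_eq_square algebra_simps)
  then have 2: "cmod z \<le> cmod (z + \<i>)" by (rule power2_le_imp_le) simp
  have "cmod (poly P z) \<le> (\<Sum>j\<le>degree P. cmod (coeff P j) * cmod z ^ j)"
    unfolding poly_altdef by (rule order_trans[OF norm_sum]) (simp add: norm_mult norm_power)
  also have "\<dots> \<le> (\<Sum>j\<le>degree P. cmod (coeff P j) * cmod (z + \<i>) ^ degree P)"
  proof (intro sum_mono mult_left_mono)
    fix j assume "j \<in> {..degree P}"
    have "cmod z ^ j \<le> cmod (z + \<i>) ^ j" using 2 by (intro power_mono) auto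
    also have "\<dots> \<le> cmod (z + \<i>) ^ degree P" using 1 \<open>j \<in> _\<close> by (intro power_increasing) auto
    finally show "cmod z ^ j \<le> cmod (z + \<i>) ^ degree P" .
  qed auto
  also have "cmod (z + \<i>) ^ degree P = cmod (z + \<i>) powr real (degree P)" using 1 by (subst powr_realpow) auto
  finally show "cmod (poly P z) \<le> (\<Sum>j\<le>degree P. cmod (coeff P j)) * cmod (z + \<i>) powr real (degree P)"
    by (simp add: sum_distrib_right)
qed (auto intro: sum_nonneg)

lemma poly_vanishing_factor:
  fixes P :: "complex poly"
  assumes "finite T" "\<And>d. d \<in> T \<Longrightarrow> poly P (of_real d) = 0"
  shows "\<exists>Q. P = (\<Prod>d\<in>T. [:- of_real d, 1:]) * Q"
  using assms
proof (induction T rule: finite_induct)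
  case (insert d T)
  then obtain Q where Q: "P = (\<Prod>d\<in>T. [:- of_real d, 1:]) * Q" by auto
  have "poly P (of_real d) = (\<Prod>x\<in>T. of_real d - of_real x) * poly Q (of_real d)"
    by (simp add: Q poly_prod)
  moreover have "(\<Prod>x\<in>T. complex_of_real d - of_real x) \<noteq> 0"
    using insert.hyps by (auto simp: prod_zero_iff)
  ultimately have "poly Q (of_real d) = 0" using insert.prems[of d] by simp
  then obtain Q' where "Q = [:- of_real d, 1:] * Q'" by (auto simp: poly_eq_0_iff_dvd elim: dvdE)
  then have "P = (\<Prod>d\<in>insert d T. [:- of_real d, 1:]) * Q'" using insert.hyps by (simp only: Q prod.insert[OF insert.hyps] mult.assoc mult.left_commute)
  then show ?case by blast
qed simp

lemma degree_prod_linear: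
  "finite T \<Longrightarrow> degree (\<Prod>d\<in>T. [:- complex_of_real d, 1:]) = card T"
  by (subst degree_prod_eq_sum_degree) auto

abbreviation wt_poly :: "real set \<Rightarrow> (real \<Rightarrow> real) \<Rightarrow> real \<Rightarrow> int \<Rightarrow> complex poly \<Rightarrow> complex \<Rightarrow> complex" where
  "wt_poly S e a n P z \<equiv> wt S e a z * (poly P z * (z + \<i>) powi (- n))"

lemma norm_wt_poly:
  assumes "Im z > 0"
  shows "cmod (wt_poly S e a n P z) =
    (\<Prod>c\<in>S. rho c z powr e c) * (cmod (z + \<i>) powr (a - of_int n) * cmod (poly P z))"
  using assms by (simp add: norm_mult norm_wt norm_powi_plus_i powr_diff powr_minus divide_inverse)

lemma wt_poly_holomorphic: "wt_poly S e a n P holomorphic_on C_plus"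
  using plus_i_nonzero by (intro holomorphic_intros wt_holomorphic) auto

lemma norm_wt_poly_powr:
  assumes "Im z > 0"
  shows "cmod (wt_poly S e a n P z) powr p =
    (\<Prod>c\<in>S. rho c z powr (e c * p)) * (cmod (z + \<i>) powr ((a - of_int n) * p) * cmod (poly P z) powr p)"
proof -
  have "(\<Prod>c\<in>S. rho c z powr e c) powr p = (\<Prod>c\<in>S. rho c z powr (e c * p))"
    by (subst prod_powr_distrib) (auto simp: powr_powr)
  then show ?thesis unfolding norm_wt_poly[OF assms] by (simp add: powr_mult powr_powr prod_nonneg)
qed

text \<open>A zero of \<open>P\<close> at a point with exponent \<open>1 / p\<close> contributes
  \<open>z - c\<close>, of modulus \<open>cmod (z + \<i>) / rho c z\<close>. It lowers the exponent
  at \<open>c\<close> by 1 and moves one power to infinity, where the degree of \<open>P\<close>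
  already counts it. Then every exponent times \<open>p\<close> is below 1, and
  \<open>rho_weight_majorant\<close> applies.\<close>

lemma wt_poly_Hardy:
  assumes S: "finite S" and p: "p > 1" and e: "\<And>c. c \<in> S \<Longrightarrow> e c \<le> 1 / p"
    and van: "\<And>c. c \<in> S \<Longrightarrow> e c = 1 / p \<Longrightarrow> poly P (of_real c) = 0"
    and deg: "P \<noteq> 0 \<Longrightarrow> a + real (degree P) - of_int n < - 1 / p"
  obtains C where "C \<ge> 0" "Hardy_bound p C (wt_poly S e a n P)"
proof (cases "P = 0")
  case True
  then show thesis using that[of 0] by (simp add: Hardy_bound_def)
next
  case False
  define T where "T = {c \<in> S. e c = 1 / p}"
  have T: "finite T" "T \<subseteq> S" using S by (auto simp: T_def)
  obtain Q where Q: "P = (\<Prod>d\<in>T. [:- of_real d, 1:]) * Q"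
    using poly_vanishing_factor[OF T(1), of P] van by (auto simp: T_def)
  have "Q \<noteq> 0" using False Q by auto
  have degP: "degree P = card T + degree Q"
    unfolding Q using False Q \<open>Q \<noteq> 0\<close> T(1) by (subst degree_mult_eq) (auto simp: degree_prod_linear prod_zero_iff)
  obtain K where K: "K \<ge> 0" "\<And>z. Im z > 0 \<Longrightarrow> cmod (poly Q z) \<le> K * cmod (z + \<i>) powr real (degree Q)"
    using norm_poly_le[of Q] by blast
  \<comment> \<open>The exponents left after the zeros on \<open>T\<close> have been spent.\<close>
  define e' where "e' = (\<lambda>c. e c - (if c \<in> T then 1 else 0))"
  have e': "e' c * p < 1" if "c \<in> S" for c
  proof -
    have "e' c < 1 / p" using e[OF that] that p by (auto simp: e'_def T_def)
    then show ?thesis using p by (simp add: field_simps)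
  qed
  obtain \<alpha> where \<alpha>: "0 \<le> \<alpha>" "\<alpha> < 1" "\<And>c. c \<in> S \<Longrightarrow> e' c * p \<le> \<alpha>"
    using exponent_margin[OF S, of 1 "\<lambda>c. e' c * p"] e' by auto
  obtain C1 where C1: "C1 \<ge> 0" "\<And>z. Im z > 0 \<Longrightarrow> (\<Prod>c\<in>S. rho c z powr (e' c * p)) \<le> C1 * (1 + (\<Sum>c\<in>S. rho c z powr \<alpha>))"
    using prod_rho_le[OF S \<alpha>(1), of "\<lambda>c. e' c * p"] \<alpha>(3) by blast
  \<comment> \<open>The total order of decay at infinity; \<open>deg\<close> says that its p-th
    power is integrable there.\<close>
  define \<gamma> where "\<gamma> = - (a + real (degree P) - of_int n)"
  have \<gamma>: "\<gamma> * p > 1" using deg[OF False] p by (simp add: \<gamma>_def field_simps)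
  obtain w where w [measurable]: "w \<in> borel_measurable borel" and w': "\<And>x. w x \<ge> 0" "(\<integral>\<^sup>+x. ennreal (w x) \<partial>lborel) < \<infinity>"
    "\<And>x y. y > 0 \<Longrightarrow> x \<notin> S \<Longrightarrow>
      (1 + (\<Sum>c\<in>S. rho c (Complex x y) powr \<alpha>)) * cmod (Complex x y + \<i>) powr (-(\<gamma> * p)) \<le> w x"
    using rho_weight_majorant[OF S \<alpha>(1,2) \<gamma>] by metis
  obtain I where I: "(\<integral>\<^sup>+x. ennreal (w x) \<partial>lborel) = ennreal I" "I \<ge> 0" using w'(2) by (auto simp: less_top_ennreal)
  define W where "W = wt_poly S e a n P"
  have W1: "cmod (W z) \<le> K * ((\<Prod>c\<in>S. rho c z powr e' c) * cmod (z + \<i>) powr (-\<gamma>))" if z: "Im z > 0" for z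
  proof -
    have n0: "cmod (z + \<i>) > 0" using plus_i_nonzero[of z] z by auto
    have "cmod (\<Prod>d\<in>T. z - of_real d) = (\<Prod>d\<in>T. cmod (z + \<i>) * rho d z powr (-1))"
      unfolding prod_norm[symmetric]
    proof (intro prod.cong refl)
      fix d assume "d \<in> T"
      have "z \<noteq> of_real d" using z by auto
      then show "cmod (z - of_real d) = cmod (z + \<i>) * rho d z powr (-1)"
        using n0 by (simp add: rho_def powr_minus)
    qed
    also have "\<dots> = cmod (z + \<i>) powr real (card T) * (\<Prod>d\<in>T. rho d z powr (-1))"
      unfolding prod.distrib prod_constant powr_realpow[OF n0] ..
    also have "(\<Prod>d\<in>T. rho d z powr (-1)) = (\<Prod>d\<in>S. rho d z powr (if d \<in> T then -1 else 0))"
    proof -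
      have "(\<Prod>d\<in>S. rho d z powr (if d \<in> T then -1 else 0)) = (\<Prod>d\<in>S. if d \<in> T then rho d z powr (-1) else 1)"
      proof (intro prod.cong refl)
        fix d
        have "rho d z > 0" using z by (intro rho_pos) auto
        then show "rho d z powr (if d \<in> T then -1 else 0) = (if d \<in> T then rho d z powr (-1) else 1)" by auto
      qed
      also have "\<dots> = (\<Prod>d\<in>S \<inter> T. rho d z powr (-1))" by (rule prod.inter_restrict[OF S, symmetric])
      also have "S \<inter> T = T" using T by auto
      finally show ?thesis by simp
    qed
    finally have D: "cmod (\<Prod>d\<in>T. z - of_real d) = cmod (z + \<i>) powr real (card T) * (\<Prod>d\<in>S. rho d z powr (if d \<in> T then -1 else 0))" .
    have "cmod (W z) = (\<Prod>c\<in>S. rho c z powr e c) * (cmod (z + \<i>) powr (a - of_int n) * cmod (poly P z))"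
      unfolding W_def by (rule norm_wt_poly[OF z])
    also have "cmod (poly P z) = cmod (\<Prod>d\<in>T. z - of_real d) * cmod (poly Q z)"
      by (simp add: Q poly_prod norm_mult)
    also have "(\<Prod>c\<in>S. rho c z powr e c) * (cmod (z + \<i>) powr (a - of_int n) * (cmod (\<Prod>d\<in>T. z - of_real d) * cmod (poly Q z)))
       = ((\<Prod>c\<in>S. rho c z powr e c) * (\<Prod>d\<in>S. rho d z powr (if d \<in> T then -1 else 0))) * (cmod (z + \<i>) powr (a - of_int n) * cmod (z + \<i>) powr real (card T)) * cmod (poly Q z)"
      by (simp add: D mult_ac)
    also have "(\<Prod>c\<in>S. rho c z powr e c) * (\<Prod>d\<in>S. rho d z powr (if d \<in> T then -1 else 0)) = (\<Prod>c\<in>S. rho c z powr e' c)"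
      unfolding prod.distrib[symmetric] powr_add[symmetric] by (intro prod.cong) (auto simp: e'_def)
    also have "cmod (z + \<i>) powr (a - of_int n) * cmod (z + \<i>) powr real (card T) = cmod (z + \<i>) powr (a - of_int n + real (card T))"
      by (simp add: powr_add)
    also have "(\<Prod>c\<in>S. rho c z powr e' c) * cmod (z + \<i>) powr (a - of_int n + real (card T)) * cmod (poly Q z)
      \<le> (\<Prod>c\<in>S. rho c z powr e' c) * cmod (z + \<i>) powr (a - of_int n + real (card T)) * (K * cmod (z + \<i>) powr real (degree Q))"
      using K(2)[OF z] by (intro mult_left_mono) (auto intro!: mult_nonneg_nonneg prod_nonneg)
    also have "\<dots> = K * ((\<Prod>c\<in>S. rho c z powr e' c) * (cmod (z + \<i>) powr (a - of_int n + real (card T)) * cmod (z + \<i>) powr real (degree Q)))"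
      by (simp add: mult_ac)
    also have "cmod (z + \<i>) powr (a - of_int n + real (card T)) * cmod (z + \<i>) powr real (degree Q) = cmod (z + \<i>) powr (-\<gamma>)"
      unfolding powr_add[symmetric] by (simp add: \<gamma>_def degP algebra_simps)
    finally show ?thesis .
  qed
  have W2: "cmod (W (Complex x y)) powr p \<le> (K powr p * C1) * w x" if y: "y > 0" and x: "x \<notin> S" for x y
  proof -
    define z where "z = Complex x y"
    have z: "Im z > 0" using y by (simp add: z_def)
    have "cmod (W z) powr p \<le> (K * ((\<Prod>c\<in>S. rho c z powr e' c) * cmod (z + \<i>) powr (-\<gamma>))) powr p"
      using W1[OF z] p by (intro powr_mono2) auto
    also have "\<dots> = K powr p * ((\<Prod>c\<in>S. rho c z powr e' c) powr p * cmod (z + \<i>) powr (-(\<gamma> * p)))"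
      using K by (simp add: powr_mult powr_powr prod_nonneg)
    also have "(\<Prod>c\<in>S. rho c z powr e' c) powr p = (\<Prod>c\<in>S. rho c z powr (e' c * p))"
      by (subst prod_powr_distrib) (auto simp: powr_powr)
    also have "K powr p * ((\<Prod>c\<in>S. rho c z powr (e' c * p)) * cmod (z + \<i>) powr (-(\<gamma> * p)))
      \<le> K powr p * ((C1 * (1 + (\<Sum>c\<in>S. rho c z powr \<alpha>))) * cmod (z + \<i>) powr (-(\<gamma> * p)))"
      using C1(2)[OF z] by (intro mult_left_mono mult_right_mono) auto
    also have "\<dots> = (K powr p * C1) * ((1 + (\<Sum>c\<in>S. rho c z powr \<alpha>)) * cmod (z + \<i>) powr (-(\<gamma> * p)))" by (simp add: mult_ac)
    also have "\<dots> \<le> (K powr p * C1) * w x"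
      using w'(3)[OF y x] C1 unfolding z_def by (intro mult_left_mono) auto
    finally show ?thesis by (simp add: z_def)
  qed
  have "Hardy_bound p (K powr p * C1 * I) W"
    unfolding Hardy_bound_def
  proof (intro conjI allI impI)
    show "W holomorphic_on C_plus" unfolding W_def by (rule wt_poly_holomorphic)
    fix y :: real assume y: "y > 0"
    have "AE x in lborel. x \<notin> S" using S by (intro AE_not_in finite_imp_null_set_lborel)
    then have ae: "AE x in lborel. ennreal (cmod (W (Complex x y)) powr p) \<le> ennreal (K powr p * C1) * ennreal (w x)"
    proof eventually_elim
      case (elim x)
      have "ennreal (cmod (W (Complex x y)) powr p) \<le> ennreal ((K powr p * C1) * w x)"
        by (rule ennreal_leI[OF W2[OF y elim]])
      then show ?case using C1 w' by (simp add: ennreal_mult)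
    qed
    have "Lp_mass p W y = (\<integral>\<^sup>+x. ennreal (cmod (W (Complex x y)) powr p) \<partial>lborel)"
    proof -
      have [measurable]: "(\<lambda>x. W (Complex x y)) \<in> borel_measurable borel"
        unfolding W_def by (rule horizontal_borel[OF wt_poly_holomorphic y])
      show ?thesis by (simp add: nn_integral_completion)
    qed
    also have "\<dots> \<le> (\<integral>\<^sup>+x. ennreal (K powr p * C1) * ennreal (w x) \<partial>lborel)"
      by (rule nn_integral_mono_AE[OF ae])
    also have "\<dots> = ennreal (K powr p * C1 * I)"
      using C1 I by (simp add: nn_integral_cmult ennreal_mult)
    finally show "Lp_mass p W y \<le> ennreal (K powr p * C1 * I)" .
  qed
  moreover have "K powr p * C1 * I \<ge> 0" using C1 I by simp
  ultimately show thesis using that unfolding W_def by blast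
qed

text \<open>Quantifies the divergence of the integral of \<open>1/x\<close> both at a point with exponent \<open>1/p\<close> and at infinity.\<close>

lemma log_le_of_reciprocal_lower_bound:
  fixes f :: "real \<Rightarrow> real"
  assumes int: "(\<integral>\<^sup>+x. ennreal (f x) \<partial>lebesgue) \<le> ennreal C" and C: "C \<ge> 0" and k: "k > 0"
    and AB: "s < A" "A \<le> B" and lower: "\<And>x. A \<le> x \<Longrightarrow> x \<le> B \<Longrightarrow> k / (x - s) \<le> f x"
  shows "k * (ln (B - s) - ln (A - s)) \<le> C"
proof -
  have "((\<lambda>x. k / (x - s)) has_integral (k * ln (B - s) - k * ln (A - s))) {A..B}"
  proof (rule fundamental_theorem_of_calculus[OF AB(2)])
    fix x assume "x \<in> {A..B}"
    then have "((\<lambda>x. k * ln (x - s)) has_real_derivative k / (x - s)) (at x)"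
      using AB by (auto intro!: derivative_eq_intros)
    then show "((\<lambda>x. k * ln (x - s)) has_vector_derivative k / (x - s)) (at x within {A..B})"
      by (simp add: has_real_derivative_iff_has_vector_derivative has_vector_derivative_at_within)
  qed
  moreover have "(\<lambda>x. if x \<in> {A..B} then k / (x - s) else 0) = (\<lambda>x. k / (x - s) * indicator {A..B} x)"
    by (auto simp: fun_eq_iff)
  ultimately have hi: "((\<lambda>x. k / (x - s) * indicator {A..B} x) has_integral (k * ln (B - s) - k * ln (A - s))) UNIV"
    by (subst (asm) has_integral_restrict_UNIV[symmetric]) simp
  have "ennreal (k * ln (B - s) - k * ln (A - s)) = (\<integral>\<^sup>+x. ennreal (k / (x - s) * indicator {A..B} x) \<partial>lborel)"
    using AB k by (intro nn_integral_has_integral_lborel[symmetric] hi) (auto simp: indicator_def)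
  also have "\<dots> = (\<integral>\<^sup>+x. ennreal (k / (x - s) * indicator {A..B} x) \<partial>lebesgue)"
    by (simp add: nn_integral_completion)
  also have "\<dots> \<le> (\<integral>\<^sup>+x. ennreal (f x) \<partial>lebesgue)"
    using lower by (intro nn_integral_mono) (auto simp: indicator_def intro!: ennreal_leI)
  also have "\<dots> \<le> ennreal C" by (rule int)
  finally show ?thesis using C by (simp add: ennreal_le_iff right_diff_distrib)
qed

text \<open>With exponent \<open>1 / p\<close> the p-th power of the modulus is
  \<open>g z / cmod (z - of_real d)\<close>. If \<open>P\<close> did not vanish at \<open>d\<close>,
  then \<open>g\<close> would be continuous and positive there, and the masses on lines close to the
  real axis would grow like the logarithm of the reciprocal height, against the uniform
  bound.\<close>

lemma wt_poly_Hardy_vanishes: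
  assumes S: "finite S" and p: "p > 1" and d: "d \<in> S" "e d = 1 / p" and C: "C \<ge> 0"
    and H: "Hardy_bound p C (wt_poly S e a n P)"
  shows "poly P (of_real d) = 0"
proof (rule ccontr)
  assume nz: "poly P (of_real d) \<noteq> 0"
  define W where "W = wt_poly S e a n P"
  define g where "g = (\<lambda>z. (\<Prod>c\<in>S - {d}. rho c z powr (e c * p)) * (cmod (z + \<i>) powr ((a - of_int n) * p + 1) * cmod (poly P z) powr p))"
  have Wg: "cmod (W z) powr p = g z / cmod (z - of_real d)" if z: "Im z > 0" for z
  proof -
    have n0: "cmod (z + \<i>) > 0" using plus_i_nonzero[of z] z by auto
    have "cmod (W z) powr p = (\<Prod>c\<in>S. rho c z powr (e c * p)) * (cmod (z + \<i>) powr ((a - of_int n) * p) * cmod (poly P z) powr p)"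
      unfolding W_def by (rule norm_wt_poly_powr[OF z])
    also have "(\<Prod>c\<in>S. rho c z powr (e c * p)) = rho d z powr (e d * p) * (\<Prod>c\<in>S - {d}. rho c z powr (e c * p))"
      using S d by (simp add: prod.remove)
    also have "rho d z powr (e d * p) = cmod (z + \<i>) / cmod (z - of_real d)"
      using d p by (simp add: rho_def)
    finally show ?thesis using n0 by (simp add: g_def powr_add)
  qed
  have cont: "isCont g (of_real d)"
  proof -
    have "isCont (rho c) (of_real d) \<and> rho c (of_real d) \<noteq> 0" if "c \<in> S - {d}" for c
    proof -
      have "rho c (of_real d) > 0" using that by (intro rho_pos) auto
      moreover have "isCont (\<lambda>z. cmod (z + \<i>) / cmod (z - of_real c)) (of_real d)"
        using that by (intro continuous_intros) auto
      ultimately show ?thesis unfolding rho_def[abs_def] by auto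
    qed
    then show ?thesis
      unfolding g_def using plus_i_nonzero[of "of_real d"] nz p
      by (intro continuous_intros) auto
  qed
  have g0: "g (of_real d) > 0"
  proof -
    have "rho c (of_real d) \<noteq> 0" if "c \<in> S - {d}" for c
      using that rho_pos[of "of_real d" c] by auto
    then show ?thesis unfolding g_def using plus_i_nonzero[of "of_real d"] nz
      by (intro mult_pos_pos prod_pos) auto
  qed
  define k where "k = g (of_real d) / 2"
  have k: "k > 0" using g0 by (simp add: k_def)
  have "eventually (\<lambda>z. g z > k) (nhds (of_real d))"
    using cont g0 unfolding isCont_def by (intro order_tendstoD(1)[of _ "g (of_real d)"]) (auto simp: k_def tendsto_at_iff_tendsto_nhds)
  then obtain \<eta> where \<eta>: "\<eta> > 0" "\<And>z. dist z (of_real d) < \<eta> \<Longrightarrow> g z > k"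
    unfolding eventually_nhds_metric by blast
  have key: "k / 2 * (ln (\<eta> / 4) - ln y) \<le> C" if y: "0 < y" "y < \<eta> / 4" for y
  proof -
    \<comment> \<open>Starting at distance \<open>y\<close> from \<open>d\<close> ensures
      \<open>cmod (z - of_real d) \<le> 2 * (x - d)\<close>, whence the factor 1/2; stopping at
      \<open>\<eta> / 4\<close> keeps \<open>z\<close> in the ball where \<open>g\<close> exceeds
      \<open>k\<close>.\<close>
    have "k / 2 * (ln ((d + \<eta> / 4) - d) - ln ((d + y) - d)) \<le> C"
    proof (rule log_le_of_reciprocal_lower_bound[where f = "\<lambda>x. cmod (W (Complex x y)) powr p"])
      show "Lp_mass p W y \<le> ennreal C"
        using H y unfolding Hardy_bound_def W_def by blast
      fix x assume x: "d + y \<le> x" "x \<le> d + \<eta> / 4"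
      define z where "z = Complex x y"
      have zd: "cmod (z - of_real d) \<le> 2 * (x - d)"
        using cmod_le[of "z - of_real d"] x y by (simp add: z_def)
      have z0: "cmod (z - of_real d) > 0" using y by (auto simp: z_def complex_eq_iff)
      have gz: "k < g z" using \<eta>(2)[of z] zd x \<eta>(1) by (simp add: dist_norm)
      have "k / 2 / (x - d) = k / (2 * (x - d))" by simp
      also have "\<dots> \<le> g z / cmod (z - of_real d)"
        using zd z0 gz k by (intro frac_le) auto
      also have "\<dots> = cmod (W z) powr p" using y by (subst Wg) (auto simp: z_def)
      finally show "k / 2 / (x - d) \<le> cmod (W (Complex x y)) powr p" by (simp add: z_def)
    qed (use C k y in auto)
    then show ?thesis by simp
  qed
  \<comment> \<open>Chosen so that the left side of \<open>key\<close> becomes exactly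
    \<open>C + 1\<close>.\<close>
  define y where "y = exp (ln (\<eta> / 4) - 2 * (C + 1) / k)"
  have "ln y < ln (\<eta> / 4)" using C k by (simp add: y_def)
  moreover have y0: "y > 0" by (simp add: y_def)
  ultimately have "y < \<eta> / 4" using \<eta>(1) by (subst (asm) ln_less_cancel_iff) auto
  with y0 have "k / 2 * (ln (\<eta> / 4) - ln y) \<le> C" by (rule key)
  then show False using k by (simp add: y_def)
qed

text \<open>By \<open>deg\<close> only the coefficient of index \<open>n - 1\<close> is in question.
  If it is nonzero and \<open>a = 1 - 1 / p\<close>, the p-th power of the modulus behaves like a
  positive constant over \<open>cmod (z + \<i>)\<close> at infinity, which is not integrable. The
  single line \<open>Im z = 1\<close> already shows this.\<close>

lemma wt_poly_Hardy_degree: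
  assumes S: "finite S" and p: "p > 1" and a: "a = 1 - 1 / p" and C: "C \<ge> 0"
    and H: "Hardy_bound p C (wt_poly S e a n P)"
    and deg: "\<And>j. int j \<ge> n \<Longrightarrow> coeff P j = 0" and j: "int j \<ge> n - 1"
  shows "coeff P j = 0"
proof (rule ccontr)
  assume cj: "coeff P j \<noteq> 0"
  then have jn: "int j = n - 1" using deg[of j] j by force
  define W where "W = wt_poly S e a n P"
  define g where "g = (\<lambda>x. (\<Prod>c\<in>S. rho c (Complex x 1) powr (e c * p)) * (cmod (poly P (Complex x 1)) / cmod (Complex x 1 + \<i>) ^ j) powr p)"
  have Wg: "cmod (W (Complex x 1)) powr p = g x / cmod (Complex x 1 + \<i>)" for x
  proof -
    define z where "z = Complex x 1"
    have z: "Im z > 0" by (simp add: z_def)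
    have n0: "cmod (z + \<i>) > 0" using plus_i_nonzero[of z] z by auto
    have "cmod (W z) powr p = (\<Prod>c\<in>S. rho c z powr (e c * p)) * (cmod (z + \<i>) powr ((a - of_int n) * p) * cmod (poly P z) powr p)"
      unfolding W_def by (rule norm_wt_poly_powr[OF z])
    also have "(a - of_int n) * p = - 1 - real j * p"
    proof -
      have "real_of_int n = real j + 1" using jn by linarith
      then show ?thesis using p by (simp add: a field_simps)
    qed
    also have "cmod (z + \<i>) powr (- 1 - real j * p) = 1 / (cmod (z + \<i>) ^ j) powr p / cmod (z + \<i>)"
      using n0 by (simp add: powr_diff powr_minus powr_powr field_simps flip: powr_realpow)
    finally show ?thesis by (simp add: g_def z_def powr_divide)
  qed
  have big: "filterlim (\<lambda>x. Complex x 1 + w) at_infinity at_top" for w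
    unfolding filterlim_at_infinity_conv_norm_at_top
  proof (rule filterlim_at_top_mono)
    show "filterlim (\<lambda>x. Re w + x) at_top at_top"
      by (rule filterlim_tendsto_add_at_top[OF tendsto_const filterlim_ident])
    show "\<forall>\<^sub>F x in at_top. Re w + x \<le> cmod (Complex x 1 + w)"
    proof (intro always_eventually allI)
      fix x show "Re w + x \<le> cmod (Complex x 1 + w)" using abs_Re_le_cmod[of "Complex x 1 + w"] by simp
    qed
  qed
  have rho1: "((\<lambda>x. rho c (Complex x 1)) \<longlongrightarrow> 1) at_top" for c
  proof -
    have "((\<lambda>x. 1 + (of_real c + \<i>) / (Complex x 1 - of_real c)) \<longlongrightarrow> 1 + 0) at_top"
      by (intro tendsto_add tendsto_const tendsto_divide_0[OF tendsto_const] big[of "- of_real c", simplified])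
    then have "((\<lambda>x. cmod (1 + (of_real c + \<i>) / (Complex x 1 - of_real c))) \<longlongrightarrow> cmod 1) at_top"
      by (intro tendsto_norm) simp
    moreover have "cmod (1 + (of_real c + \<i>) / (Complex x 1 - of_real c)) = rho c (Complex x 1)" for x
    proof -
      have "Complex x 1 - of_real c \<noteq> 0" by (simp add: complex_eq_iff)
      then have "1 + (of_real c + \<i>) / (Complex x 1 - of_real c) = (Complex x 1 + \<i>) / (Complex x 1 - of_real c)"
        by (simp add: field_simps)
      then show ?thesis by (simp add: rho_def norm_divide)
    qed
    ultimately show ?thesis by simp
  qed
  \<comment> \<open>\<open>P\<close> expanded about \<open>-\<i>\<close>, so that dividing by
    \<open>(z + \<i>) ^ j\<close> isolates the leading coefficient.\<close>
  define q where "q = pcompose P [:-\<i>, 1:]"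
  have degP: "degree P = j"
    using cj deg jn by (intro antisym degree_le le_degree) auto
  have "degree q = j" by (simp add: q_def degP degree_pcompose)
  have "q \<noteq> 0" unfolding q_def using cj by (auto simp: pcompose_eq_0_iff)
  have poly1: "((\<lambda>x. cmod (poly P (Complex x 1)) / cmod (Complex x 1 + \<i>) ^ j) \<longlongrightarrow> cmod (lead_coeff q)) at_top"
  proof -
    have "((\<lambda>x. poly q (Complex x 1 + \<i>) / (Complex x 1 + \<i>) ^ degree q) \<longlongrightarrow> lead_coeff q) at_top"
      by (rule filterlim_compose[OF poly_divide_tendsto_aux big])
    moreover have "poly q (z + \<i>) = poly P z" for z by (simp add: q_def poly_pcompose)
    ultimately have "((\<lambda>x. cmod (poly P (Complex x 1) / (Complex x 1 + \<i>) ^ j)) \<longlongrightarrow> cmod (lead_coeff q)) at_top"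
      unfolding \<open>degree q = j\<close> by (intro tendsto_norm) (simp add: \<open>degree q = j\<close>)
    then show ?thesis by (simp add: norm_divide norm_power)
  qed
  define L where "L = cmod (lead_coeff q) powr p"
  have L: "L > 0" using \<open>q \<noteq> 0\<close> by (simp add: L_def)
  have "(g \<longlongrightarrow> (\<Prod>c\<in>S. 1 powr (e c * p)) * L) at_top"
    unfolding g_def L_def using \<open>q \<noteq> 0\<close>
    by (intro tendsto_mult tendsto_prod tendsto_powr rho1 poly1 tendsto_const) auto
  then have "(g \<longlongrightarrow> L) at_top" by simp
  then have "eventually (\<lambda>x. g x > L / 2) at_top" using L by (intro order_tendstoD(1)) auto
  then obtain X where X: "\<And>x. x \<ge> X \<Longrightarrow> g x > L / 2" by (auto simp: eventually_at_top_linorder)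
  define A where "A = max X 0"
  \<comment> \<open>The shift -2 reflects that \<open>Complex x 1 + \<i>\<close> has imaginary part
    2, so its modulus is at most \<open>x + 2\<close> for \<open>x \<ge> 0\<close>.\<close>
  have key: "L / 2 * (ln (B - (-2)) - ln (A - (-2))) \<le> C" if B: "A \<le> B" for B
  proof (rule log_le_of_reciprocal_lower_bound[where f = "\<lambda>x. cmod (W (Complex x 1)) powr p"])
    show "(\<integral>\<^sup>+x. ennreal (cmod (W (Complex x 1)) powr p) \<partial>lebesgue) \<le> ennreal C"
      using H[unfolded Hardy_bound_def, THEN conjunct2, rule_format, of 1] unfolding W_def by simp
    fix x assume x: "A \<le> x" "x \<le> B"
    have "cmod (Complex x 1 + \<i>) \<le> x + 2" using cmod_le[of "Complex x 1 + \<i>"] x by (simp add: A_def)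
    moreover have "cmod (Complex x 1 + \<i>) > 0" by (auto simp: complex_eq_iff)
    moreover have "L / 2 < g x" using X x by (simp add: A_def)
    ultimately have "L / 2 / (x + 2) \<le> g x / cmod (Complex x 1 + \<i>)" using L by (intro frac_le) auto
    then show "L / 2 / (x - (-2)) \<le> cmod (W (Complex x 1)) powr p" by (simp add: Wg)
  qed (use C L B in \<open>auto simp: A_def\<close>)
  \<comment> \<open>Chosen so that the left side of \<open>key\<close> becomes
    \<open>C + 1\<close>.\<close>
  define B where "B = exp (ln (A + 2) + 2 * (C + 1) / L) - 2"
  have "ln (A + 2) \<le> ln (A + 2) + 2 * (C + 1) / L" using C L by simp
  then have "exp (ln (A + 2)) \<le> B + 2" unfolding B_def by simp
  moreover have "A \<ge> 0" by (simp add: A_def)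
  ultimately have "A \<le> B" by simp
  from key[OF this] show False using L by (simp add: B_def)
qed

subsection \<open>Factorization of the symbol on the real line\<close>

text \<open>The argument, written with \<open>arctan\<close>, lies strictly between 0 and pi, so
  this is the principal logarithm; questions about branches thereby become inequalities between real
  numbers.\<close>

abbreviation log_plus_i :: "real \<Rightarrow> complex" where
  "log_plus_i x \<equiv> Complex (ln (sqrt (1 + x\<^sup>2))) (pi / 2 - arctan x)"

lemma plus_i_polar: "of_real x + \<i> = exp (log_plus_i x)"
proof -
  have s: "sqrt (1 + x\<^sup>2) > 0" by (simp add: add_pos_nonneg)
  have "exp (log_plus_i x) =
      of_real (sqrt (1 + x\<^sup>2)) * Complex (cos (pi / 2 - arctan x)) (sin (pi / 2 - arctan x))"
    using s by (simp add: exp_eq_polar cis.ctr)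
  also have "cos (pi / 2 - arctan x) = x / sqrt (1 + x\<^sup>2)" by (simp add: cos_diff sin_arctan)
  also have "sin (pi / 2 - arctan x) = 1 / sqrt (1 + x\<^sup>2)" by (simp add: sin_diff cos_arctan)
  also have "of_real (sqrt (1 + x\<^sup>2)) * Complex (x / sqrt (1 + x\<^sup>2)) (1 / sqrt (1 + x\<^sup>2)) = of_real x + \<i>"
    using s by (simp add: complex_eq_iff)
  finally show ?thesis by simp
qed

lemma r_polar: "r x = exp (\<i> * of_real (2 * arctan x - pi))"
proof -
  have "of_real x - \<i> = cnj (of_real x + \<i>)" by simp
  also have "\<dots> = exp (cnj (log_plus_i x))" unfolding plus_i_polar exp_cnj ..
  finally have "r x = exp (cnj (log_plus_i x) - log_plus_i x)"
    unfolding r_def exp_diff plus_i_polar[symmetric] by simp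
  also have "cnj (log_plus_i x) - log_plus_i x = \<i> * of_real (2 * arctan x - pi)"
    by (simp add: complex_eq_iff)
  finally show ?thesis .
qed

lemma Ln_plus_i: "Ln (of_real x + \<i>) = log_plus_i x"
  unfolding plus_i_polar using arctan_bounded[of x] by (intro Ln_exp) auto

text \<open>Only the argument matters for the factorization. It jumps by pi as \<open>x\<close>
  passes \<open>c\<close>, and -2 times it gives exactly the values in \<open>log_cut_r\<close>,
  including their jump by 2 pi.\<close>

lemma Ln_plus_i_over_minus:
  assumes "x \<noteq> c"
  shows "Im (Ln ((of_real x + \<i>) / (of_real x - of_real c))) = (if x > c then pi / 2 else - pi / 2) - arctan x"
proof -
  define A where "A = (if x > c then pi / 2 else - pi / 2) - arctan x"
  define B where "B = Complex (ln (sqrt (1 + x\<^sup>2)) - ln \<bar>x - c\<bar>) A"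
  have "exp (Complex (ln \<bar>x - c\<bar>) (if x > c then 0 else pi)) = of_real (x - c)"
    using assms by (auto simp: exp_eq_polar complex_eq_iff)
  then have "(of_real x + \<i>) / (of_real x - of_real c) =
     exp (log_plus_i x) / exp (Complex (ln \<bar>x - c\<bar>) (if x > c then 0 else pi))"
    unfolding plus_i_polar by simp
  also have "\<dots> = exp (log_plus_i x - Complex (ln \<bar>x - c\<bar>) (if x > c then 0 else pi))"
    by (rule exp_diff[symmetric])
  also have "log_plus_i x - Complex (ln \<bar>x - c\<bar>) (if x > c then 0 else pi) = B"
    by (auto simp: B_def A_def complex_eq_iff)
  finally have "Ln ((of_real x + \<i>) / (of_real x - of_real c)) = Ln (exp B)" by simp
  also have "\<dots> = B" using arctan_bounded[of x] by (intro Ln_exp) (auto simp: B_def A_def)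
  finally show ?thesis by (simp add: B_def A_def)
qed

lemma Ln_unit: "-pi < t \<Longrightarrow> t \<le> pi \<Longrightarrow> Ln (exp (\<i> * of_real t)) = \<i> * of_real t"
  by (intro Ln_exp) auto

text \<open>The argument in \<open>r_polar\<close> can leave the principal range. The sign change
  brings it to \<open>2 * arctan x\<close>, which lies inside; this matches the minus sign in
  \<open>log_cut\<close>.\<close>

lemma neg_r_polar: "- r x = exp (\<i> * of_real (2 * arctan x))"
proof -
  have "exp (\<i> * of_real (2 * arctan x)) = exp (\<i> * of_real (2 * arctan x - pi)) * exp (\<i> * of_real pi)"
    unfolding exp_add[symmetric] by (simp add: algebra_simps)
  then show ?thesis by (simp add: r_polar)
qed

text \<open>The normalizing term of \<open>log_cut\<close> cancels \<open>arctan c\<close>, so the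
  position of the cut survives only as the place of a jump by 2 pi.\<close>

lemma log_cut_r:
  assumes "x \<noteq> c"
  shows "log_cut (r c) (r x) = \<i> * of_real (2 * arctan x - (if x > c then pi else - pi))"
proof -
  have "- (r x / r c) = exp (\<i> * of_real (2 * arctan x)) / exp (\<i> * of_real (2 * arctan c - pi))"
    unfolding neg_r_polar[symmetric] r_polar[of c, symmetric] by simp
  also have "\<dots> = exp (\<i> * of_real (2 * arctan x) - \<i> * of_real (2 * arctan c - pi))"
    by (rule exp_diff[symmetric])
  \<comment> \<open>The representative modulo 2 pi depends on the side of \<open>c\<close>: it is
    the one with argument in the principal range.\<close>
  also have "\<dots> = exp (\<i> * of_real (2 * (arctan x - arctan c) - (if x > c then pi else - pi)))"
    by (subst exp_eq) (auto simp: algebra_simps intro: exI[of _ 0] exI[of _ 1])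
  finally have 1: "Ln (- (r x / r c)) = \<i> * of_real (2 * (arctan x - arctan c) - (if x > c then pi else - pi))"
    using assms arctan_bounded[of x] arctan_bounded[of c] arctan_less_iff[of x c] arctan_less_iff[of c x]
    by (simp only:, intro Ln_unit) auto
  have "- (1 / r c) = exp (\<i> * of_real (- 2 * arctan c))"
  proof -
    have "- (1 / r c) = 1 / (- r c)" by simp
    also have "\<dots> = exp (\<i> * of_real (- 2 * arctan c))"
      unfolding neg_r_polar by (simp add: exp_minus inverse_eq_divide)
    finally show ?thesis .
  qed
  then have 2: "Ln (- (1 / r c)) = \<i> * of_real (- 2 * arctan c)"
    using arctan_bounded[of c] by (simp only:, intro Ln_unit) auto
  show ?thesis unfolding log_cut_def 1 2 by (simp add: algebra_simps)
qed

lemma log_cut_r_inf: "log_cut 1 (r x) = \<i> * of_real (2 * arctan x - pi)"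
proof -
  have "Ln (- r x) = \<i> * of_real (2 * arctan x)"
    unfolding neg_r_polar using arctan_bounded[of x] by (intro Ln_unit) auto
  then show ?thesis by (simp add: log_cut_def algebra_simps)
qed

text \<open>A unimodular factor with argument -2 times that of the power turns it into its
  conjugate. This is why r_c^\<alpha> splits as conj(w)/w once its logarithm is recognized as -2
  \<i> times an argument.\<close>

lemma exp_Im_mult:
  assumes "L = Ln w" "w \<noteq> 0"
  shows "exp (of_real \<alpha> * (\<i> * of_real (- 2 * Im L))) * w powr of_real \<alpha> = cnj (w powr of_real \<alpha>)"
proof -
  have "exp (of_real \<alpha> * (\<i> * of_real (- 2 * Im L))) * exp (of_real \<alpha> * L) = exp (cnj (of_real \<alpha> * L))"
    unfolding exp_add[symmetric] by (rule arg_cong[of _ _ exp]) (simp add: complex_eq_iff)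
  then show ?thesis using assms by (simp add: powr_def exp_cnj)
qed

lemma r_pow_mult_w_pow:
  assumes "x \<noteq> c"
  shows "r_pow c \<alpha> x * w_pow c \<alpha> x = cnj (w_pow c \<alpha> x)"
proof -
  define w where "w = (of_real x + \<i>) / (of_real x - complex_of_real c)"
  have "w \<noteq> 0" using assms plus_i_nonzero[of "of_real x"] by (simp add: w_def)
  have "2 * arctan x - (if x > c then pi else - pi) = - 2 * Im (Ln w)"
    unfolding w_def Ln_plus_i_over_minus[OF assms] by simp
  then have "r_pow c \<alpha> x = exp (of_real \<alpha> * (\<i> * of_real (- 2 * Im (Ln w))))"
    unfolding r_pow_def r_pow_at_def log_cut_r[OF assms] by simp
  then show ?thesis using exp_Im_mult[OF refl \<open>w \<noteq> 0\<close>] by (simp add: w_pow_def w_def)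
qed

lemma r_pow_inf_mult:
  "r_pow_inf a x * (of_real x + \<i>) powr of_real a = cnj ((of_real x + \<i>) powr of_real a)"
proof -
  have "r_pow_inf a x = exp (of_real a * (\<i> * of_real (- 2 * Im (Ln (of_real x + \<i>)))))"
    unfolding r_pow_inf_def r_pow_at_def log_cut_r_inf Ln_plus_i by (simp add: algebra_simps)
  then show ?thesis using exp_Im_mult[OF refl plus_i_nonzero[of "of_real x"]] by simp
qed

lemma wt_of_real: "wt S e a x = (\<Prod>c\<in>S. w_pow c (e c) x) * (of_real x + \<i>) powr of_real a"
  by (simp add: wt_def w_pow_def)

lemma symbol_mult_wt:
  assumes "x \<notin> S"
  shows "r_pow_inf a x * (\<Prod>c\<in>S. r_pow c (e c) x) * wt S e a x = cnj (wt S e a x)"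
proof -
  have "(\<Prod>c\<in>S. r_pow c (e c) x) * (\<Prod>c\<in>S. w_pow c (e c) x) = (\<Prod>c\<in>S. cnj (w_pow c (e c) x))"
    unfolding prod.distrib[symmetric] using assms by (intro prod.cong refl r_pow_mult_w_pow) auto
  then have "r_pow_inf a x * (\<Prod>c\<in>S. r_pow c (e c) x) * wt S e a x =
    (\<Prod>c\<in>S. cnj (w_pow c (e c) x)) * (r_pow_inf a x * (of_real x + \<i>) powr of_real a)"
    unfolding wt_of_real by (simp add: mult_ac)
  then show ?thesis unfolding wt_of_real r_pow_inf_mult by simp
qed

subsection \<open>Boundary values\<close>

lemma vertical_limit_iff:
  "(F \<longlongrightarrow> l) (at (of_real x) within {z \<in> C_plus. Re z = x}) \<longleftrightarrow> vlim F x l"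
proof
  assume F: "(F \<longlongrightarrow> l) (at (of_real x) within {z \<in> C_plus. Re z = x})"
  have "filterlim (Complex x) (at (of_real x) within {z \<in> C_plus. Re z = x}) (at_right 0)"
    unfolding filterlim_at
  proof
    show "\<forall>\<^sub>F y in at_right 0. Complex x y \<in> {z \<in> C_plus. Re z = x} \<and> Complex x y \<noteq> of_real x"
      using eventually_at_right_less[of 0] by eventually_elim (auto simp: complex_eq_iff)
    show "(Complex x \<longlongrightarrow> of_real x) (at_right 0)"
      unfolding complex_of_real_def by (intro tendsto_Complex tendsto_intros)
  qed
  from filterlim_compose[OF F this] show "vlim F x l" .
next
  assume F: "vlim F x l"
  let ?G = "at (complex_of_real x) within {z \<in> C_plus. Re z = x}"
  have ev: "\<forall>\<^sub>F z in ?G. Im z > 0 \<and> Re z = x" by (auto simp: eventually_at_filter)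
  have "filterlim Im (at_right 0) ?G"
    unfolding filterlim_at
  proof
    show "\<forall>\<^sub>F z in ?G. Im z \<in> {0<..} \<and> Im z \<noteq> 0" using ev by eventually_elim auto
    have "(Im \<longlongrightarrow> Im (of_real x)) ?G" by (intro tendsto_Im tendsto_ident_at)
    then show "(Im \<longlongrightarrow> 0) ?G" by simp
  qed
  from filterlim_compose[OF F this] have "((\<lambda>z. F (Complex x (Im z))) \<longlongrightarrow> l) ?G" .
  moreover have "\<forall>\<^sub>F z in ?G. F (Complex x (Im z)) = F z" using ev by eventually_elim (auto intro: arg_cong[of _ _ F] complex_eqI)
  ultimately show "(F \<longlongrightarrow> l) ?G" by (rule Lim_transform_eventually)
qed

lemma has_boundary_value_cnj:
  assumes "has_boundary_value U F f"
  shows "has_boundary_value (cnj -` U) (cnj \<circ> F \<circ> cnj) (\<lambda>x. cnj (f x))"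
  unfolding has_boundary_value_def
proof -
  have *: "((cnj \<circ> F \<circ> cnj) \<longlongrightarrow> cnj l) (at (of_real x) within {z \<in> cnj -` U. Re z = x})"
    if "(F \<longlongrightarrow> l) (at (of_real x) within {z \<in> U. Re z = x})" for x l
  proof -
    let ?G = "at (complex_of_real x) within {z \<in> cnj -` U. Re z = x}"
    have "filterlim cnj (at (of_real x) within {z \<in> U. Re z = x}) ?G"
      unfolding filterlim_at
    proof
      have "\<forall>\<^sub>F z in ?G. z \<in> {z \<in> cnj -` U. Re z = x} \<and> z \<noteq> of_real x" by (auto simp: eventually_at_filter)
      then show "\<forall>\<^sub>F z in ?G. cnj z \<in> {z \<in> U. Re z = x} \<and> cnj z \<noteq> of_real x"
        by eventually_elim (auto simp: complex_eq_iff)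
      have "(cnj \<longlongrightarrow> cnj (of_real x)) ?G" by (intro tendsto_cnj tendsto_ident_at)
      then show "(cnj \<longlongrightarrow> of_real x) ?G" by simp
    qed
    from tendsto_cnj[OF filterlim_compose[OF that this]] show ?thesis by (simp add: o_def)
  qed
  show "AE x in lebesgue. ((cnj \<circ> F \<circ> cnj) \<longlongrightarrow> cnj (f x)) (at (of_real x) within {z \<in> cnj -` U. Re z = x})"
    using assms unfolding has_boundary_value_def by eventually_elim (rule *)
qed

lemma Hardy_cnj:
  assumes "open U" "f \<in> Hardy U p"
  shows "(\<lambda>x. cnj (f x)) \<in> Hardy (cnj -` U) p"
proof -
  obtain F C where F: "F holomorphic_on U" "\<And>y. Complex 0 y \<in> U \<Longrightarrow>
        Lp_mass p F y \<le> ennreal C" "has_boundary_value U F f"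
    using assms(2) unfolding Hardy_def by blast
  have "cnj \<circ> F \<circ> cnj holomorphic_on (cnj -` U)"
  proof (rule holomorphic_on_compose_cnj_cnj)
    show "open (cnj -` U)" using assms(1) by (intro open_vimage continuous_intros)
    show "F holomorphic_on cnj ` cnj -` U" using F(1) by (rule holomorphic_on_subset) auto
  qed
  moreover have "(\<integral>\<^sup>+x. ennreal (cmod ((cnj \<circ> F \<circ> cnj) (Complex x y)) powr p) \<partial>lebesgue) \<le> ennreal C" if "Complex 0 y \<in> cnj -` U" for y
    using F(2)[of "-y"] that by (simp add: complex_cnj)
  ultimately show ?thesis using has_boundary_value_cnj[OF F(3)] unfolding Hardy_def by blast
qed

lemma Hardy_inf_cnj:
  assumes "open U" "f \<in> Hardy_inf U"
  shows "(\<lambda>x. cnj (f x)) \<in> Hardy_inf (cnj -` U)"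
proof -
  obtain F where F: "F holomorphic_on U" "bounded (F ` U)" "has_boundary_value U F f"
    using assms(2) unfolding Hardy_inf_def by blast
  have "cnj \<circ> F \<circ> cnj holomorphic_on (cnj -` U)"
  proof (rule holomorphic_on_compose_cnj_cnj)
    show "open (cnj -` U)" using assms(1) by (intro open_vimage continuous_intros)
    show "F holomorphic_on cnj ` cnj -` U" using F(1) by (rule holomorphic_on_subset) auto
  qed
  moreover have "bounded ((cnj \<circ> F \<circ> cnj) ` (cnj -` U))"
    using F(2) by (auto simp: bounded_iff)
  ultimately show ?thesis using has_boundary_value_cnj[OF F(3)] unfolding Hardy_inf_def by blast
qed

lemma vimage_cnj_halfplanes: "cnj -` C_plus = C_minus" "cnj -` C_minus = C_plus"
  by auto

text \<open>Reflection in the real line removes the lower half-plane from the rest of the argument: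
  membership of \<open>g * \<phi>\<close> in the minus space is tested on its conjugate.\<close>

lemma Hardy_minus_iff: "f \<in> Hardy C_minus p \<longleftrightarrow> (\<lambda>x. cnj (f x)) \<in> Hardy C_plus p"
proof
  assume "f \<in> Hardy C_minus p"
  from Hardy_cnj[OF open_halfspace_Im_lt this] show "(\<lambda>x. cnj (f x)) \<in> Hardy C_plus p"
    by (simp only: vimage_cnj_halfplanes)
next
  assume "(\<lambda>x. cnj (f x)) \<in> Hardy C_plus p"
  from Hardy_cnj[OF open_halfspace_Im_gt this] show "f \<in> Hardy C_minus p"
    by (simp only: vimage_cnj_halfplanes complex_cnj_cnj)
qed

lemma Hardy_plus_iff:
  "f \<in> Hardy C_plus p \<longleftrightarrow> (\<exists>F C. C \<ge> 0 \<and> Hardy_bound p C F \<and>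
     (AE x in lebesgue. vlim F x (f x)))"
proof
  assume "f \<in> Hardy C_plus p"
  then obtain F C where F: "F holomorphic_on C_plus" "\<And>y. Complex 0 y \<in> C_plus \<Longrightarrow>
        Lp_mass p F y \<le> ennreal C" "has_boundary_value C_plus F f"
    unfolding Hardy_def by blast
  have "Lp_mass p F y \<le> ennreal (max C 0)" if "y > 0" for y
    by (rule order_trans[OF F(2)]) (use that in \<open>auto intro: ennreal_leI\<close>)
  then have "Hardy_bound p (max C 0) F" using F(1) by (simp add: Hardy_bound_def)
  moreover have "AE x in lebesgue. vlim F x (f x)"
    using F(3) unfolding has_boundary_value_def vertical_limit_iff .
  ultimately show "\<exists>F C. C \<ge> 0 \<and> Hardy_bound p C F \<and>
     (AE x in lebesgue. vlim F x (f x))"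
    by (intro exI[of _ F] exI[of _ "max C 0"]) auto
next
  assume "\<exists>F C. C \<ge> 0 \<and> Hardy_bound p C F \<and>
     (AE x in lebesgue. vlim F x (f x))"
  then obtain F C where "Hardy_bound p C F" "AE x in lebesgue. vlim F x (f x)" by blast
  then show "f \<in> Hardy C_plus p"
    unfolding Hardy_def has_boundary_value_def vertical_limit_iff
    by (intro CollectI exI[of _ F]) (auto simp: Hardy_bound_def)
qed

lemma Hardy_inf_plusE:
  assumes "f \<in> Hardy_inf C_plus"
  obtains F B where "F holomorphic_on C_plus" "B \<ge> 0" "\<And>z. Im z > 0 \<Longrightarrow> cmod (F z) \<le> B"
    "AE x in lebesgue. vlim F x (f x)"
proof -
  obtain F where F: "F holomorphic_on C_plus" "bounded (F ` C_plus)" "has_boundary_value C_plus F f"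
    using assms unfolding Hardy_inf_def by blast
  obtain B where B: "B > 0" "\<And>z. Im z > 0 \<Longrightarrow> cmod (F z) \<le> B"
    using F(2) unfolding bounded_pos by auto
  show thesis
    by (rule that[OF F(1) less_imp_le[OF B(1)] B(2) F(3)[unfolded has_boundary_value_def vertical_limit_iff]])
qed

lemma Hardy_bound_mult:
  assumes F: "Hardy_bound p C F" and H: "H holomorphic_on C_plus" "B \<ge> 0" "\<And>z. Im z > 0 \<Longrightarrow> cmod (H z) \<le> B"
    and p: "p > 0"
  shows "Hardy_bound p (B powr p * C) (\<lambda>z. H z * F z)"
  unfolding Hardy_bound_def
proof (intro conjI allI impI)
  show "(\<lambda>z. H z * F z) holomorphic_on C_plus" using F H by (intro holomorphic_intros) (auto simp: Hardy_bound_def)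
  fix y :: real assume y: "y > 0"
  have [measurable]: "(\<lambda>x. F (Complex x y)) \<in> borel_measurable borel"
    using F y by (intro horizontal_borel) (auto simp: Hardy_bound_def)
  have "(\<integral>\<^sup>+x. ennreal (cmod (H (Complex x y) * F (Complex x y)) powr p) \<partial>lebesgue)
    \<le> (\<integral>\<^sup>+x. ennreal (B powr p) * ennreal (cmod (F (Complex x y)) powr p) \<partial>lebesgue)"
  proof (intro nn_integral_mono)
    fix x
    have "cmod (H (Complex x y) * F (Complex x y)) powr p \<le> (B * cmod (F (Complex x y))) powr p"
      using H(3)[of "Complex x y"] y p by (intro powr_mono2) (auto simp: norm_mult mult_right_mono)
    also have "\<dots> = B powr p * cmod (F (Complex x y)) powr p" using H(2) by (simp add: powr_mult)
    finally show "ennreal (cmod (H (Complex x y) * F (Complex x y)) powr p) \<le> ennreal (B powr p) * ennreal (cmod (F (Complex x y)) powr p)"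
      by (simp add: ennreal_mult[symmetric] ennreal_leI)
  qed
  also have "\<dots> = ennreal (B powr p) * Lp_mass p F y"
    by (intro nn_integral_cmult) (simp add: measurable_completion)
  also have "\<dots> \<le> ennreal (B powr p) * ennreal C"
    using F y by (intro mult_left_mono) (auto simp: Hardy_bound_def)
  also have "\<dots> = ennreal (B powr p * C)" by (simp add: ennreal_mult')
  finally show "(\<integral>\<^sup>+x. ennreal (cmod (H (Complex x y) * F (Complex x y)) powr p) \<partial>lebesgue) \<le> ennreal (B powr p * C)" .
qed

lemma Hardy_bound_cong:
  assumes "\<And>z. Im z > 0 \<Longrightarrow> F z = G z"
  shows "Hardy_bound p C F \<longleftrightarrow> Hardy_bound p C G"
proof -
  have "F holomorphic_on C_plus \<longleftrightarrow> G holomorphic_on C_plus"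
    by (rule holomorphic_cong) (use assms in auto)
  then show ?thesis unfolding Hardy_bound_def using assms by auto
qed

lemma wt_quot_vertical_limit:
  assumes S: "finite S" and x: "x \<notin> S" and F: "vlim F x l"
  shows "vlim (wt_quot S e a n F) x (l / wt S e a x * (of_real x + \<i>) powi n)"
proof -
  have l: "((\<lambda>y. Complex x y) \<longlongrightarrow> of_real x) (at_right 0)"
    unfolding complex_of_real_def by (intro tendsto_Complex tendsto_intros)
  have "wt S e a x \<noteq> 0" using x by (intro wt_nonzero S) auto
  then show ?thesis
    unfolding wt_quot_def using plus_i_nonzero[of "of_real x"]
    by (intro tendsto_intros F wt_vertical_limit x l) auto
qed

lemma wt_poly_vertical_limit:
  assumes "x \<notin> S"
  shows "((\<lambda>y. wt S e a (Complex x y) * (poly P (Complex x y) * (Complex x y + \<i>) powi n)) \<longlongrightarrow>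
     wt S e a x * (poly P (of_real x) * (of_real x + \<i>) powi n)) (at_right 0)"
proof -
  have l: "((\<lambda>y. Complex x y) \<longlongrightarrow> of_real x) (at_right 0)"
    unfolding complex_of_real_def by (intro tendsto_Complex tendsto_intros)
  show ?thesis using plus_i_nonzero[of "of_real x"]
    by (intro tendsto_intros wt_vertical_limit assms l) auto
qed

lemma r_powi: "r x powi (- n) = (of_real x + \<i>) powi n / cnj (of_real x + \<i>) powi n"
proof -
  have "r x = cnj (of_real x + \<i>) / (of_real x + \<i>)" by (simp add: r_def)
  then show ?thesis by (simp add: power_int_divide_distrib power_int_minus)
qed

lemma AE_lebesgue_not_in_finite: "finite S \<Longrightarrow> AE x in lebesgue. x \<notin> (S :: real set)"
  by (intro AE_completion AE_not_in finite_imp_null_set_lborel)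

subsection \<open>The kernel\<close>

text \<open>Restricting coefficients instead of the degree keeps the zero polynomial, and nothing
  else, when \<open>N = 0\<close>.\<close>

definition ker_polys :: "real set \<Rightarrow> nat \<Rightarrow> complex poly set" where
  "ker_polys T N = {P. (\<forall>j\<ge>N. coeff P j = 0) \<and> (\<forall>d\<in>T. poly P (of_real d) = 0)}"

text \<open>The prescribed zeros are real, so conjugating the coefficients preserves them.\<close>

lemma map_poly_cnj_ker_polys:
  assumes "P \<in> ker_polys T N" shows "map_poly cnj P \<in> ker_polys T N"
proof -
  have "poly (map_poly cnj P) (of_real d) = cnj (poly P (of_real d))" for d
    using poly_cnj[of P "of_real d"] by simp
  then show ?thesis using assms by (auto simp: ker_polys_def coeff_map_poly)
qed

text \<open>The bounded factors are removed first: \<open>\<phi>\<close> is multiplied by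
  \<open>h_plus\<close>, and the conjugate of \<open>g * \<phi>\<close> by the conjugate of an
  inverse of \<open>h_minus\<close>. The quotients of the results by the weight have conjugate
  limits and hence give a polynomial; membership of the weighted polynomial in the Hardy class then
  imposes its zeros and, in the extreme case, the lower degree.\<close>

lemma toeplitz_ker_subset:
  assumes p: "p > 1" and S: "finite S"
    and e: "\<And>c. c \<in> S \<Longrightarrow> - (1 - 1 / p) < e c" "\<And>c. c \<in> S \<Longrightarrow> e c \<le> 1 / p"
    and a: "- 1 / p < a" "a \<le> 1 - 1 / p"
    and hm: "h_minus \<in> G_Hardy_inf C_minus" and hp: "h_plus \<in> G_Hardy_inf C_plus"
    and g: "AE x in lebesgue. g x * wt S e a x = h_minus x * r x powi (- n) * h_plus x * cnj (wt S e a x)"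
    and \<phi>: "\<phi> \<in> toeplitz_ker p g"
  shows "\<exists>P\<in>ker_polys {c \<in> S. e c = 1 / p} (nat (if a = 1 - 1 / p then n - 1 else n)).
       AE x in lebesgue. \<phi> x = inverse (h_plus x) * wt S e a x * (poly P (of_real x) * (of_real x + \<i>) powi (- n))"
proof -
  have \<phi>1: "\<phi> \<in> Hardy C_plus p" and \<phi>2: "(\<lambda>x. cnj (g x * \<phi> x)) \<in> Hardy C_plus p"
    using \<phi> unfolding toeplitz_ker_iff Hardy_minus_iff by auto
  obtain F C where F: "C \<ge> 0" "Hardy_bound p C F" "AE x in lebesgue. vlim F x (\<phi> x)"
    using \<phi>1 unfolding Hardy_plus_iff by blast
  obtain Fm Cm where Fm: "Cm \<ge> 0" "Hardy_bound p Cm Fm" "AE x in lebesgue. vlim Fm x (cnj (g x * \<phi> x))"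
    using \<phi>2 unfolding Hardy_plus_iff by blast
  obtain qp where qp: "h_plus \<in> Hardy_inf C_plus" "AE x in lebesgue. h_plus x * qp x = 1"
    using hp unfolding G_Hardy_inf_def by blast
  obtain qm where qm: "qm \<in> Hardy_inf C_minus" "AE x in lebesgue. h_minus x * qm x = 1"
    using hm unfolding G_Hardy_inf_def by blast
  have qm': "(\<lambda>x. cnj (qm x)) \<in> Hardy_inf C_plus"
    using Hardy_inf_cnj[OF open_halfspace_Im_lt qm(1)] by (simp only: vimage_cnj_halfplanes)
  obtain H B where H: "H holomorphic_on C_plus" "B \<ge> 0" "\<And>z. Im z > 0 \<Longrightarrow> cmod (H z) \<le> B"
    "AE x in lebesgue. vlim H x (h_plus x)"
    using Hardy_inf_plusE[OF qp(1)] by blast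
  obtain Q Bq where Q: "Q holomorphic_on C_plus" "Bq \<ge> 0" "\<And>z. Im z > 0 \<Longrightarrow> cmod (Q z) \<le> Bq"
    "AE x in lebesgue. vlim Q x (cnj (qm x))"
    using Hardy_inf_plusE[OF qm'] by blast
  define F1 F2 where "F1 = (\<lambda>z. H z * F z)" and "F2 = (\<lambda>z. Q z * Fm z)"
  define C' where "C' = max (B powr p * C) (Bq powr p * Cm)"
  have mono: "Hardy_bound p C1 G \<Longrightarrow> C1 \<le> C2 \<Longrightarrow> Hardy_bound p C2 G" for C1 C2 G
    unfolding Hardy_bound_def by (meson ennreal_leI order_trans)
  have F1: "Hardy_bound p C' F1" unfolding F1_def
    by (rule mono[OF Hardy_bound_mult[OF F(2) H(1-3)]]) (use p in \<open>auto simp: C'_def\<close>)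
  have F2: "Hardy_bound p C' F2" unfolding F2_def
    by (rule mono[OF Hardy_bound_mult[OF Fm(2) Q(1-3)]]) (use p in \<open>auto simp: C'_def\<close>)
  have C': "C' \<ge> 0" using F(1) by (simp add: C'_def le_max_iff_disj)
  note ae = AE_lebesgue_not_in_finite[OF S]
  have lim1: "AE x in lebesgue. x \<notin> S \<and> vlim (wt_quot S e a n F1) x (h_plus x * \<phi> x / wt S e a x * (of_real x + \<i>) powi n)"
    using ae F(3) H(4)
  proof eventually_elim
    case (elim x)
    then show ?case unfolding F1_def by (intro conjI wt_quot_vertical_limit S tendsto_mult) auto
  qed
  have lim2: "AE x in lebesgue. vlim (wt_quot S e a n F2) x (cnj (h_plus x * \<phi> x / wt S e a x * (of_real x + \<i>) powi n))"
    using ae Fm(3) Q(4) qm(2) g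
  proof eventually_elim
    case (elim x)
    define v w where "v = wt S e a x" and "w = of_real x + \<i>"
    have w0: "w \<noteq> 0" using plus_i_nonzero[of "of_real x"] by (simp add: w_def)
    have v0: "v \<noteq> 0" unfolding v_def using elim(1) by (intro wt_nonzero S) auto
    from w0 v0 have nz: "v \<noteq> 0" "w \<noteq> 0" "w powi n \<noteq> 0" "cnj w powi n \<noteq> 0" by auto
    have gv: "g x * v = h_minus x * (w powi n / cnj w powi n) * h_plus x * cnj v"
      using elim(5) unfolding r_powi v_def w_def .
    \<comment> \<open>Here the symbol drops out: \<open>gv\<close> rewrites \<open>g x * v\<close>,
      the conjugated factors cancel, and \<open>qm\<close> inverts \<open>h_minus\<close>. What
      remains is the limit of the first quotient; conjugating both sides gives that of the
      second.\<close>
    have "qm x * (g x * \<phi> x) / cnj v * cnj w powi n = qm x * (g x * v) * \<phi> x / (v * cnj v) * cnj w powi n"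
      using nz by (simp add: field_simps)
    also have "\<dots> = (h_minus x * qm x) * (h_plus x * \<phi> x / v * w powi n)"
      unfolding gv using nz by (simp add: field_simps)
    finally have "qm x * (g x * \<phi> x) / cnj v * cnj w powi n = h_plus x * \<phi> x / v * w powi n"
      using elim(4) by simp
    then have "cnj (qm x * (g x * \<phi> x) / cnj v * cnj w powi n) = cnj (h_plus x * \<phi> x / v * w powi n)" by simp
    then have eq: "cnj (qm x) * cnj (g x * \<phi> x) / v * w powi n = cnj (h_plus x * \<phi> x / v * w powi n)"
      by simp
    show ?case
      unfolding F2_def v_def[symmetric] w_def[symmetric] eq[symmetric]
      unfolding v_def w_def using elim by (intro wt_quot_vertical_limit S tendsto_mult) auto
  qed
  have lim: "AE x in lborel. \<exists>l. vlim (wt_quot S e a n F1) x l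
      \<and> vlim (wt_quot S e a n F2) x (cnj l)"
  proof (rule AE_completion_iff[THEN iffD1])
    show "AE x in lebesgue. \<exists>l. vlim (wt_quot S e a n F1) x l
      \<and> vlim (wt_quot S e a n F2) x (cnj l)"
      using lim1 lim2 by eventually_elim blast
  qed
  obtain P where P: "\<And>j. int j \<ge> n \<Longrightarrow> coeff P j = 0" "\<And>z. Im z > 0 \<Longrightarrow> wt_quot S e a n F1 z = poly P z"
    by (rule wt_quot_pair_polynomial[where e = e, OF S p e(1) a(1) F1 F2 C' lim]) (auto intro: that)
  define W where "W = wt_poly S e a n P"
  have FW: "F1 z = W z" if "Im z > 0" for z
    using P(2)[OF that] unfolding wt_quot_eq_iff[OF S that] W_def .
  have HW: "Hardy_bound p C' W" using F1 Hardy_bound_cong[of F1 W] FW by blast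
  have "P \<in> ker_polys {c \<in> S. e c = 1 / p} (nat (if a = 1 - 1 / p then n - 1 else n))"
  proof -
    have "poly P (of_real d) = 0" if "d \<in> S" "e d = 1 / p" for d
      by (rule wt_poly_Hardy_vanishes[OF S p that C' HW[unfolded W_def]])
    moreover have "coeff P j = 0" if "j \<ge> nat (if a = 1 - 1 / p then n - 1 else n)" for j
    proof (cases "a = 1 - 1 / p")
      case True
      show ?thesis
        by (rule wt_poly_Hardy_degree[OF S p True C' HW[unfolded W_def] P(1)]) (use that True in auto)
    qed (use that P(1) in auto)
    ultimately show ?thesis by (auto simp: ker_polys_def)
  qed
  moreover have "AE x in lebesgue. \<phi> x = inverse (h_plus x) * wt S e a x * (poly P (of_real x) * (of_real x + \<i>) powi (- n))"
    using ae F(3) H(4) qp(2)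
  proof eventually_elim
    case (elim x)
    have "vlim F1 x (h_plus x * \<phi> x)"
      unfolding F1_def using elim by (intro tendsto_mult) auto
    moreover have "vlim F1 x (wt_poly S e a n P (of_real x))"
    proof (rule Lim_transform_eventually[OF wt_poly_vertical_limit[OF elim(1)]])
      show "\<forall>\<^sub>F y in at_right 0. wt S e a (Complex x y) * (poly P (Complex x y) * (Complex x y + \<i>) powi (- n)) = F1 (Complex x y)"
        using eventually_at_right_less[of 0] by eventually_elim (simp add: FW W_def)
    qed
    ultimately have "h_plus x * \<phi> x = wt_poly S e a n P (of_real x)"
      by (rule tendsto_unique[OF trivial_limit_at_right_real])
    moreover have "h_plus x \<noteq> 0" using elim(4) by auto
    ultimately show ?case by (simp add: field_simps)
  qed
  ultimately show ?thesis by blast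
qed

text \<open>On the real line the symbol replaces the weight and the powers of
  \<open>x + \<i>\<close> by their conjugates. Hence the conjugate of \<open>g * \<phi>\<close> is
  again a bounded function times a weighted polynomial, now with conjugated coefficients, and the
  one membership statement \<open>gen\<close> serves both halves.\<close>

lemma toeplitz_ker_superset:
  assumes p: "p > 1" and S: "finite S"
    and e: "\<And>c. c \<in> S \<Longrightarrow> e c \<le> 1 / p"
    and a: "a \<le> 1 - 1 / p"
    and hm: "h_minus \<in> G_Hardy_inf C_minus" and hp: "h_plus \<in> G_Hardy_inf C_plus"
    and g: "AE x in lebesgue. g x * wt S e a x = h_minus x * r x powi (- n) * h_plus x * cnj (wt S e a x)"
    and P: "P \<in> ker_polys {c \<in> S. e c = 1 / p} (nat (if a = 1 - 1 / p then n - 1 else n))"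
    and \<phi>: "AE x in lebesgue. \<phi> x = inverse (h_plus x) * wt S e a x * (poly P (of_real x) * (of_real x + \<i>) powi (- n))"
  shows "\<phi> \<in> toeplitz_ker p g"
proof -
  obtain qp where qp: "qp \<in> Hardy_inf C_plus" "AE x in lebesgue. h_plus x * qp x = 1"
    using hp unfolding G_Hardy_inf_def by blast
  have hm': "(\<lambda>x. cnj (h_minus x)) \<in> Hardy_inf C_plus"
  proof -
    have "h_minus \<in> Hardy_inf C_minus" using hm by (simp add: G_Hardy_inf_def)
    from Hardy_inf_cnj[OF open_halfspace_Im_lt this] show ?thesis by (simp only: vimage_cnj_halfplanes)
  qed
  have gen: "(\<lambda>x. q x * (wt_poly S e a n R (of_real x))) \<in> Hardy C_plus p"
    if q: "q \<in> Hardy_inf C_plus" and R: "R \<in> ker_polys {c \<in> S. e c = 1 / p} (nat (if a = 1 - 1 / p then n - 1 else n))" for q R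
  proof -
    obtain H B where H: "H holomorphic_on C_plus" "B \<ge> 0" "\<And>z. Im z > 0 \<Longrightarrow> cmod (H z) \<le> B"
      "AE x in lebesgue. vlim H x (q x)"
      using Hardy_inf_plusE[OF q] by blast
    define W where "W = wt_poly S e a n R"
    obtain C where C: "C \<ge> 0" "Hardy_bound p C W"
      unfolding W_def
    proof (rule wt_poly_Hardy[OF S p e])
      show "poly R (of_real c) = 0" if "c \<in> S" "e c = 1 / p" for c using R that by (auto simp: ker_polys_def)
      assume "R \<noteq> 0"
      then have "degree R < nat (if a = 1 - 1 / p then n - 1 else n)"
        using R by (auto simp: ker_polys_def not_le[symmetric])
      then have "int (degree R) + 1 \<le> (if a = 1 - 1 / p then n - 1 else n)" by linarith
      then have "real (degree R) + 1 \<le> real_of_int (if a = 1 - 1 / p then n - 1 else n)"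
        by (metis of_int_1 of_int_add of_int_le_iff of_int_of_nat_eq)
      moreover have "1 / p > 0" using p by simp
      ultimately show "a + real (degree R) - real_of_int n < - 1 / p"
        using a by (cases "a = 1 - 1 / p") auto
    qed blast
    have "Hardy_bound p (B powr p * C) (\<lambda>z. H z * W z)"
      by (rule Hardy_bound_mult[OF C(2) H(1-3)]) (use p in auto)
    moreover have "AE x in lebesgue. ((\<lambda>y. H (Complex x y) * W (Complex x y)) \<longlongrightarrow> q x * (wt_poly S e a n R (of_real x))) (at_right 0)"
      using AE_lebesgue_not_in_finite[OF S] H(4)
      by eventually_elim (auto simp: W_def intro!: tendsto_mult[OF _ wt_poly_vertical_limit])
    moreover have "B powr p * C \<ge> 0" using C by simp
    ultimately show ?thesis unfolding Hardy_plus_iff by blast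
  qed
  have cong: "f \<in> Hardy C_plus p" if f': "f' \<in> Hardy C_plus p" and ae: "AE x in lebesgue. f x = f' x" for f f'
  proof -
    obtain F C where F: "C \<ge> 0" "Hardy_bound p C F" "AE x in lebesgue. vlim F x (f' x)"
      using f' unfolding Hardy_plus_iff by blast
    have "AE x in lebesgue. vlim F x (f x)"
      using F(3) ae by eventually_elim (simp only:)
    then show ?thesis using F unfolding Hardy_plus_iff by blast
  qed
  have "\<phi> \<in> Hardy C_plus p"
  proof (rule cong[OF gen[OF qp(1) P]])
    show "AE x in lebesgue. \<phi> x = qp x * (wt_poly S e a n P (of_real x))"
      using \<phi> qp(2)
    proof eventually_elim
      case (elim x)
      then have "inverse (h_plus x) = qp x" by (metis inverse_unique)
      then show ?case using elim(1) by (simp add: mult.assoc)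
    qed
  qed
  moreover have "(\<lambda>x. cnj (g x * \<phi> x)) \<in> Hardy C_plus p"
  proof (rule cong[OF gen[OF hm' map_poly_cnj_ker_polys[OF P]]])
    show "AE x in lebesgue. cnj (g x * \<phi> x) = cnj (h_minus x) * (wt S e a x * (poly (map_poly cnj P) (of_real x) * (of_real x + \<i>) powi (- n)))"
      using \<phi> qp(2) g
    proof eventually_elim
      case (elim x)
      define v w where "v = wt S e a x" and "w = of_real x + \<i>"
      have w0: "w \<noteq> 0" using plus_i_nonzero[of "of_real x"] by (simp add: w_def)
      then have nz: "w powi n \<noteq> 0" "cnj w powi n \<noteq> 0" "h_plus x \<noteq> 0" using elim(2) by auto
      have gv: "g x * v = h_minus x * (w powi n / cnj w powi n) * h_plus x * cnj v"
        using elim(3) unfolding r_powi v_def w_def .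
      have "g x * \<phi> x = (g x * v) * (inverse (h_plus x) * (poly P (of_real x) * w powi (- n)))"
        unfolding elim(1) v_def w_def by (simp add: mult_ac)
      also have "\<dots> = h_minus x * (cnj v * (poly P (of_real x) * cnj w powi (- n)))"
        unfolding gv using nz w0 by (simp add: power_int_minus field_simps)
      finally have "cnj (g x * \<phi> x) = cnj (h_minus x * (cnj v * (poly P (of_real x) * cnj w powi (- n))))" by simp
      also have "\<dots> = cnj (h_minus x) * (v * (cnj (poly P (of_real x)) * w powi (- n)))" by simp
      also have "cnj (poly P (of_real x)) = poly (map_poly cnj P) (of_real x)"
        using poly_cnj[of P "of_real x"] by (simp only: complex_cnj_complex_of_real)
      finally show ?case unfolding v_def w_def .
    qed
  qed
  ultimately show ?thesis unfolding toeplitz_ker_iff Hardy_minus_iff by blast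
qed

lemma poly_eq_sum_lessThan:
  fixes P :: "'a::comm_semiring_1 poly"
  assumes "\<And>j. j \<ge> n \<Longrightarrow> coeff P j = 0"
  shows "poly P x = (\<Sum>j<n. coeff P j * x ^ j)"
proof -
  have "P = (\<Sum>j<n. monom (coeff P j) j)"
    by (rule poly_eqI) (auto simp: coeff_sum assms not_less)
  then have "poly P x = poly (\<Sum>j<n. monom (coeff P j) j) x" by simp
  then show ?thesis by (simp add: poly_sum poly_monom)
qed

subsection \<open>Rational functions and dimension\<close>

abbreviation poly_quot :: "nat \<Rightarrow> complex poly \<Rightarrow> real \<Rightarrow> complex" where
  "poly_quot n P \<equiv> (\<lambda>x. poly P (of_real x) * (of_real x + \<i>) powi (- int n))"

text \<open>Both inclusions are explicit substitutions. One puts the generators over the common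
  denominator \<open>(x + \<i>) ^ n\<close>; the other inverts the Moebius map, expressing
  \<open>x / (x + \<i>)\<close> and \<open>1 / (x + \<i>)\<close> as polynomials of degree 1 in
  \<open>r x\<close>.\<close>

lemma K_r_eq:
  "K_r n = {\<psi>. \<exists>P. (\<forall>j\<ge>n. coeff P j = 0) \<and> \<psi> = poly_quot n P}"
proof (cases n)
  case 0
  have "(\<forall>j. coeff P j = 0) \<longleftrightarrow> P = 0" for P :: "complex poly" by (auto intro: poly_eqI)
  then show ?thesis using 0 by (simp add: K_r_def)
next
  case (Suc m)
  have w: "of_real x + \<i> \<noteq> 0" for x using plus_i_nonzero[of "of_real x"] by simp
  show ?thesis
  proof (intro set_eqI iffI)
    fix \<psi> assume "\<psi> \<in> K_r n"
    then obtain a where a: "\<psi> = (\<lambda>\<xi>. \<Sum>j<n. a j * (1 / (of_real \<xi> + \<i>) * r \<xi> ^ j))" unfolding K_r_def by blast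
    define P where "P = (\<Sum>j<n. smult (a j) ([:-\<i>, 1:] ^ j * [:\<i>, 1:] ^ (m - j)))"
    have "coeff P i = 0" if "i \<ge> n" for i
    proof -
      have "coeff ([:-\<i>, 1:] ^ j * [:\<i>, 1:] ^ (m - j)) i = 0" if "j < n" for j
      proof (rule coeff_eq_0)
        have "degree ([:-\<i>, 1:] ^ j * [:\<i>, 1:] ^ (m - j)) \<le> j + (m - j)"
          by (rule order_trans[OF degree_mult_le]) (auto intro!: add_mono order_trans[OF degree_power_le])
        then show "degree ([:-\<i>, 1:] ^ j * [:\<i>, 1:] ^ (m - j)) < i" using that \<open>i \<ge> n\<close> Suc by simp
      qed
      then show ?thesis by (simp add: P_def coeff_sum)
    qed
    moreover have "\<psi> x = poly_quot n P x" for x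
    proof -
      define w where "w = of_real x + \<i>"
      have w0: "w \<noteq> 0" using w by (simp add: w_def)
      have "1 / w * r x ^ j = (of_real x - \<i>) ^ j * w ^ (m - j) * w powi (- int n)" if "j < n" for j
      proof -
        have n: "n = j + (m - j) + 1" using that Suc by simp
        have "w powi (- int n) = 1 / (w ^ j * w ^ (m - j) * w)"
          unfolding power_int_minus power_int_of_nat by (subst n) (simp add: power_add inverse_eq_divide)
        then show ?thesis using w0 by (simp add: r_def power_divide w_def[symmetric])
      qed
      then have "\<psi> x = (\<Sum>j<n. a j * ((of_real x - \<i>) ^ j * w ^ (m - j) * w powi (- int n)))"
        unfolding a w_def[symmetric] by (intro sum.cong refl) (simp only: lessThan_iff)
      also have "\<dots> = poly P (of_real x) * w powi (- int n)"
      proof -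
        have "poly [:-\<i>, 1:] (of_real x) = of_real x - \<i>" "poly [:\<i>, 1:] (of_real x) = w" by (simp_all add: w_def)
        then show ?thesis
          unfolding P_def by (simp only: poly_sum poly_smult poly_mult poly_power sum_distrib_right mult.assoc)
      qed
      finally show ?thesis unfolding w_def .
    qed
    ultimately show "\<psi> \<in> {\<psi>. \<exists>P. (\<forall>j\<ge>n. coeff P j = 0) \<and> \<psi> = poly_quot n P}"
      by blast
  next
    fix \<psi> assume "\<psi> \<in> {\<psi>. \<exists>P. (\<forall>j\<ge>n. coeff P j = 0) \<and> \<psi> = poly_quot n P}"
    then obtain P where P: "\<And>j. j \<ge> n \<Longrightarrow> coeff P j = 0" "\<psi> = poly_quot n P" by blast
    \<comment> \<open>The two linear factors evaluate at \<open>r x\<close> to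
      \<open>x / (x + \<i>)\<close> and \<open>1 / (x + \<i>)\<close>; each monomial is made
      homogeneous of degree \<open>m = n - 1\<close>, and one more factor
      \<open>1 / (x + \<i>)\<close> stays outside.\<close>
    define Q where "Q = (\<Sum>l<n. smult (coeff P l) ([:1 / 2, 1 / 2:] ^ l * [:1 / (2 * \<i>), - 1 / (2 * \<i>):] ^ (m - l)))"
    have Q: "coeff Q i = 0" if "i \<ge> n" for i
    proof -
      have "coeff ([:1 / 2, 1 / 2:] ^ l * [:1 / (2 * \<i>), - 1 / (2 * \<i>):] ^ (m - l)) i = 0" if "l < n" for l
      proof (rule coeff_eq_0)
        have "degree ([:1 / 2, 1 / 2:] ^ l * [:1 / (2 * \<i>), - 1 / (2 * \<i>):] ^ (m - l)) \<le> l + (m - l)"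
          by (rule order_trans[OF degree_mult_le]) (auto intro!: add_mono order_trans[OF degree_power_le])
        then show "degree ([:1 / 2, 1 / 2:] ^ l * [:1 / (2 * \<i>), - 1 / (2 * \<i>):] ^ (m - l)) < i" using that \<open>i \<ge> n\<close> Suc by simp
      qed
      then show ?thesis by (simp add: Q_def coeff_sum)
    qed
    have "\<psi> x = (\<Sum>j<n. coeff Q j * (1 / (of_real x + \<i>) * r x ^ j))" for x
    proof -
      define w where "w = of_real x + \<i>"
      have w0: "w \<noteq> 0" using w by (simp add: w_def)
      have x: "of_real x = w - \<i>" by (simp add: w_def)
      have rx: "r x = 1 - 2 * \<i> / w" using w0 unfolding r_def w_def[symmetric] by (simp add: x diff_divide_distrib)
      have 1: "1 / 2 + r x * (1 / 2) = of_real x / w" "1 / (2 * \<i>) + r x * (- 1 / (2 * \<i>)) = 1 / w"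
        using w0 by (simp_all add: rx x algebra_simps diff_divide_distrib)
      have "(of_real x / w) ^ l * (1 / w) ^ (m - l) * (1 / w) = of_real x ^ l * w powi (- int n)" if "l < n" for l
      proof -
        have n: "n = l + (m - l) + 1" using that Suc by simp
        have "w powi (- int n) = 1 / (w ^ l * w ^ (m - l) * w)"
          unfolding power_int_minus power_int_of_nat by (subst n) (simp add: power_add inverse_eq_divide)
        then show ?thesis by (simp add: power_divide)
      qed
      then have "(\<Sum>l<n. coeff P l * ((of_real x / w) ^ l * (1 / w) ^ (m - l) * (1 / w))) = (\<Sum>l<n. coeff P l * (of_real x ^ l * w powi (- int n)))"
        by (intro sum.cong refl) simp
      also have "\<dots> = \<psi> x"
        unfolding P(2) w_def by (subst poly_eq_sum_lessThan[of n P, OF P(1)]) (simp_all add: sum_distrib_right mult.assoc)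
      also have "(\<Sum>l<n. coeff P l * ((of_real x / w) ^ l * (1 / w) ^ (m - l) * (1 / w))) = poly Q (r x) * (1 / w)"
        unfolding Q_def by (simp only: poly_sum poly_smult poly_mult poly_power poly_pCons poly_0 mult_zero_right add_0_right 1 sum_distrib_right mult.assoc)
      also have "\<dots> = (\<Sum>j<n. coeff Q j * (1 / w * r x ^ j))"
        by (subst poly_eq_sum_lessThan[of n Q, OF Q]) (simp_all add: sum_divide_distrib)
      finally show ?thesis by (simp add: w_def)
    qed
    then show "\<psi> \<in> K_r n" unfolding K_r_def by blast
  qed
qed

section \<open>Linear algebra and the dimension count\<close>

lemma homogeneous_system_nontrivial:
  fixes v :: "'i \<Rightarrow> nat \<Rightarrow> 'a::field"
  assumes "finite I" "m < card I"
  shows "\<exists>a. (\<exists>i\<in>I. a i \<noteq> 0) \<and> (\<forall>j<m. (\<Sum>i\<in>I. a i * v i j) = 0)"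
  using assms
proof (induction m arbitrary: I v)
  case 0
  then have "I \<noteq> {}" by auto
  then show ?case by (intro exI[of _ "\<lambda>_. 1"]) auto
next
  case (Suc m)
  show ?case
  proof (cases "\<forall>i\<in>I. v i m = 0")
    case True
    from Suc obtain a where a: "\<exists>i\<in>I. a i \<noteq> 0" "\<forall>j<m. (\<Sum>i\<in>I. a i * v i j) = 0" by (meson Suc_lessD)
    then show ?thesis using True by (intro exI[of _ a]) (auto simp: less_Suc_eq)
  next
    case False
    then obtain i0 where i0: "i0 \<in> I" "v i0 m \<noteq> 0" by blast
    define q where "q = (\<lambda>i. v i m / v i0 m)"
    have "card (I - {i0}) = card I - 1" by (rule card_Diff_singleton[OF i0(1)])
    with Suc.prems(2) have card: "m < card (I - {i0})" by arith
    obtain a where a: "\<exists>i\<in>I - {i0}. a i \<noteq> 0" "\<forall>j<m. (\<Sum>i\<in>I - {i0}. a i * (v i j - q i * v i0 j)) = 0"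
      using Suc.IH[of "I - {i0}" "\<lambda>i j. v i j - q i * v i0 j"] card Suc.prems(1) by blast
    \<comment> \<open>One step of elimination: the coefficient at the pivot \<open>i0\<close> is
      chosen to satisfy equation \<open>m\<close>, and \<open>eq\<close> shows that the remaining
      equations become those of the reduced system.\<close>
    define b where "b = (\<lambda>i. if i = i0 then - (\<Sum>i\<in>I - {i0}. a i * q i) else a i)"
    have eq: "(\<Sum>i\<in>I. b i * v i j) = (\<Sum>i\<in>I - {i0}. a i * (v i j - q i * v i0 j))" for j
    proof -
      have "(\<Sum>i\<in>I. b i * v i j) = b i0 * v i0 j + (\<Sum>i\<in>I - {i0}. b i * v i j)"
        using Suc.prems i0 by (simp add: sum.remove)
      also have "(\<Sum>i\<in>I - {i0}. b i * v i j) = (\<Sum>i\<in>I - {i0}. a i * v i j)"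
        by (intro sum.cong) (auto simp: b_def)
      also have "b i0 = - (\<Sum>i\<in>I - {i0}. a i * q i)" by (simp add: b_def)
      finally show ?thesis by (simp add: sum_subtractf sum_distrib_right right_diff_distrib mult.assoc)
    qed
    have "(\<Sum>i\<in>I. b i * v i j) = 0" if "j < Suc m" for j
    proof (cases "j = m")
      case True
      show ?thesis unfolding eq True using i0 by (intro sum.neutral) (auto simp: q_def)
    next
      case False
      then show ?thesis unfolding eq using a(2) that by auto
    qed
    moreover have "\<exists>i\<in>I. b i \<noteq> 0" using a(1) by (auto simp: b_def)
    ultimately show ?thesis by blast
  qed
qed

lemma poly_AE_zero:
  fixes P :: "complex poly"
  assumes "AE x in lebesgue. poly P (of_real x) = 0"
  shows "P = 0"
proof (rule ccontr)
  assume "P \<noteq> 0"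
  then have "finite {z. poly P z = 0}" by (rule poly_roots_finite)
  then have "finite {x::real. poly P (of_real x) = 0}"
    by (rule finite_subset[OF _ finite_vimageI[of _ "of_real :: real \<Rightarrow> complex"], rotated]) (auto intro: injI)
  from AE_lebesgue_not_in_finite[OF this] have "AE x in lebesgue. poly P (of_real x) \<noteq> 0" by simp
  with assms have "AE x::real in lebesgue. False" by eventually_elim simp
  then have "ae_filter (lebesgue :: real measure) = bot" by (simp add: trivial_limit_def)
  then show False by (simp add: ae_filter_eq_bot_iff)
qed

text \<open>Division by the product \<open>D\<close> of the linear factors identifies
  \<open>ker_polys T N\<close> with the polynomials having fewer than \<open>N - card T\<close>
  coefficients. Truncated subtraction is right when there are more zeros than coefficients: then
  only the zero polynomial remains.\<close>

lemma ae_dim_ker_polys: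
  assumes T: "finite T" and M: "AE x in lebesgue. M x \<noteq> 0"
  shows "ae_dim {\<phi>. \<exists>P\<in>ker_polys T N. AE x in lebesgue. \<phi> x = M x * poly P (of_real x)} = enat (N - card T)"
    (is "ae_dim ?V = _")
proof -
  define D where "D = (\<Prod>d\<in>T. [:- complex_of_real d, 1:])"
  have D0: "D \<noteq> 0" using T by (auto simp: D_def prod_zero_iff)
  have degD: "degree D = card T" unfolding D_def by (rule degree_prod_linear[OF T])
  have Dz: "poly D (of_real d) = 0" if "d \<in> T" for d using that T by (auto simp: D_def poly_prod prod_zero_iff)
  define m where "m = N - card T"
  have "enat m \<le> ae_dim ?V"
    unfolding ae_dim_def
  proof (rule SUP_upper, rule CollectI)
    \<comment> \<open>Multiples of \<open>D\<close> by the monomials of index below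
      \<open>m\<close>; independence transfers from polynomials because \<open>M\<close> is nonzero
      almost everywhere.\<close>
    define b where "b = (\<lambda>i x. M x * poly (D * monom 1 i) (of_real x))"
    have "b i \<in> ?V" if "i < m" for i
    proof -
      have "coeff (D * monom 1 i) j = 0" if "j \<ge> N" for j
      proof (rule coeff_eq_0)
        have "degree (D * monom 1 i) \<le> card T + i"
          using degree_mult_le[of D "monom 1 i"] by (simp add: degD degree_monom_eq)
        then show "degree (D * monom 1 i) < j" using \<open>i < m\<close> that by (simp add: m_def)
      qed
      then have "D * monom 1 i \<in> ker_polys T N" using Dz by (auto simp: ker_polys_def)
      then show ?thesis unfolding b_def by blast
    qed
    moreover have "ae_independent m b"
      unfolding ae_independent_def
    proof (intro allI impI)
      fix a :: "nat \<Rightarrow> complex" and i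
      assume z: "AE x in lebesgue. (\<Sum>i<m. a i * b i x) = 0" and i: "i < m"
      define R where "R = (\<Sum>i<m. monom (a i) i)"
      have "AE x in lebesgue. poly (D * R) (of_real x) = 0"
        using z M
      proof eventually_elim
        case (elim x)
        have "(\<Sum>i<m. a i * b i x) = M x * poly (D * R) (of_real x)"
          by (simp add: b_def R_def poly_sum poly_monom sum_distrib_left mult_ac)
        then show ?case using elim by simp
      qed
      then have "D * R = 0" by (rule poly_AE_zero)
      then have "R = 0" using D0 by simp
      then have "coeff R i = 0" by simp
      then show "a i = 0" using i by (simp add: R_def coeff_sum)
    qed
    ultimately show "\<exists>b. (\<forall>i<m. b i \<in> ?V) \<and> ae_independent m b" by blast
  qed
  moreover have "ae_dim ?V \<le> enat m"
    unfolding ae_dim_def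
  proof (rule SUP_least)
    fix n assume "n \<in> {n. \<exists>b. (\<forall>i<n. b i \<in> ?V) \<and> ae_independent n b}"
    then obtain b where b: "\<And>i. i < n \<Longrightarrow> b i \<in> ?V" "ae_independent n b" by blast
    have "\<exists>P. i < n \<longrightarrow> P \<in> ker_polys T N \<and> (AE x in lebesgue. b i x = M x * poly P (of_real x))" for i
      using b(1)[of i] by blast
    then obtain P where P: "\<And>i. i < n \<Longrightarrow> P i \<in> ker_polys T N" "\<And>i. i < n \<Longrightarrow> AE x in lebesgue. b i x = M x * poly (P i) (of_real x)"
      by metis
    have "\<exists>Q. P i = D * Q" if "i < n" for i
      unfolding D_def using P(1)[OF that] by (intro poly_vanishing_factor T) (auto simp: ker_polys_def)
    then obtain Q where Q: "\<And>i. i < n \<Longrightarrow> P i = D * Q i" by metis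
    have Qz: "coeff (Q i) j = 0" if i: "i < n" and j: "j \<ge> m" for i j
    proof (cases "Q i = 0")
      case False
      have "P i \<noteq> 0" using False D0 Q[OF i] by simp
      moreover have "degree (P i) = card T + degree (Q i)"
        unfolding Q[OF i] degD[symmetric] using False D0 by (rule degree_mult_eq[rotated])
      moreover have "coeff (P i) (degree (P i)) \<noteq> 0" using \<open>P i \<noteq> 0\<close> by simp
      ultimately have "degree (P i) < N" using P(1)[OF i] unfolding ker_polys_def by (metis (mono_tags, lifting) mem_Collect_eq not_le)
      then have "degree (Q i) < j" using j \<open>degree (P i) = card T + degree (Q i)\<close> by (simp add: m_def)
      then show ?thesis by (rule coeff_eq_0)
    qed simp
    show "enat n \<le> enat m"
    proof (rule ccontr)
      assume "\<not> enat n \<le> enat m"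
      \<comment> \<open>The quotients by \<open>D\<close> have only \<open>m\<close> coefficients,
        so more than \<open>m\<close> of them satisfy a nontrivial linear relation, which carries
        over to the functions almost everywhere.\<close>
      then have "m < card {..<n}" by simp
      from homogeneous_system_nontrivial[OF _ this, of "\<lambda>i. coeff (Q i)"]
      obtain a where a: "\<exists>i\<in>{..<n}. a i \<noteq> 0" "\<forall>j<m. (\<Sum>i<n. a i * coeff (Q i) j) = 0" by auto
      have "(\<Sum>i<n. smult (a i) (Q i)) = 0"
      proof (rule poly_eqI)
        fix j
        show "coeff (\<Sum>i<n. smult (a i) (Q i)) j = coeff 0 j"
          using a(2) Qz by (cases "j < m") (auto simp: coeff_sum intro!: sum.neutral)
      qed
      then have z: "(\<Sum>i<n. a i * poly (Q i) x) = 0" for x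
        by (metis (no_types, lifting) poly_0 poly_smult poly_sum sum.cong)
      have "AE x in lebesgue. \<forall>i\<in>{..<n}. b i x = M x * poly (P i) (of_real x)"
        using P(2) by (intro AE_finite_allI) auto
      then have "AE x in lebesgue. (\<Sum>i<n. a i * b i x) = 0"
      proof eventually_elim
        case (elim x)
        have "(\<Sum>i<n. a i * b i x) = (\<Sum>i<n. (M x * poly D (of_real x)) * (a i * poly (Q i) (of_real x)))"
          using elim Q by (intro sum.cong) (auto simp: mult_ac)
        also have "\<dots> = 0" unfolding sum_distrib_left[symmetric] z by simp
        finally show ?case .
      qed
      then show False using b(2) a(1) unfolding ae_independent_def by auto
    qed
  qed
  ultimately show ?thesis unfolding m_def by (rule antisym[rotated])
qed

text \<open>Asking for the product of \<open>g\<close> with the weight, rather than a formula for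
  \<open>g\<close>, allows the same statement to be applied to the given symbol and to
  \<open>h\<close>.\<close>

lemma toeplitz_ker_characterization:
  assumes p: "p > 1" and S: "finite S"
    and e: "\<forall>c\<in>S. - (1 - 1 / p) < e c \<and> e c \<le> 1 / p"
    and a: "- 1 / p < a" "a \<le> 1 - 1 / p"
    and hm: "h_minus \<in> G_Hardy_inf C_minus" and hp: "h_plus \<in> G_Hardy_inf C_plus"
    and g: "AE x in lebesgue. g x * wt S e a x = h_minus x * r x powi (- n) * h_plus x * cnj (wt S e a x)"
    and T: "T = {c \<in> S. e c = 1 / p}" and N: "N = nat (if a = 1 - 1 / p then n - 1 else n)"
  shows "toeplitz_ker p g = {\<phi>. \<exists>P\<in>ker_polys T N. AE x in lebesgue.
      \<phi> x = inverse (h_plus x) * wt S e a x * (poly P (of_real x) * (of_real x + \<i>) powi (- n))}"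
    and "ae_dim (toeplitz_ker p g) = enat (N - card T)"
proof -
  have e1: "- (1 - 1 / p) < e c" and e2: "e c \<le> 1 / p" if "c \<in> S" for c using e that by auto
  show eq: "toeplitz_ker p g = {\<phi>. \<exists>P\<in>ker_polys T N. AE x in lebesgue.
      \<phi> x = inverse (h_plus x) * wt S e a x * (poly P (of_real x) * (of_real x + \<i>) powi (- n))}"
    unfolding T N
  proof (intro set_eqI iffI CollectI, goal_cases)
    case (1 \<phi>)
    show ?case by (rule toeplitz_ker_subset[where e = e, OF p S e1 e2 a hm hp g 1])
  next
    case (2 \<phi>)
    then obtain P where P: "P \<in> ker_polys {c \<in> S. e c = 1 / p} (nat (if a = 1 - 1 / p then n - 1 else n))"
      "AE x in lebesgue. \<phi> x = inverse (h_plus x) * wt S e a x * (poly P (of_real x) * (of_real x + \<i>) powi (- n))"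
      by blast
    show ?case by (rule toeplitz_ker_superset[where e = e, OF p S e2 a(2) hm hp g P])
  qed
  have "AE x in lebesgue. inverse (h_plus x) * wt S e a x * (of_real x + \<i>) powi (- n) \<noteq> 0"
  proof -
    obtain qp where "AE x in lebesgue. h_plus x * qp x = 1"
      using hp unfolding G_Hardy_inf_def by blast
    with AE_lebesgue_not_in_finite[OF S] show ?thesis
    proof eventually_elim
      case (elim x)
      have "wt S e a x \<noteq> 0" using elim(1) by (intro wt_nonzero S) auto
      moreover have "of_real x + \<i> \<noteq> 0" using plus_i_nonzero[of "of_real x"] by simp
      moreover have "h_plus x \<noteq> 0" using elim(2) by auto
      ultimately show ?case by simp
    qed
  qed
  from ae_dim_ker_polys[OF _ this, of T N] S show "ae_dim (toeplitz_ker p g) = enat (N - card T)"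
    unfolding eq T by (simp add: mult_ac)
qed

lemma image_ker_polys_eq_K_r:
  "(\<exists>\<psi>\<in>{\<psi> \<in> K_r N. \<forall>j\<in>J. \<psi> (d j) = 0}. Q \<psi>) \<longleftrightarrow>
   (\<exists>P\<in>ker_polys (d ` J) N. Q (poly_quot N P))"
proof -
  have "(of_real x + \<i>) powi (- int N) \<noteq> 0" for x
    using plus_i_nonzero[of "of_real x"] by simp
  then have van: "poly P (of_real x) * (of_real x + \<i>) powi (- int N) = 0 \<longleftrightarrow> poly P (of_real x) = 0" for P x
    by (simp only: mult_eq_0_iff simp_thms)
  have "\<psi> \<in> {\<psi> \<in> K_r N. \<forall>j\<in>J. \<psi> (d j) = 0} \<longleftrightarrow>
      (\<exists>P\<in>ker_polys (d ` J) N. \<psi> = poly_quot N P)" for \<psi>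
  proof
    assume "\<psi> \<in> {\<psi> \<in> K_r N. \<forall>j\<in>J. \<psi> (d j) = 0}"
    then obtain P where P: "\<forall>j\<ge>N. coeff P j = 0" "\<psi> = poly_quot N P" "\<forall>j\<in>J. \<psi> (d j) = 0"
      unfolding K_r_eq by blast
    then have "P \<in> ker_polys (d ` J) N" unfolding ker_polys_def P(2) van by blast
    then show "\<exists>P\<in>ker_polys (d ` J) N. \<psi> = poly_quot N P"
      using P(2) by blast
  next
    assume "\<exists>P\<in>ker_polys (d ` J) N. \<psi> = poly_quot N P"
    then obtain P where P: "P \<in> ker_polys (d ` J) N" "\<psi> = poly_quot N P" by blast
    then have "\<psi> \<in> K_r N" unfolding K_r_eq ker_polys_def by blast
    moreover have "\<forall>j\<in>J. \<psi> (d j) = 0" using P(1) unfolding P(2) van ker_polys_def by blast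
    ultimately show "\<psi> \<in> {\<psi> \<in> K_r N. \<forall>j\<in>J. \<psi> (d j) = 0}" by blast
  qed
  note iff = this
  show ?thesis unfolding Bex_def[of "{\<psi> \<in> K_r N. \<forall>j\<in>J. \<psi> (d j) = 0}"] iff by blast
qed

theorem theorem8p3:
  fixes p p' \<alpha>_inf :: real and k :: int and m s :: nat
    and c d \<alpha> :: "nat \<Rightarrow> real"
    and h_minus h_plus h g :: "real \<Rightarrow> complex"
  assumes "1 < p" and "1 / p + 1 / p' = 1"
    and "h_minus \<in> G_Hardy_inf C_minus" and "h_plus \<in> G_Hardy_inf C_plus"
    and "h = (\<lambda>\<xi>. h_minus \<xi> * r \<xi> powi k * h_plus \<xi>)"
    and "g = (\<lambda>\<xi>. h \<xi> * r_pow_inf \<alpha>_inf \<xi> * (\<Prod>j=1..m. r_pow (c j) (\<alpha> j) \<xi>)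
                      * (\<Prod>j=1..s. r_pow (d j) (1 / p) \<xi>))"
    and "inj_on c {1..m}" and "inj_on d {1..s}" and "c ` {1..m} \<inter> d ` {1..s} = {}"
    and "- 1 / p < \<alpha>_inf" and "\<alpha>_inf \<le> 1 / p'"
    and "\<forall>j\<in>{1..m}. - 1 / p' < \<alpha> j \<and> \<alpha> j < 1 / p"
  shows
    "(\<alpha>_inf < 1 / p' \<longrightarrow>
        ae_dim (toeplitz_ker p g) = enat (nat (max 0 (- k - int s)))
      \<and> ae_dim (toeplitz_ker p g) = max 0 (ae_dim (toeplitz_ker p h) - enat s)
      \<and> (k < - int s \<longrightarrow>
          toeplitz_ker p g =
            {\<phi>. \<exists>\<psi> \<in> {\<psi> \<in> K_r (nat \<bar>k\<bar>). \<forall>j\<in>{1..s}. \<psi> (d j) = 0}.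
                 AE \<xi> in lebesgue. \<phi> \<xi> =
                   inverse (h_plus \<xi>) * (\<Prod>j=1..s. w_pow (d j) (1 / p) \<xi>)
                   * (\<Prod>j=1..m. w_pow (c j) (\<alpha> j) \<xi>)
                   * (of_real \<xi> + \<i>) powr of_real \<alpha>_inf * \<psi> \<xi>}))
   \<and> (\<alpha>_inf = 1 / p' \<longrightarrow>
        ae_dim (toeplitz_ker p g) = enat (nat (max 0 (- k - int s - 1)))
      \<and> ae_dim (toeplitz_ker p g) = max 0 (ae_dim (toeplitz_ker p h) - enat s - 1)
      \<and> (k < - int s - 1 \<longrightarrow>
          toeplitz_ker p g =
            {\<phi>. \<exists>\<psi> \<in> {\<psi> \<in> K_r (nat (\<bar>k\<bar> - 1)). \<forall>j\<in>{1..s}. \<psi> (d j) = 0}.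
                 AE \<xi> in lebesgue. \<phi> \<xi> =
                   inverse (h_plus \<xi>) * (\<Prod>j=1..s. w_pow (d j) (1 / p) \<xi>)
                   * (\<Prod>j=1..m. w_pow (c j) (\<alpha> j) \<xi>)
                   * ((of_real \<xi> + \<i>) powr of_real (1 / p') / (of_real \<xi> + \<i>)) * \<psi> \<xi>}))"
proof -
  have p: "p > 1" and p': "1 / p' = 1 - 1 / p" using assms(1,2) by auto
  note a = assms(10,11)[unfolded p']
  define S where "S = c ` {1..m} \<union> d ` {1..s}"
  define T where "T = d ` {1..s}"
  \<comment> \<open>Injectivity of \<open>c\<close> recovers the index, and disjointness of the two
    families keeps the points \<open>c j\<close> outside \<open>T\<close>.\<close>
  define e where "e = (\<lambda>x. if x \<in> T then 1 / p else \<alpha> (inv_into {1..m} c x))"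
  have S: "finite S" by (simp add: S_def)
  have ed: "e (d j) = 1 / p" if "j \<in> {1..s}" for j using that by (simp add: e_def T_def)
  have ec: "e (c j) = \<alpha> j" if "j \<in> {1..m}" for j
  proof -
    have "c j \<notin> T" using assms(9) that unfolding T_def by blast
    then show ?thesis using that assms(7) by (simp add: e_def)
  qed
  have pp: "1 / p > 0" "1 / p < 1" using p by auto
  have e: "\<forall>x\<in>S. - (1 - 1 / p) < e x \<and> e x \<le> 1 / p"
  proof
    fix x assume "x \<in> S"
    then consider j where "x = c j" "j \<in> {1..m}" | j where "x = d j" "j \<in> {1..s}" unfolding S_def by blast
    then show "- (1 - 1 / p) < e x \<and> e x \<le> 1 / p"
    proof cases
      case 1
      moreover have "- 1 / p' = - (1 - 1 / p)" using p' by simp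
      ultimately show ?thesis using assms(12) ec[of j] by force
    next
      case 2
      then show ?thesis using ed[of j] pp by auto
    qed
  qed
  \<comment> \<open>The exponents \<open>\<alpha> j\<close> are strictly below \<open>1 / p\<close>,
    so no \<open>c j\<close> is forced to be a zero.\<close>
  have T: "T = {x \<in> S. e x = 1 / p}"
    using ec assms(12) ed by (force simp: S_def T_def)
  have cardT: "card T = s" using assms(8) by (simp add: T_def card_image)
  have prodS: "(\<Prod>x\<in>S. f x (e x)) = (\<Prod>j=1..m. f (c j) (\<alpha> j)) * (\<Prod>j=1..s. f (d j) (1 / p))" for f :: "real \<Rightarrow> real \<Rightarrow> complex"
  proof -
    have "(\<Prod>x\<in>S. f x (e x)) = (\<Prod>x\<in>c ` {1..m}. f x (e x)) * (\<Prod>x\<in>d ` {1..s}. f x (e x))"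
      unfolding S_def using assms(9) by (intro prod.union_disjoint) auto
    also have "(\<Prod>x\<in>c ` {1..m}. f x (e x)) = (\<Prod>j=1..m. f (c j) (\<alpha> j))"
      by (subst prod.reindex[OF assms(7)]) (auto intro!: prod.cong simp: ec)
    also have "(\<Prod>x\<in>d ` {1..s}. f x (e x)) = (\<Prod>j=1..s. f (d j) (1 / p))"
      by (subst prod.reindex[OF assms(8)]) (auto intro!: prod.cong simp: ed)
    finally show ?thesis .
  qed
  have g: "AE x in lebesgue. g x * wt S e \<alpha>_inf x = h_minus x * r x powi (- (- k)) * h_plus x * cnj (wt S e \<alpha>_inf x)"
    using AE_lebesgue_not_in_finite[OF S]
  proof eventually_elim
    case (elim x)
    have "g x = h x * (r_pow_inf \<alpha>_inf x * (\<Prod>c\<in>S. r_pow c (e c) x))"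
      unfolding assms(6) prodS[of "\<lambda>c a. r_pow c a x"] by (simp add: mult_ac)
    then have "g x * wt S e \<alpha>_inf x = h x * cnj (wt S e \<alpha>_inf x)"
      by (simp only: mult.assoc symbol_mult_wt[OF elim, unfolded mult.assoc])
    then show ?case by (simp add: assms(5))
  qed
  \<comment> \<open>For the empty set and exponent 0 the weight is identically 1 on the line, so
    \<open>h\<close> fits the characterization with no zeros prescribed.\<close>
  have h: "AE x in lebesgue. h x * wt {} e 0 (of_real x) = h_minus x * r x powi (- (- k)) * h_plus x * cnj (wt {} e 0 (of_real x))"
  proof (intro AE_I2)
    fix x
    have "wt {} e 0 (of_real x) = 1" using plus_i_nonzero[of "of_real x"] by (simp add: wt_def)
    then show "h x * wt {} e 0 (of_real x) = h_minus x * r x powi (- (- k)) * h_plus x * cnj (wt {} e 0 (of_real x))"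
      by (simp add: assms(5))
  qed
  have dim_h: "ae_dim (toeplitz_ker p h) = enat (nat (- k))"
    using toeplitz_ker_characterization(2)[where S = "{}" and e = e and a = 0, OF p _ _ _ _ assms(3,4) h refl refl] pp by simp
  define N where "N = nat (if \<alpha>_inf = 1 - 1 / p then - k - 1 else - k)"
  note char = toeplitz_ker_characterization[where e = e, OF p S e a assms(3,4) g T N_def, unfolded cardT minus_minus]
  have Vx: "wt S e \<alpha>_inf x = (\<Prod>j=1..s. w_pow (d j) (1 / p) x) * (\<Prod>j=1..m. w_pow (c j) (\<alpha> j) x) * (of_real x + \<i>) powr of_real \<alpha>_inf" for x
    unfolding wt_of_real prodS[of "\<lambda>c a. w_pow c a x"] by (simp add: mult_ac)
  show ?thesis
  proof (intro conjI impI)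
    assume "\<alpha>_inf < 1 / p'"
    then have N: "N = nat (- k)" by (simp add: N_def p')
    show "ae_dim (toeplitz_ker p g) = enat (nat (max 0 (- k - int s)))"
      unfolding char(2) N by (simp add: nat_diff_distrib')
    show "ae_dim (toeplitz_ker p g) = max 0 (ae_dim (toeplitz_ker p h) - enat s)"
      unfolding char(2) N dim_h by simp
    assume k: "k < - int s"
    then have Nk: "N = nat \<bar>k\<bar>" "- int N = k" by (simp_all add: N)
    show "toeplitz_ker p g =
            {\<phi>. \<exists>\<psi> \<in> {\<psi> \<in> K_r (nat \<bar>k\<bar>). \<forall>j\<in>{1..s}. \<psi> (d j) = 0}.
                 AE \<xi> in lebesgue. \<phi> \<xi> =
                   inverse (h_plus \<xi>) * (\<Prod>j=1..s. w_pow (d j) (1 / p) \<xi>)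
                   * (\<Prod>j=1..m. w_pow (c j) (\<alpha> j) \<xi>)
                   * (of_real \<xi> + \<i>) powr of_real \<alpha>_inf * \<psi> \<xi>}"
      unfolding char(1) image_ker_polys_eq_K_r Nk(1)[symmetric] Nk(2) T_def[symmetric] Vx
      by (simp only: mult.assoc)
  next
    assume ai: "\<alpha>_inf = 1 / p'"
    then have N: "N = nat (- k - 1)" by (simp add: N_def p')
    show "ae_dim (toeplitz_ker p g) = enat (nat (max 0 (- k - int s - 1)))"
      unfolding char(2) N by simp
    show "ae_dim (toeplitz_ker p g) = max 0 (ae_dim (toeplitz_ker p h) - enat s - 1)"
      unfolding char(2) N dim_h by (simp add: one_enat_def)
    assume k: "k < - int s - 1"
    then have Nk: "N = nat (\<bar>k\<bar> - 1)" "- int N = k + 1" by (simp_all add: N)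
    \<comment> \<open>The characterization has the denominator
      \<open>(x + \<i>) ^ \<bar>k\<bar>\<close>, while the functions in \<open>K_r\<close> with
      index \<open>\<bar>k\<bar> - 1\<close> account for one power less; the remaining one is the
      denominator next to the power \<open>1 / p'\<close>.\<close>
    have w: "(of_real x + \<i>) powr of_real (1 / p') * (poly P (of_real x) * (of_real x + \<i>) powi k) =
      (of_real x + \<i>) powr of_real (1 / p') / (of_real x + \<i>) * (poly P (of_real x) * (of_real x + \<i>) powi (k + 1))" for x P
      using plus_i_nonzero[of "of_real x"] by (simp add: power_int_add_1)
    show "toeplitz_ker p g =
            {\<phi>. \<exists>\<psi> \<in> {\<psi> \<in> K_r (nat (\<bar>k\<bar> - 1)). \<forall>j\<in>{1..s}. \<psi> (d j) = 0}.
                 AE \<xi> in lebesgue. \<phi> \<xi> =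
                   inverse (h_plus \<xi>) * (\<Prod>j=1..s. w_pow (d j) (1 / p) \<xi>)
                   * (\<Prod>j=1..m. w_pow (c j) (\<alpha> j) \<xi>)
                   * ((of_real \<xi> + \<i>) powr of_real (1 / p') / (of_real \<xi> + \<i>)) * \<psi> \<xi>}"
      unfolding char(1) image_ker_polys_eq_K_r Nk(1)[symmetric] Nk(2) T_def[symmetric] Vx
      unfolding ai mult.assoc w ..
  qed
qed

end
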